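(* Let $\mathbf a_1,\mathbf a_2$ be two coefficient vectors taking values in $\mathbf D$, and let $(\mathbf m_h^{(i)},\bar\rho_h^{(i)})$, $i=1,2$, be two solutions of the semidiscrete problem: $(\mathbf m_h^{(i)},\bar\rho_h^{(i)}):I\to V_h\times Q_h$, $$\big(F(\mathbf a_i,|\mathbf m_h^{(i)}|)\mathbf m_h^{(i)},\mathbf v\big)-(\bar\rho_h^{(i)},\nabla\cdot\mathbf v)=-(\nabla\Psi,\mathbf v)\quad\text{for all }\mathbf v\in V_h,$$ $$(\phi\,\bar\rho_{ht}^{(i)},q)+(\nabla\cdot\mathbf m_h^{(i)},q)=(f,q)-(\phi\Psi_t,q)\quad\text{for all }q\in Q_h,$$ corresponding to the coefficient vectors $\mathbf a_i$ of the generalized polynomial $F(\mathbf a_i,\cdot)$, with the same boundary data $\psi$ (extended by $\Psi$) and the same initial data $\rho_0$ (so $\bar\rho_h^{(i)}(0)=\pi(\rho_0-\Psi(\cdot,0))$ for $i=1,2$). Then there exists a positive constant $C$ independent of $\|\mathbf a_1-\mathbf a_2\|_{L^\infty(I,L^\infty(\Omega))}$ such that $$\|\bar\rho_h^{(1)}-\bar\rho_h^{(2)}\|_{L^\infty(I,L^2(\Omega))}^2+\|\mathbf m_h^{(1)}-\mathbf m_h^{(2)}\|_{L^s(I,L^s(\Omega))}^s\le C\,\|\mathbf a_1-\mathbf a_2\|_{L^\infty(I,L^\infty(\Omega))}^{s^*}.$$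
   Context: $\Omega\subset\mathbb R^d$ ($d\ge2$) is open, bounded, with $C^1$ boundary; $T>0$, $I=[0,T]$; $(\cdot,\cdot)$ is the integral pairing over $\Omega$ of scalar or vector functions; subscript $t$ denotes time derivative. Solutions are assumed to have enough regularity in $\mathbf x$ and $t$ for the expressions to make sense. Fix $N\ge1$ and real exponents $\alpha_{-1}=-\alpha<\alpha_0=0<\alpha_1<\dots<\alpha_N$ with $\alpha\in(0,1)$; put $s=\alpha_N+2$, $s^*=s/(s-1)$. For a vector of coefficient functions $\mathbf a=(a_{-1},a_0,\dots,a_N)$ on $\Omega\times I$, $F(\mathbf a,z)=\sum_{i=-1}^N a_i(\mathbf x,t)z^{\alpha_i}$, and $F(\mathbf a,|\mathbf m|)\mathbf m$ is understood as $0$ where $\mathbf m=0$. $\mathbf D$ is a compact subset of $\{(a_{-1},a_0,\dots,a_N):0<a_*\le a_{-1},a_0,a_N\le a^*,\ 0\le a_1,\dots,a_{N-1}\le a^*\}$, with $0<a_*\le a^*<\infty$ fixed. Coefficients are assumed to lie in $W^{1,\infty}(I,L^\infty(\Omega))$ with $|\partial_ta_i|<b^*<\infty$. Data: $0<\phi_*\le\phi(\mathbf x)\le\phi^*<\infty$; $f\in L^\infty(I,L^2(\Omega))$; $\psi\in C^{1,2}_{\mathbf x,t}(\bar\Omega\times I)$; $\Psi$ is an extension of the boundary datum $\psi$ from $\partial\Omega\times I$ to $\bar\Omega\times I$; $\rho_0$ is the initial density. Spaces: $\{\mathcal T_h\}_h$ is a family of globally quasi-uniform triangulations of $\Omega$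 with $\max_{\tau\in\mathcal T_h}\operatorname{diam}\tau\le h$; for an integer $k\ge0$, $P_k(\tau)$ is the space of polynomials of degree at most $k$ on $\tau$; $Q_h=\{\rho_h\in C^0(\overline\Omega):\rho_h|_\tau\in P_k(\tau)\ \forall\tau\in\mathcal T_h\}$, $V_h=\{\mathbf m_h\in C^0(\overline\Omega)^d:\mathbf m_h|_\tau\in P_k(\tau)\ \forall\tau\in\mathcal T_h\}$ (componentwise). $\pi$ is the $L^2$-projection onto $Q_h$. *)

theory Defs
  imports "HOL-Analysis.Analysis" "HOL-Probability.Essential_Supremum"
begin

section \<open>Lebesgue and Bochner norms\<close>

definition ennreal_powr :: "ennreal \<Rightarrow> real \<Rightarrow> ennreal" where
  "ennreal_powr x p = (if x = \<infinity> then \<infinity> else ennreal (enn2real x powr p))"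

text \<open>Norms take values in \<^typ>\<open>ennreal\<close>, so that a function outside the space has norm
  \<open>\<infinity>\<close> rather than an arbitrary real number.\<close>

definition Lnorm :: "ennreal \<Rightarrow> 'a measure \<Rightarrow> ('a \<Rightarrow> ennreal) \<Rightarrow> ennreal" where
  "Lnorm p M g =
     (if p = \<infinity> then esssup M g
      else ennreal_powr (\<integral>\<^sup>+x. ennreal_powr (g x) (enn2real p) \<partial>M) (1 / enn2real p))"

definition Lp_norm :: "ennreal \<Rightarrow> 'a measure \<Rightarrow> ('a \<Rightarrow> 'b::real_normed_vector) \<Rightarrow> ennreal" where
  "Lp_norm p M u = Lnorm p M (\<lambda>x. ennreal (norm (u x)))"

definition in_Lp :: "ennreal \<Rightarrow> 'a measure \<Rightarrow> ('a \<Rightarrow> 'b::real_normed_vector) \<Rightarrow> bool" where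
  "in_Lp p M u \<longleftrightarrow> u \<in> borel_measurable M \<and> Lp_norm p M u < \<infinity>"

text \<open>The norm of \<open>L\<^sup>p(I, L\<^sup>q(\<Omega>))\<close> with \<open>I = [0,T]\<close>. Functions of space and time take the time
  argument first. Elements of \<open>L\<^sup>p(I, L\<^sup>q(\<Omega>))\<close> are represented by functions that are jointly Lebesgue
  measurable on \<open>I \<times> \<Omega>\<close>.\<close>

definition bochner_norm ::
    "ennreal \<Rightarrow> real \<Rightarrow> ennreal \<Rightarrow> 'a::euclidean_space set \<Rightarrow> (real \<Rightarrow> 'a \<Rightarrow> 'b::real_normed_vector) \<Rightarrow> ennreal"
where
  "bochner_norm p T q \<Omega> u = Lnorm p (lebesgue_on {0..T}) (\<lambda>t. Lp_norm q (lebesgue_on \<Omega>) (u t))"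

definition in_bochner ::
    "ennreal \<Rightarrow> real \<Rightarrow> ennreal \<Rightarrow> 'a::euclidean_space set \<Rightarrow> (real \<Rightarrow> 'a \<Rightarrow> 'b::real_normed_vector) \<Rightarrow> bool"
where
  "in_bochner p T q \<Omega> u \<longleftrightarrow>
     (\<lambda>(t, x). u t x) \<in> borel_measurable (lebesgue_on ({0..T} \<times> \<Omega>)) \<and> bochner_norm p T q \<Omega> u < \<infinity>"

definition pairing :: "'a::euclidean_space set \<Rightarrow> ('a \<Rightarrow> 'b::real_inner) \<Rightarrow> ('a \<Rightarrow> 'b) \<Rightarrow> real" where
  "pairing \<Omega> u v = (\<integral>x. u x \<bullet> v x \<partial>lebesgue_on \<Omega>)"


section \<open>Weak time derivatives\<close>

definition test_function :: "real \<Rightarrow> (real \<Rightarrow> real) \<Rightarrow> bool" where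
  "test_function T \<eta> \<longleftrightarrow>
     (\<forall>n. (deriv ^^ n) \<eta> differentiable_on UNIV) \<and> closure {t. \<eta> t \<noteq> 0} \<subseteq> {0<..<T}"

text \<open>\<open>c \<in> W\<^sup>1\<^sup>,\<^sup>\<infinity>(I, L\<^sup>\<infinity>(\<Omega>))\<close> with \<open>\<partial>\<^sub>t c = g\<close>. The defining identity between elements of
  \<open>L\<^sup>\<infinity>(\<Omega>)\<close> is read almost everywhere on \<open>\<Omega>\<close>.\<close>

definition has_weak_time_derivative ::
    "real \<Rightarrow> 'a::euclidean_space set \<Rightarrow> (real \<Rightarrow> 'a \<Rightarrow> real) \<Rightarrow> (real \<Rightarrow> 'a \<Rightarrow> real) \<Rightarrow> bool"
where
  "has_weak_time_derivative T \<Omega> c g \<longleftrightarrow>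
     in_bochner \<infinity> T \<infinity> \<Omega> c \<and> in_bochner \<infinity> T \<infinity> \<Omega> g \<and>
     (\<forall>\<eta>. test_function T \<eta> \<longrightarrow>
        (AE x in lebesgue_on \<Omega>.
           (\<integral>t. c t x * deriv \<eta> t \<partial>lebesgue_on {0..T}) = - (\<integral>t. g t x * \<eta> t \<partial>lebesgue_on {0..T})))"


section \<open>Classical differential operators and classes\<close>

definition grad :: "(real^'d \<Rightarrow> real) \<Rightarrow> real^'d \<Rightarrow> real^'d" where
  "grad u x = (\<chi> i. frechet_derivative u (at x) (axis i 1))"

text \<open>Finite element functions are differentiable off a null set only; \<open>divg v\<close> is used under
  integrals, where its values on that set do not matter.\<close>

definition divg :: "(real^'d \<Rightarrow> real^'d) \<Rightarrow> real^'d \<Rightarrow> real" where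
  "divg v x = (\<Sum>i\<in>UNIV. frechet_derivative v (at x) (axis i 1) $ i)"

definition time_deriv :: "real \<Rightarrow> (real \<Rightarrow> 'a \<Rightarrow> real) \<Rightarrow> real \<Rightarrow> 'a \<Rightarrow> real" where
  "time_deriv T u t x = vector_derivative (\<lambda>r. u r x) (at t within {0..T})"

text \<open>\<open>C\<^sup>1\<^sup>,\<^sup>2\<close> in \<open>(x, t)\<close>: one derivative in space, two in time, all continuous up to the boundary.\<close>

definition C12 :: "real \<Rightarrow> (real^'d) set \<Rightarrow> (real \<Rightarrow> real^'d \<Rightarrow> real) \<Rightarrow> bool" where
  "C12 T \<Omega> u \<longleftrightarrow>
     continuous_on ({0..T} \<times> closure \<Omega>) (\<lambda>(t, x). u t x) \<and>
     (\<exists>G. continuous_on ({0..T} \<times> closure \<Omega>) (\<lambda>(t, x). G t x) \<and>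
          (\<forall>t\<in>{0..T}. \<forall>x\<in>\<Omega>. GDERIV (u t) x :> G t x)) \<and>
     (\<exists>u1 u2. continuous_on ({0..T} \<times> closure \<Omega>) (\<lambda>(t, x). u1 t x) \<and>
              continuous_on ({0..T} \<times> closure \<Omega>) (\<lambda>(t, x). u2 t x) \<and>
              (\<forall>t\<in>{0..T}. \<forall>x\<in>closure \<Omega>.
                 ((\<lambda>r. u r x) has_real_derivative u1 t x) (at t within {0..T}) \<and>
                 ((\<lambda>r. u1 r x) has_real_derivative u2 t x) (at t within {0..T})))"

text \<open>Near each boundary point, \<open>\<Omega>\<close> is the region above the graph of a \<open>C\<^sup>1\<close> function over the
  hyperplane orthogonal to a unit vector \<open>e\<close>.\<close>

definition C1_boundary :: "(real^'d) set \<Rightarrow> bool" where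
  "C1_boundary \<Omega> \<longleftrightarrow>
     (\<forall>x0\<in>frontier \<Omega>. \<exists>r>0. \<exists>e \<gamma> G. norm e = 1 \<and>
        (\<forall>y. GDERIV \<gamma> y :> G y) \<and> continuous_on UNIV G \<and>
        \<Omega> \<inter> ball x0 r = {x \<in> ball x0 r. x \<bullet> e > \<gamma> (x - (x \<bullet> e) *\<^sub>R e)})"


section \<open>Triangulations and finite element spaces\<close>

definition C1_embedding :: "(real^'d) set \<Rightarrow> (real^'d \<Rightarrow> real^'d) \<Rightarrow> bool" where
  "C1_embedding S G \<longleftrightarrow>
     (\<exists>U G'. open U \<and> S \<subseteq> U \<and> inj_on G U \<and>
        continuous_on U (G' :: real^'d \<Rightarrow> (real^'d) \<Rightarrow>\<^sub>L (real^'d)) \<and>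
        (\<forall>x\<in>U. (G has_derivative blinfun_apply (G' x)) (at x) \<and> inj (blinfun_apply (G' x))))"

text \<open>A bounded domain with \<open>C\<^sup>1\<close> boundary is never a finite union of straight simplices, so elements
  that meet the boundary may be curved: each element \<open>\<tau>\<close> is the image of a \<open>d\<close>-simplex \<open>S \<tau>\<close> under a
  \<open>C\<^sup>1\<close> diffeomorphism \<open>G \<tau>\<close>, and is a straight simplex if it does not touch the boundary. Two elements
  meet in a common face, possibly empty.\<close>

definition triangulation :: "(real^'d) set \<Rightarrow> (real^'d) set set \<Rightarrow> bool" where
  "triangulation \<Omega> \<T> \<longleftrightarrow>
     finite \<T> \<and> \<Union>\<T> = closure \<Omega> \<and>
     (\<exists>S G.
        (\<forall>\<tau>\<in>\<T>. int CARD('d) simplex S \<tau> \<and> C1_embedding (S \<tau>) (G \<tau>) \<and> \<tau> = G \<tau> ` S \<tau> \<and>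
           (\<tau> \<inter> frontier \<Omega> = {} \<longrightarrow> (\<forall>x\<in>S \<tau>. G \<tau> x = x))) \<and>
        (\<forall>\<tau>\<in>\<T>. \<forall>\<tau>'\<in>\<T>. \<exists>A B. A face_of S \<tau> \<and> B face_of S \<tau>' \<and>
           \<tau> \<inter> \<tau>' = G \<tau> ` A \<and> \<tau> \<inter> \<tau>' = G \<tau>' ` B))"

definition quasi_uniform_triangulations ::
    "(real^'d) set \<Rightarrow> real set \<Rightarrow> (real \<Rightarrow> (real^'d) set set) \<Rightarrow> bool"
where
  "quasi_uniform_triangulations \<Omega> H \<T> \<longleftrightarrow>
     H \<subseteq> {0<..} \<and>
     (\<forall>h\<in>H. triangulation \<Omega> (\<T> h) \<and> (\<forall>\<tau>\<in>\<T> h. diameter \<tau> \<le> h)) \<and>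
     (\<exists>\<sigma>>0. \<forall>h\<in>H. \<forall>\<tau>\<in>\<T> h. \<exists>c. cball c (\<sigma> * h) \<subseteq> \<tau>)"

definition poly_space :: "nat \<Rightarrow> (real^'d \<Rightarrow> real) set" where
  "poly_space k =
     {p. \<exists>c. \<forall>x. p x = (\<Sum>e | (\<Sum>i\<in>UNIV. e i) \<le> k. c e * (\<Prod>i\<in>UNIV. (x $ i) ^ (e i :: nat)))}"

definition Q_space :: "(real^'d) set \<Rightarrow> nat \<Rightarrow> (real^'d) set set \<Rightarrow> (real^'d \<Rightarrow> real) set" where
  "Q_space \<Omega> k \<T> =
     {q. continuous_on (closure \<Omega>) q \<and> (\<forall>\<tau>\<in>\<T>. \<exists>p\<in>poly_space k. \<forall>x\<in>\<tau>. q x = p x)}"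

definition V_space :: "(real^'d) set \<Rightarrow> nat \<Rightarrow> (real^'d) set set \<Rightarrow> (real^'d \<Rightarrow> real^'d) set" where
  "V_space \<Omega> k \<T> =
     {v. continuous_on (closure \<Omega>) v \<and> (\<forall>\<tau>\<in>\<T>. \<forall>i. \<exists>p\<in>poly_space k. \<forall>x\<in>\<tau>. v x $ i = p x)}"

definition is_L2_projection ::
    "(real^'d) set \<Rightarrow> (real^'d \<Rightarrow> real) set \<Rightarrow> (real^'d \<Rightarrow> real) \<Rightarrow> (real^'d \<Rightarrow> real) \<Rightarrow> bool"
where
  "is_L2_projection \<Omega> Q g p \<longleftrightarrow> p \<in> Q \<and> (\<forall>q\<in>Q. pairing \<Omega> p q = pairing \<Omega> g q)"


section \<open>The generalized Forchheimer polynomial and its coefficients\<close>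

text \<open>Coefficient vectors \<open>(a\<^sub>-\<^sub>1, a\<^sub>0, \<dots>, a\<^sub>N)\<close> are functions on the integers, read on \<open>{-1..N}\<close>.
  In Isabelle, \<open>0 powr e = 0\<close> for every \<open>e\<close>, so \<open>Fpoly N \<alpha> a 0 = 0\<close>; only
  \<open>Fpoly N \<alpha> a \<bar>m\<bar> *\<^sub>R m\<close> is ever used, which is \<open>0\<close> at \<open>m = 0\<close> as it should be.\<close>

definition Fpoly :: "nat \<Rightarrow> (int \<Rightarrow> real) \<Rightarrow> (int \<Rightarrow> real) \<Rightarrow> real \<Rightarrow> real" where
  "Fpoly N \<alpha> a z = (\<Sum>i\<in>{-1..int N}. a i * z powr \<alpha> i)"

text \<open>Entries outside \<open>{-1..N}\<close> are \<open>0\<close>, which identifies this set, with the product topology on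
  \<^typ>\<open>int \<Rightarrow> real\<close>, with a subset of \<open>(N+2)\<close>-dimensional Euclidean space.\<close>

definition coeff_box :: "nat \<Rightarrow> real \<Rightarrow> real \<Rightarrow> (int \<Rightarrow> real) set" where
  "coeff_box N alo ahi =
     {a. (\<forall>i\<in>{-1, 0, int N}. alo \<le> a i \<and> a i \<le> ahi) \<and>
         (\<forall>i\<in>{1..int N - 1}. 0 \<le> a i \<and> a i \<le> ahi) \<and>
         (\<forall>i. i \<notin> {-1..int N} \<longrightarrow> a i = 0)}"

definition coeff_functions ::
    "real \<Rightarrow> (real^'d) set \<Rightarrow> nat \<Rightarrow> (int \<Rightarrow> real) set \<Rightarrow> real \<Rightarrow> (real \<Rightarrow> real^'d \<Rightarrow> int \<Rightarrow> real) set"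
where
  "coeff_functions T \<Omega> N D b =
     {a. (AE (t, x) in lebesgue_on ({0..T} \<times> \<Omega>). a t x \<in> D) \<and>
         (\<forall>i\<in>{-1..int N}. \<exists>g. has_weak_time_derivative T \<Omega> (\<lambda>t x. a t x i) g \<and>
            (AE (t, x) in lebesgue_on ({0..T} \<times> \<Omega>). \<bar>g t x\<bar> < b))}"

definition coeff_dist ::
    "real \<Rightarrow> (real^'d) set \<Rightarrow> nat \<Rightarrow> (real \<Rightarrow> real^'d \<Rightarrow> int \<Rightarrow> real) \<Rightarrow> (real \<Rightarrow> real^'d \<Rightarrow> int \<Rightarrow> real) \<Rightarrow> ennreal"
where
  "coeff_dist T \<Omega> N a a' =
     bochner_norm \<infinity> T \<infinity> \<Omega> (\<lambda>t x. L2_set (\<lambda>i. a t x i - a' t x i) {-1..int N})"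


section \<open>The semidiscrete problem\<close>

text \<open>As the data are only bounded in time, \<open>\<rho>\<close> is required to be absolutely continuous in time with
  values in \<open>Q\<close> (with derivative \<open>\<rho>t\<close>), \<open>m\<close> to be measurable in time, and the equations to hold for
  almost every \<open>t\<close>. Since \<open>Q\<close> and \<open>V\<close> are finite-dimensional spaces of continuous functions on the closure of \<open>\<Omega>\<close>,
  measurability and integrability in time may be tested pointwise in space.\<close>

definition semidiscrete_solution ::
    "(real^'d) set \<Rightarrow> real \<Rightarrow> (real^'d \<Rightarrow> real) \<Rightarrow> (real \<Rightarrow> real^'d \<Rightarrow> real) \<Rightarrow> (real \<Rightarrow> real^'d \<Rightarrow> real) \<Rightarrow>
     (real^'d \<Rightarrow> real) \<Rightarrow> nat \<Rightarrow> (int \<Rightarrow> real) \<Rightarrow> (real^'d \<Rightarrow> real^'d) set \<Rightarrow> (real^'d \<Rightarrow> real) set \<Rightarrow>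
     (real \<Rightarrow> real^'d \<Rightarrow> int \<Rightarrow> real) \<Rightarrow> (real \<Rightarrow> real^'d \<Rightarrow> real^'d) \<Rightarrow> (real \<Rightarrow> real^'d \<Rightarrow> real) \<Rightarrow> bool"
where
  "semidiscrete_solution \<Omega> T \<phi> f \<Psi> \<rho>0 N \<alpha> V Q a m \<rho> \<longleftrightarrow>
     (\<forall>t\<in>{0..T}. m t \<in> V \<and> \<rho> t \<in> Q) \<and>
     (\<forall>x\<in>closure \<Omega>. (\<lambda>t. m t x) \<in> borel_measurable (lebesgue_on {0..T})) \<and>
     is_L2_projection \<Omega> Q (\<lambda>x. \<rho>0 x - \<Psi> 0 x) (\<rho> 0) \<and>
     (\<exists>\<rho>t.
        (\<forall>t\<in>{0..T}. \<rho>t t \<in> Q) \<and>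
        (\<forall>x\<in>closure \<Omega>. integrable (lebesgue_on {0..T}) (\<lambda>t. \<rho>t t x) \<and>
           (\<forall>t\<in>{0..T}. \<rho> t x = \<rho> 0 x + (\<integral>r. \<rho>t r x \<partial>lebesgue_on {0..t}))) \<and>
        (AE t in lebesgue_on {0..T}.
           (\<forall>v\<in>V. pairing \<Omega> (\<lambda>x. Fpoly N \<alpha> (a t x) (norm (m t x)) *\<^sub>R m t x) v - pairing \<Omega> (\<rho> t) (divg v)
                   = - pairing \<Omega> (grad (\<Psi> t)) v) \<and>
           (\<forall>q\<in>Q. pairing \<Omega> (\<lambda>x. \<phi> x * \<rho>t t x) q + pairing \<Omega> (divg (m t)) q
                   = pairing \<Omega> (f t) q - pairing \<Omega> (\<lambda>x. \<phi> x * time_deriv T \<Psi> t x) q)))"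

end

theory Submission
  imports Defs
begin

text \<open>Testing the difference of the two problems with the differences \<open>m\<close> of the fluxes and \<open>\<rho>\<close> of the
  densities makes the divergence terms cancel. The term with the largest exponent makes the flux
  strongly monotone with power \<open>s\<close>, while changing the coefficients by \<open>\<Delta>\<close> perturbs it by at most
  \<open>\<Delta> (N + 2) (1 + \<bar>m\<^sub>2\<bar>\<^bsup>s - 1\<^esup>)\<close>; Young's inequality then gives
  \<open>d/dt (\<phi> \<rho>, \<rho>) / 2 + c \<integral>\<bar>m\<bar>\<^sup>s \<le> C \<Delta>\<^bsup>s/(s - 1)\<^esup> (1 + \<integral>\<bar>m\<^sub>2\<bar>\<^sup>s)\<close>. The last integral is bounded in terms of
  the data by testing the problem for \<open>m\<^sub>2\<close> with its own solution. Neither step uses more about the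
  triangulation than that boundaries of elements are null sets.\<close>

section \<open>Products of absolutely continuous functions\<close>

text \<open>The equations hold only for almost every \<open>t\<close>, and the density is absolutely
  continuous pointwise in space, so the time derivative of its energy has to be justified. Each
  discrete space is therefore sampled at finitely many points: the energy becomes a quadratic form
  in finitely many absolutely continuous scalars, for which a product rule suffices. A second
  obstacle is the time integral of the dissipation, which is never formed as a Bochner integral. It
  is bounded almost everywhere by an integrable function built from the time derivative of the
  energy, whose integral telescopes to energies at the endpoints. The a priori bound avoids a
  Gronwall argument: the energy inequality is integrated up to the time of largest energy, where the
  lower-order term, scaled by \<open>1 / (4 * T)\<close>, is absorbed. Null boundaries of elements
  matter because a finite element function need have a divergence only inside elements, so the
  divergence terms cancel through linearity of \<open>divg\<close> almost everywhere.\<close>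

text \<open>Fubini on the square \<open>[0, t]\<^sup>2\<close>, cut along the diagonal.\<close>

lemma lebesgue_on_mult_indefinite_integrals:
  fixes f g :: "real \<Rightarrow> real"
  assumes f: "integrable (lebesgue_on {0..t}) f" and g: "integrable (lebesgue_on {0..t}) g"
    and F: "\<And>r. r \<in> {0..t} \<Longrightarrow> F r = F 0 + (\<integral>x. f x \<partial>lebesgue_on {0..r})"
    and G: "\<And>r. r \<in> {0..t} \<Longrightarrow> G r = G 0 + (\<integral>x. g x \<partial>lebesgue_on {0..r})"
    and t: "0 \<le> t"
  shows "integrable (lebesgue_on {0..t}) (\<lambda>r. f r * G r)"
    and "integrable (lebesgue_on {0..t}) (\<lambda>r. F r * g r)"
    and "F t * G t - F 0 * G 0 = (\<integral>r. f r * G r \<partial>lebesgue_on {0..t}) + (\<integral>r. F r * g r \<partial>lebesgue_on {0..t})"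
proof -
  let ?M = "lebesgue_on {0..t}"
  interpret finite_measure ?M by (rule finite_measure_lebesgue_on) simp
  interpret P: pair_sigma_finite ?M ?M by standard
  have mid [measurable]: "(\<lambda>x. x) \<in> borel_measurable ?M"
    by (simp add: continuous_imp_measurable_on_sets_lebesgue)
  have fm [measurable]: "f \<in> borel_measurable ?M" and gm [measurable]: "g \<in> borel_measurable ?M"
    using f g by auto
  let ?f = "\<lambda>r. (\<integral>x. f x \<partial>lebesgue_on {0..r})" and ?g = "\<lambda>r. (\<integral>x. g x \<partial>lebesgue_on {0..r})"
  have mulc: "integrable ?M (\<lambda>r. k r * H r)" if k: "integrable ?M k" and H: "continuous_on {0..t} H" for k H :: "real \<Rightarrow> real"
  proof -
    obtain B where B: "\<And>x. x \<in> {0..t} \<Longrightarrow> norm (H x) \<le> B"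
      using compact_imp_bounded[OF compact_continuous_image[OF H compact_Icc]] unfolding bounded_iff by blast
    have [measurable]: "H \<in> borel_measurable ?M"
      by (rule continuous_imp_measurable_on_sets_lebesgue[OF H]) simp
    have [measurable]: "k \<in> borel_measurable ?M" using k by auto
    show ?thesis
      by (rule Bochner_Integration.integrable_bound[of _ "\<lambda>r. B * k r"])
        (use k B in \<open>auto simp: abs_mult mult.commute intro!: AE_I2 mult_mono intro: order_trans[OF _ abs_ge_self]\<close>)
  qed
  have cf: "continuous_on {0..t} ?f" and cg: "continuous_on {0..t} ?g"
    using indefinite_integral_continuous_real f g by blast+
  have cF: "continuous_on {0..t} F" and cG: "continuous_on {0..t} G"
    by (subst continuous_on_cong[OF refl F], simp, intro continuous_intros cf)
       (subst continuous_on_cong[OF refl G], simp, intro continuous_intros cg)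
  show i1: "integrable ?M (\<lambda>r. f r * G r)" by (rule mulc[OF f cG])
  show i2: "integrable ?M (\<lambda>r. F r * g r)" using mulc[OF g cF] by (simp add: mult.commute)
  have sub: "(\<integral>x. indicator {..r} x * k x \<partial>?M) = (\<integral>x. k x \<partial>lebesgue_on {0..r})" if r: "r \<in> {0..t}" for r and k :: "real \<Rightarrow> real"
  proof -
    have "(\<integral>x. indicator {..r} x * k x \<partial>?M) = (\<integral>x. (if x \<in> {0..r} then k x else 0) \<partial>?M)"
      by (intro Bochner_Integration.integral_cong refl) (auto simp: indicator_def)
    also have "\<dots> = (\<integral>x. k x \<partial>lebesgue_on {0..r})"
      by (rule integral_restrict) (use r in auto)
    finally show ?thesis .
  qed
  have int0: "integrable (?M \<Otimes>\<^sub>M ?M) (\<lambda>(r,u). f r * g u)"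
  proof (rule P.Fubini_integrable)
    show "(\<lambda>(r,u). f r * g u) \<in> borel_measurable (?M \<Otimes>\<^sub>M ?M)" by measurable
    have "integrable ?M (\<lambda>r. \<bar>f r\<bar> * (\<integral>u. \<bar>g u\<bar> \<partial>?M))" using f by auto
    then show "integrable ?M (\<lambda>r. \<integral>u. norm (case (r,u) of (r,u) \<Rightarrow> f r * g u) \<partial>?M)"
      by (simp add: abs_mult)
    show "AE r in ?M. integrable ?M (\<lambda>u. case (r,u) of (r,u) \<Rightarrow> f r * g u)" using g by auto
  qed
  \<comment> \<open>\<open>?A\<close> lives where \<open>u \<le> r\<close> and \<open>?B\<close>
    where \<open>r < u\<close>; integrating over one variable first gives \<open>f r * ?g r\<close>
    on one triangle and \<open>g u * ?f u\<close> on the other.\<close>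
  let ?A = "\<lambda>(r,u). indicator {..r} u * (f r * g u)" and ?B = "\<lambda>(r,u). indicator {..<u} r * (f r * g u)"
  have mA: "(\<lambda>(r,u). indicator {..r} u :: real) \<in> borel_measurable (?M \<Otimes>\<^sub>M ?M)"
    unfolding indicator_def atMost_iff lessThan_iff by measurable
  have mB: "(\<lambda>(r,u). indicator {..<u} r :: real) \<in> borel_measurable (?M \<Otimes>\<^sub>M ?M)"
    unfolding indicator_def atMost_iff lessThan_iff by measurable
  have iA: "integrable (?M \<Otimes>\<^sub>M ?M) ?A"
    by (rule Bochner_Integration.integrable_bound[OF int0])
       (use mA in \<open>auto simp: indicator_def case_prod_unfold\<close>)
  have iB: "integrable (?M \<Otimes>\<^sub>M ?M) ?B"
    by (rule Bochner_Integration.integrable_bound[OF int0])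
       (use mB in \<open>auto simp: indicator_def case_prod_unfold\<close>)
  have "?f t * ?g t = (\<integral>r. (\<integral>u. f r * g u \<partial>?M) \<partial>?M)" by simp
  also have "\<dots> = (\<integral>z. (case z of (r,u) \<Rightarrow> f r * g u) \<partial>(?M \<Otimes>\<^sub>M ?M))"
    using P.integral_fst'[OF int0] by simp
  also have "\<dots> = (\<integral>z. ?A z + ?B z \<partial>(?M \<Otimes>\<^sub>M ?M))"
    by (intro Bochner_Integration.integral_cong refl) (auto simp: indicator_def)
  also have "\<dots> = (\<integral>z. ?A z \<partial>(?M \<Otimes>\<^sub>M ?M)) + (\<integral>z. ?B z \<partial>(?M \<Otimes>\<^sub>M ?M))"
    using iA iB by simp
  also have "(\<integral>z. ?A z \<partial>(?M \<Otimes>\<^sub>M ?M)) = (\<integral>r. (\<integral>u. ?A (r,u) \<partial>?M) \<partial>?M)"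
    using P.integral_fst'[OF iA] by simp
  also have "\<dots> = (\<integral>r. f r * ?g r \<partial>?M)"
  proof (intro Bochner_Integration.integral_cong refl)
    fix r assume "r \<in> space ?M"
    then have r: "r \<in> {0..t}" by simp
    have "(\<integral>u. ?A (r,u) \<partial>?M) = (\<integral>u. f r * (indicator {..r} u * g u) \<partial>?M)"
      by (intro Bochner_Integration.integral_cong refl) auto
    also have "\<dots> = f r * ?g r" using sub[OF r, of g] by simp
    finally show "(\<integral>u. ?A (r,u) \<partial>?M) = f r * ?g r" .
  qed
  also have "(\<integral>z. ?B z \<partial>(?M \<Otimes>\<^sub>M ?M)) = (\<integral>u. (\<integral>r. ?B (r,u) \<partial>?M) \<partial>?M)"
    using P.integral_snd[OF iB] by simp
  also have "\<dots> = (\<integral>u. g u * ?f u \<partial>?M)"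
  proof (intro Bochner_Integration.integral_cong refl)
    fix u assume "u \<in> space ?M"
    then have u: "u \<in> {0..t}" by simp
    \<comment> \<open>\<open>?B\<close> leaves out the diagonal; adding the null set
      \<open>r = u\<close> turns the inner integral into one over \<open>[0, u]\<close>.\<close>
    have "AE r in lebesgue. r \<noteq> u"
      using AE_not_in[of "{u}" lebesgue] by simp
    then have ne: "AE r in ?M. r \<noteq> u"
      by (auto simp: AE_restrict_space_iff)
    have "(\<integral>r. ?B (r,u) \<partial>?M) = (\<integral>r. g u * (indicator {..u} r * f r) \<partial>?M)"
      by (rule integral_cong_AE) (use ne in \<open>auto simp: indicator_def\<close>)
    also have "\<dots> = g u * ?f u" using sub[OF u, of f] by simp
    finally show "(\<integral>r. ?B (r,u) \<partial>?M) = g u * ?f u" .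
  qed
  finally have prod: "?f t * ?g t = (\<integral>r. f r * ?g r \<partial>?M) + (\<integral>r. g r * ?f r \<partial>?M)" .
  \<comment> \<open>\<open>prod\<close> is the case of vanishing initial values; the constants
    \<open>F 0\<close> and \<open>G 0\<close> enter linearly.\<close>
  have "(\<integral>r. f r * G r \<partial>?M) = (\<integral>r. G 0 * f r + f r * ?g r \<partial>?M)"
    by (intro Bochner_Integration.integral_cong refl) (subst G, auto simp: algebra_simps)
  also have "\<dots> = G 0 * ?f t + (\<integral>r. f r * ?g r \<partial>?M)"
    using f mulc[OF f cg] by simp
  finally have 1: "(\<integral>r. f r * G r \<partial>?M) = G 0 * ?f t + (\<integral>r. f r * ?g r \<partial>?M)" .
  have "(\<integral>r. F r * g r \<partial>?M) = (\<integral>r. F 0 * g r + g r * ?f r \<partial>?M)"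
    by (intro Bochner_Integration.integral_cong refl) (subst F, auto simp: algebra_simps)
  also have "\<dots> = F 0 * ?g t + (\<integral>r. g r * ?f r \<partial>?M)"
    using g mulc[OF g cf] by simp
  finally have 2: "(\<integral>r. F r * g r \<partial>?M) = F 0 * ?g t + (\<integral>r. g r * ?f r \<partial>?M)" .
  show "F t * G t - F 0 * G 0 = (\<integral>r. f r * G r \<partial>?M) + (\<integral>r. F r * g r \<partial>?M)"
    unfolding 1 2 F[of t, OF atLeastAtMost_iff[THEN iffD2, OF conjI, OF t order_refl]]
      G[of t, OF atLeastAtMost_iff[THEN iffD2, OF conjI, OF t order_refl]]
    using prod by (simp add: algebra_simps)
qed

section \<open>Pointwise estimates for the flux\<close>

text \<open>By Cauchy-Schwarz the inner product is at least
  \<open>(a powr (\<beta>+1) - b powr (\<beta>+1)) * (a - b)\<close> with \<open>a\<close>,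
  \<open>b\<close> the two norms, and \<open>z powr (\<beta>+1)\<close> is increasing. Negative
  exponents are included because of the term with \<open>\<alpha> (-1)\<close>.\<close>

lemma powr_vector_monotone:
  fixes x y :: "'a::real_inner"
  assumes "\<beta> > -1"
  shows "0 \<le> ((norm x powr \<beta>) *\<^sub>R x - (norm y powr \<beta>) *\<^sub>R y) \<bullet> (x - y)"
proof -
  let ?a = "norm x" and ?b = "norm y"
  have p1: "z powr \<beta> * z = z powr (\<beta> + 1)" if "z \<ge> 0" for z :: real
    using that by (cases "z = 0") (auto simp: powr_add)
  have "x \<bullet> y \<le> ?a * ?b" by (rule norm_cauchy_schwarz)
  then have cs: "(?a powr \<beta> + ?b powr \<beta>) * (x \<bullet> y) \<le> (?a powr \<beta> + ?b powr \<beta>) * (?a * ?b)"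
    by (intro mult_left_mono) auto
  have m: "0 \<le> (?a powr (\<beta>+1) - ?b powr (\<beta>+1)) * (?a - ?b)"
  proof (cases "?a \<le> ?b")
    case True
    then have "?a powr (\<beta>+1) \<le> ?b powr (\<beta>+1)" using assms by (intro powr_mono2) auto
    with True show ?thesis by (intro mult_nonpos_nonpos) auto
  next
    case False
    then have "?b powr (\<beta>+1) \<le> ?a powr (\<beta>+1)" using assms by (intro powr_mono2) auto
    with False show ?thesis by (intro mult_nonneg_nonneg) auto
  qed
  have "((norm x powr \<beta>) *\<^sub>R x - (norm y powr \<beta>) *\<^sub>R y) \<bullet> (x - y)
     = ?a powr \<beta> * (?a * ?a) + ?b powr \<beta> * (?b * ?b) - (?a powr \<beta> + ?b powr \<beta>) * (x \<bullet> y)"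
    by (simp add: inner_diff_left inner_diff_right inner_commute algebra_simps
        flip: power2_eq_square power2_norm_eq_inner)
  also have "\<dots> \<ge> ?a powr \<beta> * (?a * ?a) + ?b powr \<beta> * (?b * ?b) - (?a powr \<beta> + ?b powr \<beta>) * (?a * ?b)"
    using cs by linarith
  also have "?a powr \<beta> * (?a * ?a) + ?b powr \<beta> * (?b * ?b) - (?a powr \<beta> + ?b powr \<beta>) * (?a * ?b)
      = (?a powr (\<beta>+1) - ?b powr (\<beta>+1)) * (?a - ?b)"
    by (simp add: p1[symmetric]) (simp add: algebra_simps)
  finally show ?thesis using m by linarith
qed

text \<open>With \<open>a\<close>, \<open>b\<close> the norms and \<open>d\<close> that of the
  difference, the inner product is half of \<open>(a powr \<beta> + b powr \<beta>) * d^2 + (a powr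
  \<beta> - b powr \<beta>) * (a^2 - b^2)\<close>. The second summand is nonnegative, and the larger
  of \<open>a\<close>, \<open>b\<close> is at least \<open>d / 2\<close>, which gives the
  constant.\<close>

lemma powr_vector_strongly_monotone:
  fixes x y :: "'a::real_inner"
  assumes "\<beta> \<ge> 0"
  shows "2 powr (- \<beta> - 1) * norm (x - y) powr (\<beta> + 2)
    \<le> ((norm x powr \<beta>) *\<^sub>R x - (norm y powr \<beta>) *\<^sub>R y) \<bullet> (x - y)"
proof -
  let ?a = "norm x" and ?b = "norm y" and ?d = "norm (x - y)"
  have m: "0 \<le> (?a powr \<beta> - ?b powr \<beta>) * (?a\<^sup>2 - ?b\<^sup>2)"
  proof (cases "?a \<le> ?b")
    case True
    then have "?a powr \<beta> \<le> ?b powr \<beta>" using assms by (intro powr_mono2) auto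
    with True show ?thesis by (intro mult_nonpos_nonpos) auto
  next
    case False
    then have "?b powr \<beta> \<le> ?a powr \<beta>" using assms by (intro powr_mono2) auto
    with False show ?thesis by (intro mult_nonneg_nonneg) auto
  qed
  have "(?d / 2) powr \<beta> \<le> max ?a ?b powr \<beta>"
    using assms norm_triangle_ineq4[of x y] by (intro powr_mono2) (auto simp: max_def)
  also have "\<dots> \<le> ?a powr \<beta> + ?b powr \<beta>" by (auto simp: max_def)
  finally have "(?d / 2) powr \<beta> * ?d\<^sup>2 \<le> (?a powr \<beta> + ?b powr \<beta>) * ?d\<^sup>2"
    by (intro mult_right_mono) auto
  moreover have "(?d / 2) powr \<beta> * ?d\<^sup>2 = 2 * (2 powr (- \<beta> - 1) * ?d powr (\<beta> + 2))"
    by (cases "?d = 0") (auto simp: powr_add powr_divide powr_minus powr_diff field_simps)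
  moreover have "((norm x powr \<beta>) *\<^sub>R x - (norm y powr \<beta>) *\<^sub>R y) \<bullet> (x - y)
     = ((?a powr \<beta> + ?b powr \<beta>) * ?d\<^sup>2 + (?a powr \<beta> - ?b powr \<beta>) * (?a\<^sup>2 - ?b\<^sup>2)) / 2"
    by (simp add: power2_norm_eq_inner inner_diff_left inner_diff_right inner_commute algebra_simps)
  ultimately show ?thesis using m by argo
qed

text \<open>The constant is not sharp: either \<open>v \<le> \<delta> * u powr (s - 1)\<close>, and
  the first term dominates, or \<open>u\<close> is at most
  \<open>(v / \<delta>) powr (1 / (s - 1))\<close>, and the second does. The free \<delta> lets
  later estimates absorb the first term.\<close>

lemma powr_Young:
  fixes u v \<delta> s :: real
  assumes "u \<ge> 0" "v \<ge> 0" "\<delta> > 0" "s > 1"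
  shows "u * v \<le> \<delta> * u powr s + \<delta> powr (- (1 / (s - 1))) * v powr (s / (s - 1))"
proof (cases "v \<le> \<delta> * u powr (s - 1)")
  case True
  then have "u * v \<le> u * (\<delta> * u powr (s - 1))" using assms by (intro mult_left_mono)
  also have "\<dots> = \<delta> * u powr s"
    using assms by (cases "u = 0") (auto simp: powr_diff)
  finally show ?thesis by (smt (verit) mult_nonneg_nonneg powr_ge_zero)
next
  case False
  then have v: "v > 0" using assms by (smt (verit) mult_nonneg_nonneg powr_ge_zero)
  have "u powr (s - 1) \<le> v / \<delta>" using False assms by (simp add: field_simps)
  then have "(u powr (s - 1)) powr (1 / (s - 1)) \<le> (v / \<delta>) powr (1 / (s - 1))"
    using assms by (intro powr_mono2) auto
  moreover have "(u powr (s - 1)) powr (1 / (s - 1)) = u" using assms by (simp add: powr_powr)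
  ultimately have "u * v \<le> (v / \<delta>) powr (1 / (s - 1)) * v" using v by (intro mult_right_mono) auto
  also have "\<dots> = \<delta> powr (- (1 / (s - 1))) * (v powr (1 / (s - 1)) * v powr 1)"
    using assms v by (simp add: powr_divide powr_minus field_simps)
  also have "v powr (1 / (s - 1)) * v powr 1 = v powr (s / (s - 1))"
    using assms by (simp only: powr_add[symmetric]) (simp add: field_simps)
  finally show ?thesis using assms by (smt (verit) mult_nonneg_nonneg powr_ge_zero)
qed

lemma coeff_box_bounds:
  assumes "a \<in> coeff_box N alo ahi" "i \<in> {-1..int N}" "0 < alo"
  shows "0 \<le> a i" "a i \<le> ahi"
proof -
  have "i \<in> {-1, 0, int N} \<or> i \<in> {1..int N - 1}" using assms(2) by auto
  then show "0 \<le> a i" "a i \<le> ahi" using assms(1,3) unfolding coeff_box_def by fastforce+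
qed

section \<open>The generalized polynomial with coefficients in the box\<close>

locale forchheimer =
  fixes N :: nat and \<alpha> :: "int \<Rightarrow> real" and alo ahi s :: real
  assumes N: "N \<ge> 1" and \<alpha>m1: "\<alpha> (-1) > -1" and \<alpha>0: "\<alpha> 0 = 0"
    and mono: "strict_mono_on {-1..int N} \<alpha>" and s: "s = \<alpha> (int N) + 2"
    and alo: "0 < alo" and alo_ahi: "alo \<le> ahi"
begin

lemma \<alpha>_gt: "i \<in> {-1..int N} \<Longrightarrow> \<alpha> i > -1"
  using strict_mono_onD[OF mono, of "-1" i] \<alpha>m1 by (cases "i = -1") auto

lemma \<alpha>_le: "i \<in> {-1..int N} \<Longrightarrow> \<alpha> i \<le> s - 2"
  using strict_mono_onD[OF mono, of i "int N"] s by (cases "i = int N") auto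

lemma s_gt_2: "s > 2"
  using strict_mono_onD[OF mono, of 0 "int N"] N \<alpha>0 s by auto

text \<open>The exponents \<open>\<alpha> i + 1\<close> lie in \<open>(0, s - 1]\<close>, so the
  power is at most \<open>1\<close> for \<open>z \<le> 1\<close> and at most the top power beyond.
  The factor \<open>z\<close> tames the negative exponent near \<open>0\<close>.\<close>

lemma powr_mult_self_le:
  assumes "i \<in> {-1..int N}" "z \<ge> 0"
  shows "z powr \<alpha> i * z \<le> 1 + z powr (s - 1)"
proof (cases "z = 0")
  case False
  then have z: "z > 0" using assms by simp
  have "z powr \<alpha> i * z = z powr (\<alpha> i + 1)" using z by (simp add: powr_add)
  also have "\<dots> \<le> 1 + z powr (s - 1)"
  proof (cases "z \<le> 1")
    case True
    then have "z powr (\<alpha> i + 1) \<le> 1" using z \<alpha>_gt[OF assms(1)] by (intro powr_le1) auto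
    then show ?thesis by (simp add: add_increasing2)
  next
    case False
    then have "z powr (\<alpha> i + 1) \<le> z powr (s - 1)" using \<alpha>_le[OF assms(1)] by (intro powr_mono) auto
    then show ?thesis by simp
  qed
  finally show ?thesis .
qed simp

text \<open>Lower bound of the leading coefficient times the constant of
  \<open>powr_vector_strongly_monotone\<close> for \<open>\<beta> = s - 2\<close>.\<close>

definition mono_const :: real where "mono_const = alo * 2 powr (1 - s)"

lemma mono_const_pos: "mono_const > 0"
  unfolding mono_const_def using alo by simp

text \<open>Only the term \<open>i = int N\<close> is kept; the others, including the one with
  negative exponent, are nonnegative by \<open>powr_vector_monotone\<close> because the coefficients
  are.\<close>

lemma Fpoly_strongly_monotone:
  fixes x y :: "'a::real_inner"
  assumes a: "a \<in> coeff_box N alo ahi"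
  shows "mono_const * norm (x - y) powr s
    \<le> (Fpoly N \<alpha> a (norm x) *\<^sub>R x - Fpoly N \<alpha> a (norm y) *\<^sub>R y) \<bullet> (x - y)"
proof -
  let ?g = "\<lambda>i. ((norm x powr \<alpha> i) *\<^sub>R x - (norm y powr \<alpha> i) *\<^sub>R y) \<bullet> (x - y)"
  have "(Fpoly N \<alpha> a (norm x) *\<^sub>R x - Fpoly N \<alpha> a (norm y) *\<^sub>R y) \<bullet> (x - y)
      = (\<Sum>i\<in>{-1..int N}. a i * ?g i)"
    unfolding Fpoly_def scaleR_sum_left sum_subtractf[symmetric] inner_sum_left
    by (intro sum.cong refl) (simp add: inner_diff_left algebra_simps)
  also have "\<dots> \<ge> a (int N) * ?g (int N)"
    by (rule member_le_sum)
      (auto intro!: mult_nonneg_nonneg coeff_box_bounds(1)[OF a _ alo] powr_vector_monotone \<alpha>_gt)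
  moreover have "a (int N) * ?g (int N) \<ge> alo * (2 powr (- \<alpha> (int N) - 1) * norm (x - y) powr (\<alpha> (int N) + 2))"
    using a alo s_gt_2 s
    by (intro mult_mono powr_vector_strongly_monotone) (auto simp: coeff_box_def)
  moreover have "alo * (2 powr (- \<alpha> (int N) - 1) * norm (x - y) powr (\<alpha> (int N) + 2)) = mono_const * norm (x - y) powr s"
    unfolding mono_const_def unfolding s by (simp add: algebra_simps minus_diff_commute)
  ultimately show ?thesis by linarith
qed

lemma Fpoly_diff_bound:
  assumes "\<And>i. i \<in> {-1..int N} \<Longrightarrow> \<bar>a i - a' i\<bar> \<le> \<Delta>" and "z \<ge> 0"
  shows "\<bar>Fpoly N \<alpha> a z - Fpoly N \<alpha> a' z\<bar> * z \<le> \<Delta> * (N + 2) * (1 + z powr (s - 1))"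
proof -
  have D: "\<Delta> \<ge> 0" using assms(1)[of 0] by (auto intro: order_trans[OF abs_ge_zero])
  have "(Fpoly N \<alpha> a z - Fpoly N \<alpha> a' z) * z = (\<Sum>i\<in>{-1..int N}. (a i - a' i) * (z powr \<alpha> i * z))"
    unfolding Fpoly_def sum_subtractf[symmetric] sum_distrib_right
    by (simp add: algebra_simps)
  then have "\<bar>Fpoly N \<alpha> a z - Fpoly N \<alpha> a' z\<bar> * z = \<bar>\<Sum>i\<in>{-1..int N}. (a i - a' i) * (z powr \<alpha> i * z)\<bar>"
    using assms(2) abs_mult_pos by metis
  also have "\<dots> \<le> (\<Sum>i\<in>{-1..int N}. \<bar>(a i - a' i) * (z powr \<alpha> i * z)\<bar>)" by (rule sum_abs)
  also have "\<dots> \<le> (\<Sum>i\<in>{-1..int N}. \<Delta> * (1 + z powr (s - 1)))"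
    using assms D powr_mult_self_le
    by (intro sum_mono) (auto simp: abs_mult intro!: mult_mono)
  also have "\<dots> = \<Delta> * (N + 2) * (1 + z powr (s - 1))" by simp
  finally show ?thesis .
qed

text \<open>A perturbation of the zero coefficient vector, from which every entry differs by at most
  \<open>ahi\<close>.\<close>

lemma Fpoly_growth:
  assumes "a \<in> coeff_box N alo ahi" "z \<ge> 0"
  shows "\<bar>Fpoly N \<alpha> a z\<bar> * z \<le> ahi * (N + 2) * (1 + z powr (s - 1))"
proof -
  have "Fpoly N \<alpha> (\<lambda>_. 0) z = 0" by (simp add: Fpoly_def)
  then show ?thesis
    using Fpoly_diff_bound[of a "\<lambda>_. 0" ahi z] coeff_box_bounds[OF assms(1) _ alo] assms(2) by auto
qed

text \<open>Constant of \<open>powr_Young\<close> for \<open>\<delta> = mono_const / 2\<close>,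
  times the power of the factor \<open>2 * (N + 2)\<close> that arises when the perturbation is
  bounded by a single power.\<close>

definition pert_const :: real where
  "pert_const = (mono_const / 2) powr (- (1 / (s - 1))) * (2 * (N + 2)) powr (s / (s - 1))"

lemma pert_const_pos: "pert_const > 0"
  unfolding pert_const_def using mono_const_pos by simp

text \<open>Adding and subtracting the flux with coefficients \<open>a\<close> at \<open>y\<close>
  confines the change of coefficients to \<open>y\<close>. The error then contains
  \<open>norm y\<close> but not \<open>norm x\<close>, so an a priori bound for one of the two
  solutions is enough. Half of the strong monotonicity is spent on absorbing
  \<open>norm (x - y)\<close>.\<close>

lemma Fpoly_perturbed_monotone:
  fixes x y :: "'a::real_inner"
  assumes a: "a \<in> coeff_box N alo ahi"
    and d: "\<And>i. i \<in> {-1..int N} \<Longrightarrow> \<bar>a i - a' i\<bar> \<le> \<Delta>"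
  shows "mono_const / 2 * norm (x - y) powr s \<le>
    (Fpoly N \<alpha> a (norm x) *\<^sub>R x - Fpoly N \<alpha> a' (norm y) *\<^sub>R y) \<bullet> (x - y)
      + pert_const * \<Delta> powr (s / (s - 1)) * (1 + norm y powr s)"
proof -
  let ?D = "norm (x - y)" and ?z = "norm y" and ?p = "s / (s - 1)"
  define w where "w = \<Delta> * (N + 2) * (1 + ?z powr (s - 1))"
  have D: "\<Delta> \<ge> 0" using d[of 0] by (auto intro: order_trans[OF abs_ge_zero])
  have p: "?p > 0" using s_gt_2 by simp
  have m: "mono_const * ?D powr s \<le> (Fpoly N \<alpha> a (norm x) *\<^sub>R x - Fpoly N \<alpha> a (norm y) *\<^sub>R y) \<bullet> (x - y)"
    by (rule Fpoly_strongly_monotone[OF a])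
  have "(Fpoly N \<alpha> a (norm x) *\<^sub>R x - Fpoly N \<alpha> a (norm y) *\<^sub>R y) \<bullet> (x - y)
     - (Fpoly N \<alpha> a (norm x) *\<^sub>R x - Fpoly N \<alpha> a' (norm y) *\<^sub>R y) \<bullet> (x - y)
     = - ((Fpoly N \<alpha> a ?z - Fpoly N \<alpha> a' ?z) *\<^sub>R y) \<bullet> (x - y)"
    by (simp add: inner_diff_left algebra_simps)
  also have "\<dots> \<le> \<bar>((Fpoly N \<alpha> a ?z - Fpoly N \<alpha> a' ?z) *\<^sub>R y) \<bullet> (x - y)\<bar>" by simp
  also have "\<dots> \<le> (\<bar>Fpoly N \<alpha> a ?z - Fpoly N \<alpha> a' ?z\<bar> * ?z) * ?D"
    using Cauchy_Schwarz_ineq2[of "(Fpoly N \<alpha> a ?z - Fpoly N \<alpha> a' ?z) *\<^sub>R y" "x - y"] by simp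
  also have "\<dots> \<le> w * ?D"
    unfolding w_def by (intro mult_right_mono Fpoly_diff_bound d) auto
  also have "\<dots> = ?D * w" by simp
  also have "\<dots> \<le> mono_const / 2 * ?D powr s + (mono_const / 2) powr (- (1 / (s - 1))) * w powr ?p"
    using mono_const_pos s_gt_2 D by (intro powr_Young) (auto simp: w_def)
  also have "w powr ?p \<le> (2 * (N + 2)) powr ?p * \<Delta> powr ?p * (1 + ?z powr s)"
  proof -
    \<comment> \<open>With a single power in place of the sum the exponents multiply:
      \<open>(s - 1) * ?p = s\<close>.\<close>
    have "1 + ?z powr (s - 1) \<le> 2 * max 1 ?z powr (s - 1)"
    proof (cases "?z \<le> 1")
      case True
      then have "?z powr (s - 1) \<le> 1" using s_gt_2 by (intro powr_le1) auto
      then show ?thesis using True by simp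
    next
      case False
      then have "1 \<le> ?z powr (s - 1)" using s_gt_2 by (intro ge_one_powr_ge_zero) auto
      then show ?thesis using False by simp
    qed
    then have "w \<le> (2 * (N + 2)) * \<Delta> * max 1 ?z powr (s - 1)"
      unfolding w_def using D mult_left_mono[of "1 + ?z powr (s - 1)" "2 * max 1 ?z powr (s - 1)" "\<Delta> * (N + 2)"]
      by (simp add: algebra_simps)
    then have "w powr ?p \<le> ((2 * (N + 2)) * \<Delta> * max 1 ?z powr (s - 1)) powr ?p"
      using p D by (intro powr_mono2) (auto simp: w_def)
    also have "\<dots> = (2 * (N + 2)) powr ?p * \<Delta> powr ?p * max 1 ?z powr s"
      using D s_gt_2 by (simp add: powr_mult powr_powr)
    also have "max 1 ?z powr s \<le> 1 + ?z powr s" by (auto simp: max_def)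
    finally show ?thesis by (simp add: mult_left_mono)
  qed
  finally have "(Fpoly N \<alpha> a (norm x) *\<^sub>R x - Fpoly N \<alpha> a (norm y) *\<^sub>R y) \<bullet> (x - y)
     - (Fpoly N \<alpha> a (norm x) *\<^sub>R x - Fpoly N \<alpha> a' (norm y) *\<^sub>R y) \<bullet> (x - y)
     \<le> mono_const / 2 * ?D powr s + (mono_const / 2) powr (- (1 / (s - 1))) *
       ((2 * (N + 2)) powr ?p * \<Delta> powr ?p * (1 + ?z powr s))"
    by (simp add: mult_left_mono)
  then have "(Fpoly N \<alpha> a (norm x) *\<^sub>R x - Fpoly N \<alpha> a (norm y) *\<^sub>R y) \<bullet> (x - y)
     - (Fpoly N \<alpha> a (norm x) *\<^sub>R x - Fpoly N \<alpha> a' (norm y) *\<^sub>R y) \<bullet> (x - y)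
     \<le> mono_const / 2 * ?D powr s + pert_const * \<Delta> powr ?p * (1 + ?z powr s)"
    unfolding pert_const_def by (simp only: mult.assoc)
  then show ?thesis using m by linarith
qed

end

section \<open>Norms and time slices\<close>

lemma ennreal_powr_ennreal: "x \<ge> 0 \<Longrightarrow> ennreal_powr (ennreal x) p = ennreal (x powr p)"
  by (simp add: ennreal_powr_def)

lemma ennreal_powr_root:
  assumes "p > 0"
  shows "ennreal_powr (ennreal_powr x (1 / p)) p = x"
  using assms by (cases x) (auto simp: ennreal_powr_def powr_powr)

lemma ennreal_powr_mono:
  assumes "x \<le> y" "p \<ge> 0"
  shows "ennreal_powr x p \<le> ennreal_powr y p"
  using assms by (cases x; cases y) (auto simp: ennreal_powr_def powr_mono2 top_unique intro: ennreal_leI)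

lemma Lnorm_powr:
  assumes "p > 0"
  shows "ennreal_powr (Lnorm (ennreal p) M g) p = (\<integral>\<^sup>+x. ennreal_powr (g x) p \<partial>M)"
  using assms by (simp add: Lnorm_def ennreal_powr_root)

lemma Lp_norm_powr:
  assumes "p > 0"
  shows "ennreal_powr (Lp_norm (ennreal p) M u) p = (\<integral>\<^sup>+x. ennreal (norm (u x) powr p) \<partial>M)"
  unfolding Lp_norm_def Lnorm_powr[OF assms] by (simp add: ennreal_powr_ennreal)

text \<open>The inner root cancels against the outer power because both exponents agree, which
  leaves an iterated integral.\<close>

lemma bochner_norm_powr:
  assumes "p > 0"
  shows "ennreal_powr (bochner_norm (ennreal p) T (ennreal p) \<Omega> u) p
    = (\<integral>\<^sup>+t. \<integral>\<^sup>+x. ennreal (norm (u t x) powr p) \<partial>lebesgue_on \<Omega> \<partial>lebesgue_on {0..T})"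
  unfolding bochner_norm_def by (simp add: Lnorm_powr Lp_norm_powr assms)

lemma nn_integral_norm_sq_le:
  assumes "Lp_norm 2 M u \<le> ennreal B" "B \<ge> 0"
  shows "(\<integral>\<^sup>+x. ennreal ((norm (u x))\<^sup>2) \<partial>M) \<le> ennreal (B\<^sup>2)"
proof -
  have "(\<integral>\<^sup>+x. ennreal ((norm (u x))\<^sup>2) \<partial>M) = ennreal_powr (Lp_norm (ennreal 2) M u) 2"
    by (subst Lp_norm_powr) (auto simp: powr_numeral)
  also have "\<dots> \<le> ennreal_powr (ennreal B) 2"
    using assms by (intro ennreal_powr_mono) auto
  also have "\<dots> = ennreal (B\<^sup>2)" using assms by (simp add: ennreal_powr_ennreal powr_numeral)
  finally show ?thesis .
qed

lemma Lp_norm_2_eq: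
  assumes "integrable M (\<lambda>x. (norm (u x))\<^sup>2)"
  shows "Lp_norm 2 M u = ennreal (sqrt (\<integral>x. (norm (u x))\<^sup>2 \<partial>M))"
proof -
  have "Lp_norm 2 M u = ennreal_powr (\<integral>\<^sup>+x. ennreal ((norm (u x))\<^sup>2) \<partial>M) (1 / 2)"
    by (simp add: Lp_norm_def Lnorm_def ennreal_powr_ennreal powr_numeral)
  also have "(\<integral>\<^sup>+x. ennreal ((norm (u x))\<^sup>2) \<partial>M) = ennreal (\<integral>x. (norm (u x))\<^sup>2 \<partial>M)"
    by (rule nn_integral_eq_integral[OF assms]) auto
  finally show ?thesis by (simp add: ennreal_powr_ennreal powr_half_sqrt)
qed

lemma esssup_finiteE:
  fixes g :: "'a \<Rightarrow> ennreal"
  assumes "esssup M g < \<infinity>"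
  obtains B where "B \<ge> 0" "ennreal B = esssup M g" "g \<in> borel_measurable M" "AE x in M. g x \<le> ennreal B"
proof -
  obtain B where B: "B \<ge> 0" "esssup M g = ennreal B" using assms by (cases "esssup M g") auto
  moreover have "g \<in> borel_measurable M" using assms esssup_non_measurable by fastforce
  moreover have "AE x in M. g x \<le> ennreal B" using esssup_AE[of g M] B by simp
  ultimately show thesis using that by metis
qed

text \<open>The hypothesis on \<open>f\<close> is a nonnegative integral, so that a bare bound on
  the \<open>L^2\<close> norm of a time slice can be inserted.\<close>

lemma integral_mult_le_Young:
  fixes f q :: "'a \<Rightarrow> real"
  assumes f: "(\<integral>\<^sup>+x. ennreal ((f x)\<^sup>2) \<partial>M) \<le> ennreal A" and A: "A \<ge> 0"
    and [measurable]: "q \<in> borel_measurable M" and q: "integrable M (\<lambda>x. (q x)\<^sup>2)" and e: "e > 0"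
  shows "(\<integral>x. f x * q x \<partial>M) \<le> A / (2 * e) + e / 2 * (\<integral>x. (q x)\<^sup>2 \<partial>M)"
proof (cases "integrable M (\<lambda>x. f x * q x)")
  \<comment> \<open>A Bochner integral that does not exist has the value \<open>0\<close>, and the
    right-hand side is nonnegative.\<close>
  case False
  then show ?thesis using A e by (simp add: not_integrable_integral_eq)
next
  case True
  txt \<open>\<open>f\<close> need not be measurable, but it is so where \<open>q \<noteq> 0\<close>.\<close>
  then have [measurable]: "(\<lambda>x. f x * q x) \<in> borel_measurable M" by auto
  \<comment> \<open>Division by zero gives \<open>0\<close>, so \<open>g\<close> is \<open>f\<close>
    cut off to the set where \<open>q\<close> does not vanish.\<close>
  define g where "g x = f x * q x / q x" for x
  have [measurable]: "g \<in> borel_measurable M" unfolding g_def by measurable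
  have gq: "g x * q x = f x * q x" and gf: "(g x)\<^sup>2 \<le> (f x)\<^sup>2" for x by (auto simp: g_def)
  have le: "(\<integral>\<^sup>+x. ennreal ((g x)\<^sup>2) \<partial>M) \<le> ennreal A"
    using gf by (intro order_trans[OF nn_integral_mono f] ennreal_leI)
  then have gi: "integrable M (\<lambda>x. (g x)\<^sup>2)"
    by (intro integrableI_bounded) (auto simp: order_le_less_trans)
  have gA: "(\<integral>x. (g x)\<^sup>2 \<partial>M) \<le> A"
    using le nn_integral_eq_integral[OF gi] A by simp
  have pw: "f x * q x \<le> (g x)\<^sup>2 / (2 * e) + e / 2 * (q x)\<^sup>2" for x
  proof -
    have "0 \<le> (g x - e * q x)\<^sup>2 / (2 * e)" using e by simp
    also have "\<dots> = (g x)\<^sup>2 / (2 * e) + e / 2 * (q x)\<^sup>2 - g x * q x"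
      using e by (simp add: power2_eq_square field_simps)
    finally show ?thesis by (simp add: gq)
  qed
  have "(\<integral>x. f x * q x \<partial>M) \<le> (\<integral>x. (g x)\<^sup>2 / (2 * e) + e / 2 * (q x)\<^sup>2 \<partial>M)"
    using True gi q by (intro integral_mono pw) auto
  also have "\<dots> = (\<integral>x. (g x)\<^sup>2 \<partial>M) / (2 * e) + e / 2 * (\<integral>x. (q x)\<^sup>2 \<partial>M)"
    using gi q by simp
  also have "(\<integral>x. (g x)\<^sup>2 \<partial>M) / (2 * e) \<le> A / (2 * e)" using gA e by (simp add: divide_right_mono)
  finally show ?thesis by simp
qed

text \<open>Lebesgue measure on the product is the completion of
  \<open>lborel \<Otimes>\<^sub>M lborel\<close>. Completion does not change what holds almost
  everywhere, so the statement is moved to \<open>lborel\<close>, sliced there by Fubini, and moved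
  back in each factor.\<close>

lemma AE_lebesgue_on_Times:
  fixes S :: "'a::euclidean_space set" and \<Omega> :: "'b::euclidean_space set"
  assumes "S \<in> sets borel" "\<Omega> \<in> sets borel"
    and "AE (t, x) in lebesgue_on (S \<times> \<Omega>). P t x"
  shows "AE t in lebesgue_on S. AE x in lebesgue_on \<Omega>. P t x"
proof -
  have "S \<times> \<Omega> \<in> sets (borel :: ('a \<times> 'b) measure)"
    using assms by (simp add: borel_prod[symmetric])
  then have "AE z in lebesgue. z \<in> S \<times> \<Omega> \<longrightarrow> (case z of (t, x) \<Rightarrow> P t x)"
    using assms(3) by (simp add: AE_restrict_space_iff)
  then have "AE z in lborel \<Otimes>\<^sub>M lborel. z \<in> S \<times> \<Omega> \<longrightarrow> (case z of (t, x) \<Rightarrow> P t x)"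
    by (simp only: AE_completion_iff lborel_prod)
  then have "AE t in lborel. AE x in lborel. t \<in> S \<longrightarrow> x \<in> \<Omega> \<longrightarrow> P t x"
    by (auto dest!: lborel_pair.AE_pair)
  then have "AE t in lebesgue. AE x in lebesgue. t \<in> S \<longrightarrow> x \<in> \<Omega> \<longrightarrow> P t x"
    by (simp add: AE_completion_iff)
  then show ?thesis
    using assms(1,2) by (auto simp: AE_restrict_space_iff elim!: eventually_mono)
qed

text \<open>Completeness of Lebesgue measure, carried over to the restriction through extension by
  zero.\<close>

lemma borel_measurable_lebesgue_on_AE:
  fixes f g :: "'a::euclidean_space \<Rightarrow> real"
  assumes "f \<in> borel_measurable (lebesgue_on S)" "AE x in lebesgue_on S. f x = g x" "S \<in> sets lebesgue"
  shows "g \<in> borel_measurable (lebesgue_on S)"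
proof -
  have "(\<lambda>x. if x \<in> S then f x else 0) \<in> borel_measurable lebesgue"
    using assms borel_measurable_if by blast
  moreover have "AE x in lebesgue. (if x \<in> S then f x else 0) = (if x \<in> S then g x else 0)"
    using assms by (auto simp: AE_restrict_space_iff elim!: eventually_mono)
  ultimately have "(\<lambda>x. if x \<in> S then g x else 0) \<in> borel_measurable lebesgue"
    by (rule borel_measurable_AE)
  then show ?thesis using assms borel_measurable_if by blast
qed

text \<open>The slices are measurable because the essential supremum of a function that is not
  measurable is \<open>\<infinity>\<close>.\<close>

lemma coeff_functions_slices:
  assumes a: "a \<in> coeff_functions T \<Omega> N D b" and D: "D \<subseteq> coeff_box N alo ahi" and alo: "alo > 0"
    and \<Omega>: "open \<Omega>"
  shows "AE t in lebesgue_on {0..T}. (AE x in lebesgue_on \<Omega>. a t x \<in> coeff_box N alo ahi) \<and>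
     (\<forall>i\<in>{-1..int N}. (\<lambda>x. a t x i) \<in> borel_measurable (lebesgue_on \<Omega>))"
proof -
  have \<Omega>s: "\<Omega> \<in> sets lebesgue" using \<Omega> by simp
  have 1: "AE t in lebesgue_on {0..T}. AE x in lebesgue_on \<Omega>. a t x \<in> coeff_box N alo ahi"
    by (rule AE_lebesgue_on_Times) (use a D \<Omega> in \<open>auto simp: coeff_functions_def elim!: eventually_mono\<close>)
  have 2: "AE t in lebesgue_on {0..T}. (\<lambda>x. ennreal \<bar>a t x i\<bar>) \<in> borel_measurable (lebesgue_on \<Omega>)"
    if "i \<in> {-1..int N}" for i
  proof -
    have "in_bochner \<infinity> T \<infinity> \<Omega> (\<lambda>t x. a t x i)"
      using a that by (auto simp: coeff_functions_def has_weak_time_derivative_def)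
    then have "esssup (lebesgue_on {0..T}) (\<lambda>t. esssup (lebesgue_on \<Omega>) (\<lambda>x. ennreal \<bar>a t x i\<bar>)) < \<infinity>"
      by (simp add: in_bochner_def bochner_norm_def Lp_norm_def Lnorm_def)
    then obtain B where "AE t in lebesgue_on {0..T}. esssup (lebesgue_on \<Omega>) (\<lambda>x. ennreal \<bar>a t x i\<bar>) \<le> ennreal B"
      by (rule esssup_finiteE)
    then show ?thesis
    proof (rule eventually_mono)
      fix t assume "esssup (lebesgue_on \<Omega>) (\<lambda>x. ennreal \<bar>a t x i\<bar>) \<le> ennreal B"
      then have "esssup (lebesgue_on \<Omega>) (\<lambda>x. ennreal \<bar>a t x i\<bar>) < \<infinity>"
        by (simp add: order_le_less_trans)
      then show "(\<lambda>x. ennreal \<bar>a t x i\<bar>) \<in> borel_measurable (lebesgue_on \<Omega>)"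
        by (rule esssup_finiteE)
    qed
  qed
  have "AE t in lebesgue_on {0..T}. \<forall>i\<in>{-1..int N}. (\<lambda>x. ennreal \<bar>a t x i\<bar>) \<in> borel_measurable (lebesgue_on \<Omega>)"
    using 2 by (intro AE_finite_allI) auto
  with 1 show ?thesis
  proof eventually_elim
    case (elim t)
    \<comment> \<open>The essential supremum sees only the modulus; the coefficients are nonnegative
      almost everywhere, so its measurability is enough.\<close>
    have "(\<lambda>x. a t x i) \<in> borel_measurable (lebesgue_on \<Omega>)" if i: "i \<in> {-1..int N}" for i
    proof (rule borel_measurable_lebesgue_on_AE[OF _ _ \<Omega>s])
      have "(\<lambda>x. enn2real (ennreal \<bar>a t x i\<bar>)) \<in> borel_measurable (lebesgue_on \<Omega>)"
        using elim(2) i by (intro borel_measurable_enn2real) blast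
      then show "(\<lambda>x. \<bar>a t x i\<bar>) \<in> borel_measurable (lebesgue_on \<Omega>)" by simp
      show "AE x in lebesgue_on \<Omega>. \<bar>a t x i\<bar> = a t x i"
        using elim(1) by (rule eventually_mono) (use coeff_box_bounds(1)[OF _ i alo] in auto)
    qed
    with elim show ?case by auto
  qed
qed

text \<open>Each entry is at most the Euclidean norm of the vector, so the essential bound passes to
  all entries at once. \<Delta> is the distance itself, as the final estimate requires.\<close>

lemma coeff_dist_finiteE:
  assumes "coeff_dist T \<Omega> N a a' < \<infinity>"
  obtains \<Delta> where "\<Delta> \<ge> 0" "coeff_dist T \<Omega> N a a' = ennreal \<Delta>"
    "AE t in lebesgue_on {0..T}. AE x in lebesgue_on \<Omega>. \<forall>i\<in>{-1..int N}. \<bar>a t x i - a' t x i\<bar> \<le> \<Delta>"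
proof -
  let ?g = "\<lambda>t x. L2_set (\<lambda>i. a t x i - a' t x i) {-1..int N}"
  have eq: "coeff_dist T \<Omega> N a a' =
    esssup (lebesgue_on {0..T}) (\<lambda>t. esssup (lebesgue_on \<Omega>) (\<lambda>x. ennreal \<bar>?g t x\<bar>))"
    by (simp add: coeff_dist_def bochner_norm_def Lp_norm_def Lnorm_def)
  obtain \<Delta> where \<Delta>: "\<Delta> \<ge> 0" "ennreal \<Delta> = coeff_dist T \<Omega> N a a'"
    "AE t in lebesgue_on {0..T}. esssup (lebesgue_on \<Omega>) (\<lambda>x. ennreal \<bar>?g t x\<bar>) \<le> ennreal \<Delta>"
    using assms unfolding eq by (rule esssup_finiteE)
  from \<Delta>(3) have "AE t in lebesgue_on {0..T}. AE x in lebesgue_on \<Omega>. \<forall>i\<in>{-1..int N}. \<bar>a t x i - a' t x i\<bar> \<le> \<Delta>"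
  proof (rule eventually_mono)
    fix t assume le: "esssup (lebesgue_on \<Omega>) (\<lambda>x. ennreal \<bar>?g t x\<bar>) \<le> ennreal \<Delta>"
    show "AE x in lebesgue_on \<Omega>. \<forall>i\<in>{-1..int N}. \<bar>a t x i - a' t x i\<bar> \<le> \<Delta>"
      using esssup_AE[of "\<lambda>x. ennreal \<bar>?g t x\<bar>" "lebesgue_on \<Omega>"]
    proof (rule eventually_mono, intro ballI)
      fix x i assume g: "ennreal \<bar>?g t x\<bar> \<le> esssup (lebesgue_on \<Omega>) (\<lambda>x. ennreal \<bar>?g t x\<bar>)" and i: "i \<in> {-1..int N}"
      have "ennreal \<bar>?g t x\<bar> \<le> ennreal \<Delta>" by (rule order_trans[OF g le])
      then have "?g t x \<le> \<Delta>" using \<Delta>(1) by (simp only: ennreal_le_iff abs_le_iff)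
      moreover have "\<bar>a t x i - a' t x i\<bar> \<le> ?g t x"
        using member_le_L2_set[of "{-1..int N}" i "\<lambda>i. \<bar>a t x i - a' t x i\<bar>"] i
        by (simp add: L2_set_def)
      ultimately show "\<bar>a t x i - a' t x i\<bar> \<le> \<Delta>" by simp
    qed
  qed
  with \<Delta> that[OF \<Delta>(1) \<Delta>(2)[symmetric]] show thesis by blast
qed

section \<open>Finite element spaces\<close>

text \<open>A class closed under sums, products and inner products whose members are integrable over
  a finite measure. The bound is required only almost everywhere, so that the divergence of a finite
  element function, uncontrolled on element boundaries, belongs to it.\<close>

definition ess_bounded :: "'a measure \<Rightarrow> ('a \<Rightarrow> 'b::euclidean_space) \<Rightarrow> bool" where
  "ess_bounded M f \<longleftrightarrow> f \<in> borel_measurable M \<and> (\<exists>B. AE x in M. norm (f x) \<le> B)"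

lemma ess_boundedE:
  assumes "ess_bounded M f"
  obtains B where "B \<ge> 0" "AE x in M. norm (f x) \<le> B"
proof -
  obtain B where "AE x in M. norm (f x) \<le> B" using assms by (auto simp: ess_bounded_def)
  then have "AE x in M. norm (f x) \<le> max B 0" by (auto elim!: eventually_mono)
  then show thesis by (intro that[of "max B 0"]) auto
qed

lemma ess_bounded_measurable: "ess_bounded M f \<Longrightarrow> f \<in> borel_measurable M"
  by (simp add: ess_bounded_def)

lemma ess_bounded_const: "ess_bounded M (\<lambda>x. c)"
  by (auto simp: ess_bounded_def)

lemma ess_bounded_add:
  assumes "ess_bounded M f" "ess_bounded M g"
  shows "ess_bounded M (\<lambda>x. f x + g x)"
proof -
  obtain B C where B: "AE x in M. norm (f x) \<le> B" and C: "AE x in M. norm (g x) \<le> C"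
    using assms by (metis ess_boundedE)
  from B C have "AE x in M. norm (f x + g x) \<le> B + C"
    by eventually_elim (rule order_trans[OF norm_triangle_ineq add_mono])
  with assms show ?thesis by (auto simp: ess_bounded_def)
qed

lemma ess_bounded_scaleR:
  assumes "ess_bounded M f" "ess_bounded M g"
  shows "ess_bounded M (\<lambda>x. f x *\<^sub>R g x)"
proof -
  obtain B C where B: "B \<ge> 0" "AE x in M. norm (f x) \<le> B" and C: "C \<ge> 0" "AE x in M. norm (g x) \<le> C"
    using assms by (metis ess_boundedE)
  from B(2) C(2) have "AE x in M. norm (f x *\<^sub>R g x) \<le> B * C"
    by eventually_elim (use B(1) C(1) in \<open>auto intro!: mult_mono\<close>)
  with assms show ?thesis by (auto simp: ess_bounded_def)
qed

lemma ess_bounded_mult: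
  fixes f g :: "'a \<Rightarrow> real"
  assumes "ess_bounded M f" "ess_bounded M g"
  shows "ess_bounded M (\<lambda>x. f x * g x)"
  using ess_bounded_scaleR[OF assms] by simp

lemma ess_bounded_diff:
  assumes "ess_bounded M f" "ess_bounded M g"
  shows "ess_bounded M (\<lambda>x. f x - g x)"
  using ess_bounded_add[OF assms(1) ess_bounded_scaleR[OF ess_bounded_const[of M "-1"] assms(2)]] by simp

lemma ess_bounded_inner:
  assumes "ess_bounded M f" "ess_bounded M g"
  shows "ess_bounded M (\<lambda>x. f x \<bullet> g x)"
proof -
  obtain B C where B: "B \<ge> 0" "AE x in M. norm (f x) \<le> B" and C: "C \<ge> 0" "AE x in M. norm (g x) \<le> C"
    using assms by (metis ess_boundedE)
  from B(2) C(2) have "AE x in M. norm (f x \<bullet> g x) \<le> B * C"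
    by eventually_elim (use B(1) C(1) in \<open>auto intro!: mult_mono order_trans[OF Cauchy_Schwarz_ineq2]\<close>)
  with assms show ?thesis by (auto simp: ess_bounded_def)
qed

lemma ess_bounded_integrable:
  assumes "finite_measure M" "ess_bounded M f"
  shows "integrable M f"
proof -
  obtain B where "AE x in M. norm (f x) \<le> B" using assms(2) by (rule ess_boundedE)
  then show ?thesis
    using finite_measure.integrable_const_bound[OF assms(1)] assms(2) ess_bounded_measurable by metis
qed

lemma ess_bounded_continuous:
  fixes f :: "'a::euclidean_space \<Rightarrow> 'b::euclidean_space"
  assumes f: "continuous_on (closure S) f" and S: "bounded S" "S \<in> sets lebesgue"
  shows "ess_bounded (lebesgue_on S) f"
proof -
  have "compact (f ` closure S)" using f S by (simp add: compact_continuous_image compact_closure)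
  then obtain B where B: "\<And>y. y \<in> f ` closure S \<Longrightarrow> norm y \<le> B"
    using compact_imp_bounded[OF \<open>compact (f ` closure S)\<close>] unfolding bounded_iff by blast
  have "f \<in> borel_measurable (lebesgue_on S)"
    using continuous_on_subset[OF f closure_subset] S(2) by (rule continuous_imp_measurable_on_sets_lebesgue)
  moreover have "AE x in lebesgue_on S. norm (f x) \<le> B"
    using B closure_subset by (intro AE_I2) auto
  ultimately show ?thesis by (auto simp: ess_bounded_def)
qed

lemma finite_measure_lebesgue_on_bounded:
  assumes "bounded S" "S \<in> sets lebesgue"
  shows "finite_measure (lebesgue_on S)"
  using assms by (intro finite_measure_lebesgue_on bounded_set_imp_lmeasurable)

text \<open>A finite-dimensional space of functions is determined by finitely many point values, so that
  assumptions that hold pointwise in space pass to the coefficients of a basis.\<close>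

lemma finite_span_sampling:
  fixes b :: "'i \<Rightarrow> 'a \<Rightarrow> real"
  assumes I: "finite I" and b: "\<forall>i\<in>I. b i \<in> S"
    and S: "(\<lambda>x. 0) \<in> S" "\<forall>u\<in>S. \<forall>v\<in>S. (\<lambda>x. u x + v x) \<in> S" "\<forall>u\<in>S. \<forall>c. (\<lambda>x. c * u x) \<in> S"
  shows "\<exists>(m::nat) y \<theta>. (\<forall>j<m. y j \<in> X) \<and> (\<forall>j<m. \<theta> j \<in> S) \<and>
    (\<forall>g c. (\<forall>x\<in>X. g x = (\<Sum>i\<in>I. c i * b i x)) \<longrightarrow> (\<forall>x\<in>X. g x = (\<Sum>j<m. g (y j) * \<theta> j x)))"
proof -
  have Sa: "(\<lambda>x. u x + v x) \<in> S" if "u \<in> S" "v \<in> S" for u v using S(2) that by simp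
  have Sm: "(\<lambda>x. c * u x) \<in> S" if "u \<in> S" for c u using S(3) that by simp
  have Sd: "(\<lambda>x. u x - c * v x) \<in> S" if "u \<in> S" "v \<in> S" for u v c
    using Sa[OF that(1) Sm[OF that(2), of "- c"]] by simp
  have Ss: "(\<lambda>x. \<Sum>j<m. c j * \<theta> j x) \<in> S" if "\<And>j. j < m \<Longrightarrow> \<theta> j \<in> S" for c \<theta> and m :: nat
    using that by (induction m) (auto intro!: S(1) Sa Sm)
  show ?thesis
    using I b
  proof (induction I rule: finite_induct)
    case empty
    show ?case by (intro exI[of _ 0]) auto
  next
    case (insert i0 I)
    have "\<forall>i\<in>I. b i \<in> S" using insert.prems by simp
    from insert.IH[OF this] obtain m :: nat and y \<theta>
      where y: "\<forall>j<m. y j \<in> X" and \<theta>: "\<forall>j<m. \<theta> j \<in> S"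
      and rep': "\<forall>g c. (\<forall>x\<in>X. g x = (\<Sum>i\<in>I. c i * b i x)) \<longrightarrow> (\<forall>x\<in>X. g x = (\<Sum>j<m. g (y j) * \<theta> j x))"
      by (elim exE conjE) (rule that)
    have rep: "g x = (\<Sum>j<m. g (y j) * \<theta> j x)"
      if "\<forall>x\<in>X. g x = (\<Sum>i\<in>I. c i * b i x)" "x \<in> X" for g c x
      by (rule rep'[rule_format, where c = c]) (use that in auto)
    \<comment> \<open>What interpolation at the old nodes misses of the new generator; any function
      in the larger span is missed by a multiple of it.\<close>
    define L where "L x = b i0 x - (\<Sum>j<m. b i0 (y j) * \<theta> j x)" for x
    have LS: "L \<in> S"
      using Sd[OF _ Ss[of m \<theta> "\<lambda>j. b i0 (y j)"], of "b i0" 1] insert.prems \<theta> by (simp add: L_def[abs_def] sum_distrib_left)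
    have key: "g x = (\<Sum>j<m. g (y j) * \<theta> j x) + c i0 * L x"
      if g: "\<forall>x\<in>X. g x = (\<Sum>i\<in>insert i0 I. c i * b i x)" and x: "x \<in> X" for g c x
    proof -
      define w where "w x = (\<Sum>i\<in>I. c i * b i x)" for x
      have gw: "g x = c i0 * b i0 x + w x" if "x \<in> X" for x
        using g that insert.hyps by (simp add: w_def)
      have "w x = (\<Sum>j<m. w (y j) * \<theta> j x)" by (rule rep[of w c, OF _ x]) (simp add: w_def)
      moreover have "(\<Sum>j<m. g (y j) * \<theta> j x) = (\<Sum>j<m. c i0 * (b i0 (y j) * \<theta> j x) + w (y j) * \<theta> j x)"
        using gw y by (intro sum.cong refl) (simp add: algebra_simps)
      then have "(\<Sum>j<m. g (y j) * \<theta> j x) = c i0 * (\<Sum>j<m. b i0 (y j) * \<theta> j x) + (\<Sum>j<m. w (y j) * \<theta> j x)"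
        by (simp add: sum.distrib sum_distrib_left)
      ultimately show ?thesis using gw[OF x] by (simp add: L_def algebra_simps)
    qed
    \<comment> \<open>If \<open>L\<close> vanishes on \<open>X\<close>, the old nodes already
      determine the larger span; otherwise a point where it does not vanish becomes a new
      node.\<close>
    show ?case
    proof (cases "\<forall>x\<in>X. L x = 0")
      case True
      then show ?thesis using y \<theta> key by (intro exI[of _ m] exI[of _ y] exI[of _ \<theta>]) auto
    next
      case False
      then obtain x0 where x0: "x0 \<in> X" "L x0 \<noteq> 0" by auto
      define K where "K x = 1 / L x0 * L x" for x
      have KS: "K \<in> S" unfolding K_def[abs_def] by (rule Sm[OF LS])
      let ?y = "y(m := x0)"
      \<comment> \<open>\<open>K\<close> is \<open>1\<close> at the new node, and the correction
        makes the old functions vanish there, as in Newton interpolation.\<close>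
      define \<theta>' where "\<theta>' j = (if j = m then K else (\<lambda>x. \<theta> j x - \<theta> j x0 * K x))" for j
      have "g x = (\<Sum>j<Suc m. g (?y j) * \<theta>' j x)"
        if g: "\<forall>x\<in>X. g x = (\<Sum>i\<in>insert i0 I. c i * b i x)" and x: "x \<in> X" for g c x
      proof -
        have "c i0 * L x = (g x0 - (\<Sum>j<m. g (y j) * \<theta> j x0)) * K x"
          using key[OF g x0(1)] x0(2) by (simp add: K_def)
        then have "g x = (\<Sum>j<m. g (y j) * \<theta> j x) + (g x0 - (\<Sum>j<m. g (y j) * \<theta> j x0)) * K x"
          using key[OF g x] by simp
        also have "\<dots> = (\<Sum>j<m. g (y j) * (\<theta> j x - \<theta> j x0 * K x)) + g x0 * K x"
          by (simp add: right_diff_distrib left_diff_distrib sum_subtractf sum_distrib_right mult.assoc)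
        finally show ?thesis by (simp add: \<theta>'_def)
      qed
      moreover have "\<forall>j<Suc m. ?y j \<in> X" using y x0 by auto
      moreover have "\<forall>j<Suc m. \<theta>' j \<in> S" using \<theta> KS Sd by (auto simp: \<theta>'_def less_Suc_eq)
      ultimately show ?thesis
        by (intro exI[of _ "Suc m"] exI[of _ ?y] exI[of _ \<theta>']) blast
    qed
  qed
qed

section \<open>Polynomials and differences in the discrete spaces\<close>

lemma poly_space_diff:
  assumes "p \<in> poly_space k" "q \<in> poly_space k"
  shows "(\<lambda>x. p x - q x) \<in> poly_space k"
proof -
  obtain c d where "\<And>x. p x = (\<Sum>e | (\<Sum>i\<in>UNIV. e i) \<le> k. c e * (\<Prod>i\<in>UNIV. (x $ i) ^ (e i :: nat)))"
    "\<And>x. q x = (\<Sum>e | (\<Sum>i\<in>UNIV. e i) \<le> k. d e * (\<Prod>i\<in>UNIV. (x $ i) ^ (e i :: nat)))"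
    using assms by (auto simp: poly_space_def)
  then show ?thesis
    unfolding poly_space_def
    by (intro CollectI exI[of _ "\<lambda>e. c e - d e"]) (simp add: left_diff_distrib sum_subtractf)
qed

lemma poly_space_has_derivative:
  fixes p :: "real^'d \<Rightarrow> real"
  assumes "p \<in> poly_space k"
  obtains p' where "\<And>x. (p has_derivative p' x) (at x)" "\<And>v. continuous_on UNIV (\<lambda>x. p' x v)"
proof -
  obtain c where c: "\<And>x. p x = (\<Sum>e | (\<Sum>i\<in>UNIV. e i) \<le> k. c e * (\<Prod>i\<in>UNIV. (x $ i) ^ (e i :: nat)))"
    using assms by (auto simp: poly_space_def)
  define p' where "p' x v = (\<Sum>e | (\<Sum>i\<in>UNIV. e i) \<le> k. c e *
     (\<Sum>i\<in>UNIV. (of_nat (e i) * v $ i * (x $ i) ^ (e i - 1)) * (\<Prod>j\<in>UNIV - {i}. (x $ j) ^ e j)))"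
    for x v :: "real^'d"
  have "(p has_derivative p' x) (at x)" for x
    unfolding c[abs_def] p'_def[abs_def]
    by (intro has_derivative_sum has_derivative_mult_right has_derivative_prod has_derivative_power
        bounded_linear_imp_has_derivative bounded_linear_vec_nth)
  moreover have "continuous_on UNIV (\<lambda>x. p' x v)" for v
    unfolding p'_def by (intro continuous_intros)
  ultimately show thesis using that by blast
qed

lemma finite_bounded_exponents: "finite {e :: 'd::finite \<Rightarrow> nat. (\<Sum>i\<in>UNIV. e i) \<le> k}"
proof (rule finite_subset)
  show "{e :: 'd \<Rightarrow> nat. (\<Sum>i\<in>UNIV. e i) \<le> k} \<subseteq> PiE UNIV (\<lambda>_. {..k})"
  proof clarify
    fix e :: "'d \<Rightarrow> nat" assume "(\<Sum>i\<in>UNIV. e i) \<le> k"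
    moreover have "e i \<le> (\<Sum>i\<in>UNIV. e i)" for i by (rule member_le_sum) auto
    ultimately have "e i \<le> k" for i using order_trans by blast
    then show "e \<in> PiE UNIV (\<lambda>_. {..k})" by (simp add: PiE_def)
  qed
  show "finite (PiE (UNIV :: 'd set) (\<lambda>_. {..k}))" by (rule finite_PiE) auto
qed

lemma Q_space_diff:
  assumes "p \<in> Q_space \<Omega> k \<T>" "q \<in> Q_space \<Omega> k \<T>"
  shows "(\<lambda>x. p x - q x) \<in> Q_space \<Omega> k \<T>"
proof -
  have "\<exists>r\<in>poly_space k. \<forall>x\<in>\<tau>. p x - q x = r x" if "\<tau> \<in> \<T>" for \<tau>
  proof -
    have "\<exists>u\<in>poly_space k. \<forall>x\<in>\<tau>. p x = u x" "\<exists>u\<in>poly_space k. \<forall>x\<in>\<tau>. q x = u x"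
      using assms that by (simp_all add: Q_space_def)
    then obtain u v where "u \<in> poly_space k" "\<forall>x\<in>\<tau>. p x = u x" "v \<in> poly_space k" "\<forall>x\<in>\<tau>. q x = v x"
      by (elim bexE) (rule that)
    then show ?thesis by (intro bexI[OF _ poly_space_diff[of u k v]]) auto
  qed
  then show ?thesis using assms by (auto simp: Q_space_def intro: continuous_on_diff)
qed

lemma V_space_diff:
  assumes "v \<in> V_space \<Omega> k \<T>" "w \<in> V_space \<Omega> k \<T>"
  shows "(\<lambda>x. v x - w x) \<in> V_space \<Omega> k \<T>"
proof -
  have "\<exists>r\<in>poly_space k. \<forall>x\<in>\<tau>. (v x - w x) $ i = r x" if "\<tau> \<in> \<T>" for \<tau> i
  proof -
    have "\<exists>p\<in>poly_space k. \<forall>x\<in>\<tau>. v x $ i = p x" "\<exists>p\<in>poly_space k. \<forall>x\<in>\<tau>. w x $ i = p x"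
      using assms that by (simp_all add: V_space_def)
    then obtain p q where "p \<in> poly_space k" "\<forall>x\<in>\<tau>. v x $ i = p x" "q \<in> poly_space k" "\<forall>x\<in>\<tau>. w x $ i = q x"
      by (elim bexE) (rule that)
    then show ?thesis by (intro bexI[OF _ poly_space_diff[of p k q]]) auto
  qed
  then show ?thesis using assms by (auto simp: V_space_def intro: continuous_on_diff)
qed

section \<open>Elements, their null boundaries, and the divergence\<close>

lemma triangulation_compact:
  fixes \<tau> :: "(real^'d) set"
  assumes "triangulation \<Omega> \<T>" "\<tau> \<in> \<T>"
  shows "compact \<tau>"
proof -
  obtain S G where spx: "int CARD('d) simplex S \<tau>" and emb: "C1_embedding (S \<tau>) (G \<tau>)" and \<tau>: "\<tau> = G \<tau> ` S \<tau>"
    using assms unfolding triangulation_def by meson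
  obtain U G' where U: "S \<tau> \<subseteq> U"
    and d: "\<forall>x\<in>U. (G \<tau> has_derivative blinfun_apply (G' x :: (real^'d) \<Rightarrow>\<^sub>L (real^'d))) (at x)"
    using emb unfolding C1_embedding_def by auto
  have "continuous_on (S \<tau>) (G \<tau>)"
    using U d by (meson continuous_at_imp_continuous_on has_derivative_continuous subsetD)
  moreover have "compact (S \<tau>)" using spx by (rule compact_simplex)
  ultimately have "compact (G \<tau> ` S \<tau>)" by (rule compact_continuous_image)
  then show ?thesis using \<tau> by metis
qed

text \<open>Invariance of domain sends the interior of the simplex into the interior of \<tau>, so
  the frontier of \<tau> lies in the image of the frontier of a convex set. That frontier is null,
  and a differentiable map between spaces of equal dimension keeps it null.\<close>

lemma triangulation_negligible_frontier:
  fixes \<tau> :: "(real^'d) set"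
  assumes "triangulation \<Omega> \<T>" "\<tau> \<in> \<T>"
  shows "negligible (frontier \<tau>)"
proof -
  obtain S G where spx: "int CARD('d) simplex S \<tau>" and emb: "C1_embedding (S \<tau>) (G \<tau>)" and \<tau>: "\<tau> = G \<tau> ` S \<tau>"
    using assms unfolding triangulation_def by meson
  let ?S = "S \<tau>" and ?G = "G \<tau>"
  obtain U G' where U: "open U" "?S \<subseteq> U" "inj_on ?G U"
    and d: "\<forall>x\<in>U. (?G has_derivative blinfun_apply (G' x :: (real^'d) \<Rightarrow>\<^sub>L (real^'d))) (at x)"
    using emb unfolding C1_embedding_def by auto
  have S: "compact ?S" "convex ?S" using spx by (auto intro: compact_simplex convex_simplex)
  have cont: "continuous_on U ?G"
    using d by (meson continuous_at_imp_continuous_on has_derivative_continuous)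
  have "open (?G ` interior ?S)"
  proof (rule invariance_of_domain)
    show "continuous_on (interior ?S) ?G" using cont U interior_subset by (meson continuous_on_subset order_trans)
    show "inj_on ?G (interior ?S)" using U interior_subset by (meson inj_on_subset order_trans)
  qed simp
  moreover have "?G ` interior ?S \<subseteq> \<tau>" using \<tau> interior_subset by auto
  ultimately have int: "?G ` interior ?S \<subseteq> interior \<tau>" by (rule interior_maximal[rotated])
  have "closed \<tau>" using triangulation_compact[OF assms] by (rule compact_imp_closed)
  then have "frontier \<tau> = \<tau> - interior \<tau>" by (simp add: frontier_def)
  also have "\<dots> \<subseteq> ?G ` (?S - interior ?S)" using equalityD1[OF \<tau>] int by blast
  also have "?S - interior ?S = frontier ?S" using S by (simp add: frontier_def compact_imp_closed)
  finally have "frontier \<tau> \<subseteq> ?G ` frontier ?S" .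
  moreover have "negligible (?G ` frontier ?S)"
  proof (rule negligible_differentiable_image_negligible)
    show "negligible (frontier ?S)" using S by (intro negligible_convex_frontier)
    have "frontier ?S \<subseteq> U" using S U by (auto simp: frontier_def compact_imp_closed)
    then show "?G differentiable_on frontier ?S"
      using d unfolding differentiable_on_def differentiable_def
      by (meson has_derivative_at_withinI subsetD)
  qed simp
  ultimately show ?thesis by (rule negligible_subset[rotated])
qed

text \<open>Supplies the open set, of full measure in \<Omega>, on which finite element functions
  agree locally with polynomials.\<close>

lemma triangulation_AE_interior:
  fixes \<Omega> :: "(real^'d) set"
  assumes "triangulation \<Omega> \<T>" "open \<Omega>"
  shows "AE x in lebesgue_on \<Omega>. x \<in> (\<Union>\<tau>\<in>\<T>. interior \<tau>)"
proof -
  have T: "finite \<T>" "\<Union>\<T> = closure \<Omega>" using assms by (auto simp: triangulation_def)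
  have "negligible (\<Union>\<tau>\<in>\<T>. frontier \<tau>)"
    using T triangulation_negligible_frontier[OF assms(1)] by (intro negligible_Union) auto
  then have "AE x in lebesgue. x \<notin> (\<Union>\<tau>\<in>\<T>. frontier \<tau>)"
    using AE_not_in negligible_iff_null_sets by blast
  then have "AE x in lebesgue. x \<in> \<Omega> \<longrightarrow> x \<in> (\<Union>\<tau>\<in>\<T>. interior \<tau>)"
  proof (rule eventually_mono, intro impI)
    fix x assume x: "x \<notin> (\<Union>\<tau>\<in>\<T>. frontier \<tau>)" "x \<in> \<Omega>"
    then obtain \<tau> where \<tau>: "\<tau> \<in> \<T>" "x \<in> \<tau>" using T closure_subset by blast
    then have "x \<in> interior \<tau>" using x closure_subset[of \<tau>] by (auto simp: frontier_def)
    then show "x \<in> (\<Union>\<tau>\<in>\<T>. interior \<tau>)" using \<tau> by auto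
  qed
  then show ?thesis using assms(2) by (simp add: AE_restrict_space_iff)
qed

text \<open>Agreement with polynomials on an open set fixes the derivative there. In each direction
  \<open>v'\<close> is continuous on the whole space, hence bounded on the compact element.\<close>

lemma V_space_has_derivative:
  fixes v :: "real^'d \<Rightarrow> real^'d"
  assumes v: "v \<in> V_space \<Omega> k \<T>" and \<tau>: "\<tau> \<in> \<T>"
  obtains v' where "\<And>x. x \<in> interior \<tau> \<Longrightarrow> (v has_derivative v' x) (at x)"
    "\<And>h. continuous_on UNIV (\<lambda>x. v' x h)"
proof -
  have "\<exists>p. p \<in> poly_space k \<and> (\<forall>x\<in>\<tau>. v x $ i = p x)" for i
    using v \<tau> by (simp add: V_space_def Bex_def)
  then obtain p where p: "\<And>i. p i \<in> poly_space k" and vp: "\<And>i x. x \<in> \<tau> \<Longrightarrow> v x $ i = p i x"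
    by metis
  have "\<exists>p'. (\<forall>x. (p i has_derivative p' x) (at x)) \<and> (\<forall>h. continuous_on UNIV (\<lambda>x. p' x h))" for i
    using poly_space_has_derivative[OF p[of i]] by metis
  then obtain p' where p': "\<And>i x. (p i has_derivative p' i x) (at x)" "\<And>i h. continuous_on UNIV (\<lambda>x. p' i x h)"
    by metis
  show thesis
  proof (rule that[of "\<lambda>x h. \<Sum>i\<in>UNIV. p' i x h *\<^sub>R axis i 1"])
    fix x assume x: "x \<in> interior \<tau>"
    have "((\<lambda>x. \<Sum>i\<in>UNIV. p i x *\<^sub>R axis i 1 :: real^'d) has_derivative (\<lambda>h. \<Sum>i\<in>UNIV. p' i x h *\<^sub>R axis i 1)) (at x)"
      by (intro has_derivative_sum has_derivative_scaleR_left p')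
    then show "(v has_derivative (\<lambda>h. \<Sum>i\<in>UNIV. p' i x h *\<^sub>R axis i 1)) (at x)"
    proof (rule has_derivative_transform_within_open[OF _ open_interior x])
      fix z assume "z \<in> interior \<tau>"
      then have "v z $ i = p i z" for i using vp interior_subset by blast
      then show "(\<Sum>i\<in>UNIV. p i z *\<^sub>R axis i 1) = v z"
        using basis_expansion[of "v z"] by (simp add: scalar_mult_eq_scaleR)
    qed
  next
    show "continuous_on UNIV (\<lambda>x. \<Sum>i\<in>UNIV. p' i x h *\<^sub>R axis i 1 :: real^'d)" for h
      by (intro continuous_intros p')
  qed
qed

text \<open>The interiors are open and finitely many: continuity passes to their union, and the
  maximum of the bounds serves all of them.\<close>

lemma V_space_ess_bounded_divg:
  fixes v :: "real^'d \<Rightarrow> real^'d"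
  assumes T: "triangulation \<Omega> \<T>" and \<Omega>: "open \<Omega>" and v: "v \<in> V_space \<Omega> k \<T>"
  shows "ess_bounded (lebesgue_on \<Omega>) (divg v)"
proof -
  let ?W = "\<Union>\<tau>\<in>\<T>. interior \<tau>"
  have AEW: "AE x in lebesgue_on \<Omega>. x \<in> ?W" by (rule triangulation_AE_interior[OF T \<Omega>])
  have *: "continuous_on (interior \<tau>) (divg v) \<and> (\<exists>B. \<forall>x\<in>interior \<tau>. \<bar>divg v x\<bar> \<le> B)" if \<tau>: "\<tau> \<in> \<T>" for \<tau>
  proof -
    obtain v' where v': "\<And>x. x \<in> interior \<tau> \<Longrightarrow> (v has_derivative v' x) (at x)"
      "\<And>h. continuous_on UNIV (\<lambda>x. v' x h)"
      by (rule V_space_has_derivative[OF v \<tau>]) blast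
    let ?d = "\<lambda>x. \<Sum>i\<in>UNIV. v' x (axis i 1) $ i"
    have eq: "divg v x = ?d x" if "x \<in> interior \<tau>" for x
      using frechet_derivative_at[OF v'(1)[OF that]] by (simp add: divg_def)
    have cd: "continuous_on UNIV ?d" using v'(2) by (intro continuous_intros)
    then have "compact (?d ` \<tau>)"
      using triangulation_compact[OF T \<tau>] by (meson compact_continuous_image continuous_on_subset subset_UNIV)
    from compact_imp_bounded[OF this] obtain B where "\<forall>y\<in>?d ` \<tau>. \<bar>y\<bar> \<le> B"
      unfolding bounded_real by blast
    then have "\<forall>x\<in>interior \<tau>. \<bar>divg v x\<bar> \<le> B" using eq interior_subset[of \<tau>] by auto
    moreover have "continuous_on (interior \<tau>) (divg v)"
      using continuous_on_subset[OF cd] by (subst continuous_on_cong[OF refl eq]) auto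
    ultimately show ?thesis by blast
  qed
  have cW: "continuous_on ?W (divg v)"
    using * by (intro continuous_on_open_UN) auto
  have "\<exists>B. \<forall>\<tau>\<in>\<T>. \<forall>x\<in>interior \<tau>. \<bar>divg v x\<bar> \<le> B \<tau>" using * by metis
  then obtain B where B: "\<And>\<tau> x. \<tau> \<in> \<T> \<Longrightarrow> x \<in> interior \<tau> \<Longrightarrow> \<bar>divg v x\<bar> \<le> B \<tau>" by blast
  have T': "finite \<T>" using T by (simp add: triangulation_def)
  have "\<bar>divg v x\<bar> \<le> Max (B ` \<T>)" if "x \<in> ?W" for x
    using B that T' by (meson UN_E Max_ge finite_imageI imageI order_trans)
  then have "AE x in lebesgue_on \<Omega>. norm (divg v x) \<le> Max (B ` \<T>)"
    using AEW by (auto elim!: eventually_mono)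
  moreover have "divg v \<in> borel_measurable (lebesgue_on \<Omega>)"
  proof (rule borel_measurable_lebesgue_on_AE)
    \<comment> \<open>Cutting off to the open union gives a Borel function; the points of \<Omega>
      outside the union form a null set.\<close>
    have "(\<lambda>x. indicator ?W x *\<^sub>R divg v x) \<in> borel_measurable borel"
      using cW by (rule borel_measurable_continuous_on_indicator[rotated]) (simp add: open_Union)
    then show "(\<lambda>x. indicator ?W x *\<^sub>R divg v x) \<in> borel_measurable (lebesgue_on \<Omega>)"
      by (intro measurable_restrict_space1 measurable_completion) auto
    show "AE x in lebesgue_on \<Omega>. indicator ?W x *\<^sub>R divg v x = divg v x"
      using AEW by (rule eventually_mono) auto
  qed (use \<Omega> in simp)
  ultimately show ?thesis by (auto simp: ess_bounded_def)
qed

text \<open>Linearity holds only almost everywhere, since \<open>frechet_derivative\<close> is an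
  arbitrary choice where a function is not differentiable.\<close>

lemma V_space_divg_diff:
  fixes v w :: "real^'d \<Rightarrow> real^'d"
  assumes T: "triangulation \<Omega> \<T>" and \<Omega>: "open \<Omega>" and v: "v \<in> V_space \<Omega> k \<T>" and w: "w \<in> V_space \<Omega> k \<T>"
  shows "AE x in lebesgue_on \<Omega>. divg (\<lambda>x. v x - w x) x = divg v x - divg w x"
  using triangulation_AE_interior[OF T \<Omega>]
proof (rule eventually_mono)
  fix x assume "x \<in> (\<Union>\<tau>\<in>\<T>. interior \<tau>)"
  then obtain \<tau> where \<tau>: "\<tau> \<in> \<T>" "x \<in> interior \<tau>" by auto
  obtain v' where v': "(v has_derivative v') (at x)" using V_space_has_derivative[OF v \<tau>(1)] \<tau>(2) by metis
  obtain w' where w': "(w has_derivative w') (at x)" using V_space_has_derivative[OF w \<tau>(1)] \<tau>(2) by metis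
  show "divg (\<lambda>x. v x - w x) x = divg v x - divg w x"
    unfolding divg_def frechet_derivative_at[OF v', symmetric] frechet_derivative_at[OF w', symmetric]
      frechet_derivative_at[OF has_derivative_diff[OF v' w'], symmetric]
    by (simp add: sum_subtractf)
qed

text \<open>On the closure of \<Omega>, every member of \<open>Q_space\<close> lies in the span of
  the monomials cut off to disjoint pieces of the elements, to which
  \<open>finite_span_sampling\<close> applies. These generators may be discontinuous, so the
  \<theta> are only claimed to be essentially bounded, not to lie in \<open>Q_space\<close>.\<close>

lemma Q_space_sampling:
  fixes \<Omega> :: "(real^'d) set"
  assumes T: "triangulation \<Omega> \<T>" and \<Omega>: "bounded \<Omega>" "open \<Omega>"
  obtains m :: nat and y \<theta> where "\<And>j. j < m \<Longrightarrow> y j \<in> closure \<Omega>"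
    "\<And>j. j < m \<Longrightarrow> ess_bounded (lebesgue_on \<Omega>) (\<theta> j)"
    "\<And>q x. q \<in> Q_space \<Omega> k \<T> \<Longrightarrow> x \<in> closure \<Omega> \<Longrightarrow> q x = (\<Sum>j<m. q (y j) * \<theta> j x)"
proof -
  have T': "finite \<T>" "\<Union>\<T> = closure \<Omega>" using T by (auto simp: triangulation_def)
  obtain h :: "nat \<Rightarrow> _" and n :: nat where h: "\<T> = h ` {..<n}"
    using T'(1) by (metis finite_imp_nat_seg_image_inj_on lessThan_def)
  \<comment> \<open>Disjoint pieces, since the elements overlap on their boundaries.\<close>
  define A where "A j = h j - (\<Union>i<j. h i)" for j
  define E where "E = {e :: 'd \<Rightarrow> nat. (\<Sum>i\<in>UNIV. e i) \<le> k}"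
  define b where "b = (\<lambda>(j, e) x. indicator (A j) x * (\<Prod>i\<in>UNIV. (x $ i) ^ (e i :: nat)) :: real)" 
  let ?I = "{..<n} \<times> E" and ?S = "{u :: real^'d \<Rightarrow> real. ess_bounded (lebesgue_on \<Omega>) u}"
  have hc: "compact (h j)" if "j < n" for j using triangulation_compact[OF T] h that by auto
  have A: "A j \<in> sets borel" if "j < n" for j
  proof -
    have "closed (h i)" if "i < n" for i using hc[OF that] by (rule compact_imp_closed)
    then show ?thesis using that unfolding A_def by (intro sets.Diff sets.finite_UN) auto
  qed
  have bS: "b i \<in> ?S" if i: "i \<in> ?I" for i
  proof -
    obtain j e where ij: "i = (j, e)" "j < n" using i by auto
    have 1: "ess_bounded (lebesgue_on \<Omega>) (indicator (A j) :: _ \<Rightarrow> real)"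
    proof -
      have "(indicator (A j) :: _ \<Rightarrow> real) \<in> borel_measurable (lebesgue_on \<Omega>)"
        using A[OF ij(2)] by (intro measurable_restrict_space1 measurable_completion) auto
      then show ?thesis by (auto simp: ess_bounded_def indicator_def intro!: exI[of _ 1])
    qed
    have 2: "ess_bounded (lebesgue_on \<Omega>) (\<lambda>x. \<Prod>i\<in>UNIV. (x $ i) ^ e i)"
      using \<Omega> by (intro ess_bounded_continuous continuous_intros) auto
    show ?thesis using ess_bounded_mult[OF 1 2] by (simp add: b_def ij)
  qed
  have fin: "finite ?I" unfolding E_def by (intro finite_cartesian_product finite_bounded_exponents) auto
  have S: "(\<lambda>x. 0) \<in> ?S" "\<forall>u\<in>?S. \<forall>v\<in>?S. (\<lambda>x. u x + v x) \<in> ?S" "\<forall>u\<in>?S. \<forall>c. (\<lambda>x. c * u x) \<in> ?S"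
    by (simp_all add: ess_bounded_const ess_bounded_add ess_bounded_mult)
  have "\<forall>i\<in>?I. b i \<in> ?S" using bS by blast
  from finite_span_sampling[OF fin this S, where X = "closure \<Omega>"]
  obtain m :: nat and y \<theta> where y: "\<forall>j<m. y j \<in> closure \<Omega>" and \<theta>: "\<forall>j<m. \<theta> j \<in> ?S"
    and rep: "\<forall>g c. (\<forall>x\<in>closure \<Omega>. g x = (\<Sum>i\<in>?I. c i * b i x)) \<longrightarrow> (\<forall>x\<in>closure \<Omega>. g x = (\<Sum>j<m. g (y j) * \<theta> j x))"
    by (elim exE conjE) (rule that)
  show thesis
  proof (rule that[of m y \<theta>])
    fix q x assume q: "q \<in> Q_space \<Omega> k \<T>" and x: "x \<in> closure \<Omega>"
    have "\<exists>c. \<forall>x\<in>h j. q x = (\<Sum>e\<in>E. c e * (\<Prod>i\<in>UNIV. (x $ i) ^ e i))" if "j < n" for j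
    proof -
      have "\<exists>p\<in>poly_space k. \<forall>x\<in>h j. q x = p x" using q h \<open>j < n\<close> by (auto simp: Q_space_def)
      then show ?thesis by (auto simp: poly_space_def E_def)
    qed
    then obtain c where c: "\<And>j x. j < n \<Longrightarrow> x \<in> h j \<Longrightarrow> q x = (\<Sum>e\<in>E. c j e * (\<Prod>i\<in>UNIV. (x $ i) ^ e i))"
      by metis
    show "q x = (\<Sum>j<m. q (y j) * \<theta> j x)"
    proof (rule rep[THEN spec[of _ q], THEN spec[of _ "\<lambda>(j, e). c j e"], THEN mp, THEN bspec, OF ballI x])
      fix z assume "z \<in> closure \<Omega>"
      then have "\<exists>j. j < n \<and> z \<in> h j" using T'(2) h by auto
      \<comment> \<open>The least index of an element containing \<open>z\<close> names the only
        piece that contains it.\<close>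
      then obtain j where j: "j < n" "z \<in> h j" "\<And>i. i < j \<Longrightarrow> z \<notin> h i"
        using exists_least_iff[of "\<lambda>j. j < n \<and> z \<in> h j"] by (metis order_less_trans)
      have Aj: "z \<in> A i \<longleftrightarrow> i = j" if "i < n" for i
        using j(1,2) j(3)[of i] by (cases i j rule: linorder_cases) (auto simp: A_def dest: j(3))
      have "(\<Sum>i\<in>?I. (case i of (j, e) \<Rightarrow> c j e) * b i z)
          = (\<Sum>i<n. \<Sum>e\<in>E. c i e * (indicator (A i) z * (\<Prod>i\<in>UNIV. (z $ i) ^ e i)))"
        unfolding sum.cartesian_product by (simp add: b_def case_prod_unfold)
      also have "\<dots> = (\<Sum>i<n. if i = j then (\<Sum>e\<in>E. c i e * (\<Prod>i\<in>UNIV. (z $ i) ^ e i)) else 0)"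
        using Aj by (intro sum.cong refl) (auto simp: indicator_def)
      also have "\<dots> = q z" using j c[OF j(1,2)] by simp
      finally show "q z = (\<Sum>i\<in>?I. (case i of (j, e) \<Rightarrow> c j e) * b i z)" by simp
    qed
  qed (use y \<theta> in auto)
qed

section \<open>Energy estimates\<close>

lemma pairing_commute: "pairing \<Omega> u v = pairing \<Omega> v u"
  by (simp add: pairing_def inner_commute)

lemma pairing_real: "pairing \<Omega> u v = (\<integral>x. u x * v x \<partial>lebesgue_on \<Omega>)" for u v :: "_ \<Rightarrow> real"
  by (simp add: pairing_def)

text \<open>The continuous witnesses in \<open>C12\<close> are bounded on a compact set; the work is
  to identify \<open>grad\<close> and \<open>time_deriv\<close> with them. For the latter,
  derivatives within \<open>{0..T}\<close> are unique even at the endpoints because the interval has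
  positive length.\<close>

lemma C12_bounds:
  fixes \<Psi> :: "real \<Rightarrow> real^'d \<Rightarrow> real"
  assumes \<Psi>: "C12 T \<Omega> \<Psi>" and \<Omega>: "bounded \<Omega>" "open \<Omega>" and T: "T > 0"
  obtains K where "K \<ge> 0"
    "\<And>t. t \<in> {0..T} \<Longrightarrow> grad (\<Psi> t) \<in> borel_measurable (lebesgue_on \<Omega>)"
    "\<And>t. t \<in> {0..T} \<Longrightarrow> time_deriv T \<Psi> t \<in> borel_measurable (lebesgue_on \<Omega>)"
    "\<And>t. t \<in> {0..T} \<Longrightarrow> \<Psi> t \<in> borel_measurable (lebesgue_on \<Omega>)"
    "\<And>t x. t \<in> {0..T} \<Longrightarrow> x \<in> \<Omega> \<Longrightarrow> norm (grad (\<Psi> t) x) \<le> K"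
    "\<And>t x. t \<in> {0..T} \<Longrightarrow> x \<in> \<Omega> \<Longrightarrow> \<bar>time_deriv T \<Psi> t x\<bar> \<le> K"
    "\<And>t x. t \<in> {0..T} \<Longrightarrow> x \<in> \<Omega> \<Longrightarrow> \<bar>\<Psi> t x\<bar> \<le> K"
proof -
  let ?X = "{0..T} \<times> closure \<Omega>"
  obtain G u1 where c0: "continuous_on ?X (\<lambda>(t, x). \<Psi> t x)"
    and G: "continuous_on ?X (\<lambda>(t, x). G t x)" "\<And>t x. t \<in> {0..T} \<Longrightarrow> x \<in> \<Omega> \<Longrightarrow> GDERIV (\<Psi> t) x :> G t x"
    and u1: "continuous_on ?X (\<lambda>(t, x). u1 t x)"
      "\<And>t x. t \<in> {0..T} \<Longrightarrow> x \<in> closure \<Omega> \<Longrightarrow> ((\<lambda>r. \<Psi> r x) has_real_derivative u1 t x) (at t within {0..T})"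
    using \<Psi> unfolding C12_def by metis
  have X: "compact ?X" using \<Omega> by (intro compact_Times) (auto simp: compact_closure)
  have bdd: "\<exists>K. \<forall>(t, x)\<in>?X. norm (g t x) \<le> K" if "continuous_on ?X (\<lambda>(t, x). g t x)"
    for g :: "real \<Rightarrow> real^'d \<Rightarrow> 'z::real_normed_vector"
  proof -
    have "bounded ((\<lambda>(t, x). g t x) ` ?X)"
      by (rule compact_imp_bounded[OF compact_continuous_image[OF that X]])
    then show ?thesis unfolding bounded_iff by fastforce
  qed
  obtain K1 K2 K3 where K: "\<forall>(t, x)\<in>?X. norm (G t x) \<le> K1" "\<forall>(t, x)\<in>?X. norm (u1 t x) \<le> K2"
    "\<forall>(t, x)\<in>?X. norm (\<Psi> t x) \<le> K3"
    using bdd[OF G(1)] bdd[OF u1(1)] bdd[OF c0] by auto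
  have slice: "(\<lambda>x. g t x) \<in> borel_measurable (lebesgue_on \<Omega>)"
    if "continuous_on ?X (\<lambda>(t, x). g t x)" "t \<in> {0..T}" for g :: "real \<Rightarrow> real^'d \<Rightarrow> 'z::euclidean_space" and t
  proof (rule continuous_imp_measurable_on_sets_lebesgue)
    have "continuous_on \<Omega> ((\<lambda>(t, x). g t x) \<circ> (\<lambda>x. (t, x)))"
    proof (rule continuous_on_compose)
      have "(\<lambda>x. (t, x)) ` \<Omega> \<subseteq> ?X" using that(2) closure_subset[of \<Omega>] by auto
      then show "continuous_on ((\<lambda>x. (t, x)) ` \<Omega>) (\<lambda>(t, x). g t x)" by (rule continuous_on_subset[OF that(1)])
    qed (intro continuous_intros)
    then show "continuous_on \<Omega> (g t)" by (simp add: o_def)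
  qed (use \<Omega> in simp)
  have grad: "grad (\<Psi> t) x = G t x" if "t \<in> {0..T}" "x \<in> \<Omega>" for t x
  proof -
    have "(\<lambda>h. h \<bullet> G t x) = frechet_derivative (\<Psi> t) (at x)"
      using G(2)[OF that] unfolding gderiv_def by (rule frechet_derivative_at)
    then have "frechet_derivative (\<Psi> t) (at x) h = h \<bullet> G t x" for h by metis
    then show ?thesis unfolding grad_def by (simp add: vec_eq_iff inner_axis')
  qed
  have td: "time_deriv T \<Psi> t x = u1 t x" if "t \<in> {0..T}" "x \<in> \<Omega>" for t x
    unfolding time_deriv_def
    by (rule vector_derivative_within_cbox[where a = 0 and b = T, unfolded cbox_interval])
      (use that u1(2)[of t x] closure_subset T in \<open>auto simp: has_real_derivative_iff_has_vector_derivative\<close>)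
  let ?K = "max 0 (max K1 (max K2 K3))"
  have cl: "x \<in> closure \<Omega>" if "x \<in> \<Omega>" for x using that closure_subset by auto
  show thesis
  proof (rule that[of ?K])
    fix t assume t: "t \<in> {0..T}"
    show "grad (\<Psi> t) \<in> borel_measurable (lebesgue_on \<Omega>)"
      by (subst measurable_cong[where g = "G t"]) (use slice[OF G(1) t] grad[OF t] in auto)
    show "time_deriv T \<Psi> t \<in> borel_measurable (lebesgue_on \<Omega>)"
      by (subst measurable_cong[where g = "u1 t"]) (use slice[OF u1(1) t] td[OF t] in auto)
    show "\<Psi> t \<in> borel_measurable (lebesgue_on \<Omega>)" using slice[OF c0 t] by simp
    fix x assume x: "x \<in> \<Omega>"
    have tx: "(t, x) \<in> ?X" using t cl[OF x] by auto
    show "norm (grad (\<Psi> t) x) \<le> ?K" using bspec[OF K(1) tx] grad[OF t x] by simp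
    show "\<bar>time_deriv T \<Psi> t x\<bar> \<le> ?K" using bspec[OF K(2) tx] td[OF t x] by simp
    show "\<bar>\<Psi> t x\<bar> \<le> ?K" using bspec[OF K(3) tx] by simp
  qed simp
qed

section \<open>The energy identity in time\<close>

lemma integral_double_sum:
  fixes h :: "nat \<Rightarrow> nat \<Rightarrow> 'a \<Rightarrow> real"
  assumes "\<And>i j. i < m \<Longrightarrow> j < n \<Longrightarrow> integrable M (h i j)"
  shows "integrable M (\<lambda>x. \<Sum>i<m. \<Sum>j<n. c i j * h i j x)"
    and "(\<integral>x. (\<Sum>i<m. \<Sum>j<n. c i j * h i j x) \<partial>M) = (\<Sum>i<m. \<Sum>j<n. c i j * (\<integral>x. h i j x \<partial>M))"
proof -
  have j: "integrable M (\<lambda>x. \<Sum>j<n. c i j * h i j x)" if "i < m" for i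
    using assms[OF that] by (intro Bochner_Integration.integrable_sum integrable_mult_right) auto
  then show "integrable M (\<lambda>x. \<Sum>i<m. \<Sum>j<n. c i j * h i j x)"
    by (rule Bochner_Integration.integrable_sum) simp
  have "(\<integral>x. (\<Sum>i<m. \<Sum>j<n. c i j * h i j x) \<partial>M) = (\<Sum>i<m. (\<integral>x. (\<Sum>j<n. c i j * h i j x) \<partial>M))"
    by (rule Bochner_Integration.integral_sum) (use j in simp)
  also have "\<dots> = (\<Sum>i<m. \<Sum>j<n. (\<integral>x. c i j * h i j x \<partial>M))"
    using assms by (intro sum.cong refl Bochner_Integration.integral_sum) simp
  finally show "(\<integral>x. (\<Sum>i<m. \<Sum>j<n. c i j * h i j x) \<partial>M) = (\<Sum>i<m. \<Sum>j<n. c i j * (\<integral>x. h i j x \<partial>M))"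
    by simp
qed

text \<open>The weighted Gram matrix of the \<theta> carries the space integrals and leaves the time
  dependence to finitely many scalars.\<close>

lemma pairing_weight_sampled:
  fixes \<theta> :: "nat \<Rightarrow> real^'d \<Rightarrow> real"
  assumes fin: "finite_measure (lebesgue_on \<Omega>)" and \<phi>: "ess_bounded (lebesgue_on \<Omega>) \<phi>"
    and \<theta>: "\<And>j. j < m \<Longrightarrow> ess_bounded (lebesgue_on \<Omega>) (\<theta> j)"
    and u: "\<And>x. x \<in> \<Omega> \<Longrightarrow> u x = (\<Sum>j<m. c j * \<theta> j x)" and w: "\<And>x. x \<in> \<Omega> \<Longrightarrow> w x = (\<Sum>j<m. d j * \<theta> j x)"
  shows "pairing \<Omega> (\<lambda>x. \<phi> x * u x) w
    = (\<Sum>i<m. \<Sum>j<m. pairing \<Omega> (\<lambda>x. \<phi> x * \<theta> i x) (\<theta> j) * (c i * d j))"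
proof -
  have int: "integrable (lebesgue_on \<Omega>) (\<lambda>x. \<phi> x * \<theta> i x * \<theta> j x)" if "i < m" "j < m" for i j
    using fin \<phi> \<theta> that by (intro ess_bounded_integrable ess_bounded_mult) auto
  have "pairing \<Omega> (\<lambda>x. \<phi> x * u x) w
      = (\<integral>x. (\<Sum>i<m. \<Sum>j<m. (c i * d j) * (\<phi> x * \<theta> i x * \<theta> j x)) \<partial>lebesgue_on \<Omega>)"
    unfolding pairing_real
    by (intro Bochner_Integration.integral_cong refl)
      (simp add: u w sum_product sum_distrib_left sum_distrib_right algebra_simps)
  also have "\<dots> = (\<Sum>i<m. \<Sum>j<m. (c i * d j) * (\<integral>x. \<phi> x * \<theta> i x * \<theta> j x \<partial>lebesgue_on \<Omega>))"
    by (rule integral_double_sum(2)[OF int])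
  finally show ?thesis by (simp add: pairing_real mult.commute)
qed

text \<open>By sampling, the energy is a quadratic form in the scalars \<open>r t (y i)\<close>,
  which are indefinite integrals by \<open>ftc\<close>. The product rule applies to each pair of
  them, and the symmetry of the Gram matrix produces the factor \<open>2\<close>.\<close>

lemma weighted_energy_identity:
  fixes \<Omega> :: "(real^'d) set" and r r' :: "real \<Rightarrow> real^'d \<Rightarrow> real"
  assumes T: "triangulation \<Omega> \<T>" and \<Omega>: "bounded \<Omega>" "open \<Omega>" and \<phi>: "ess_bounded (lebesgue_on \<Omega>) \<phi>"
    and r: "\<And>t. t \<in> {0..T} \<Longrightarrow> r t \<in> Q_space \<Omega> k \<T>" and r': "\<And>t. t \<in> {0..T} \<Longrightarrow> r' t \<in> Q_space \<Omega> k \<T>"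
    and int: "\<And>x. x \<in> closure \<Omega> \<Longrightarrow> integrable (lebesgue_on {0..T}) (\<lambda>t. r' t x)"
    and ftc: "\<And>x t. x \<in> closure \<Omega> \<Longrightarrow> t \<in> {0..T} \<Longrightarrow> r t x = r 0 x + (\<integral>\<tau>. r' \<tau> x \<partial>lebesgue_on {0..t})"
    and "T > 0"
  shows "integrable (lebesgue_on {0..T}) (\<lambda>t. pairing \<Omega> (\<lambda>x. \<phi> x * r' t x) (r t))" (is ?int)
    and "\<And>t. t \<in> {0..T} \<Longrightarrow> pairing \<Omega> (\<lambda>x. \<phi> x * r t x) (r t)
       = pairing \<Omega> (\<lambda>x. \<phi> x * r 0 x) (r 0) + 2 * (\<integral>\<tau>. pairing \<Omega> (\<lambda>x. \<phi> x * r' \<tau> x) (r \<tau>) \<partial>lebesgue_on {0..t})"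
      (is "\<And>t. _ \<Longrightarrow> ?id t")
    and "continuous_on {0..T} (\<lambda>t. pairing \<Omega> (\<lambda>x. \<phi> x * r t x) (r t))" (is ?cont)
proof -
  obtain m :: nat and y \<theta> where y: "\<And>j. j < m \<Longrightarrow> y j \<in> closure \<Omega>"
    and \<theta>: "\<And>j. j < m \<Longrightarrow> ess_bounded (lebesgue_on \<Omega>) (\<theta> j)"
    and rep: "\<And>q x. q \<in> Q_space \<Omega> k \<T> \<Longrightarrow> x \<in> closure \<Omega> \<Longrightarrow> q x = (\<Sum>j<m. q (y j) * \<theta> j x)"
    by (rule Q_space_sampling[OF T \<Omega>, of k]) blast
  have fin: "finite_measure (lebesgue_on \<Omega>)" using \<Omega> by (intro finite_measure_lebesgue_on_bounded) auto
  define M where "M i j = pairing \<Omega> (\<lambda>x. \<phi> x * \<theta> i x) (\<theta> j)" for i j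
  have M: "M i j = M j i" for i j unfolding M_def pairing_real by (simp add: ac_simps)
  have samp: "pairing \<Omega> (\<lambda>x. \<phi> x * u x) w = (\<Sum>i<m. \<Sum>j<m. M i j * (u (y i) * w (y j)))"
    if "u \<in> Q_space \<Omega> k \<T>" "w \<in> Q_space \<Omega> k \<T>" for u w
    unfolding M_def
    by (rule pairing_weight_sampled[OF fin \<phi> \<theta>])
      (use rep that closure_subset[of \<Omega>] in blast)+
  have ibp: "integrable (lebesgue_on {0..t}) (\<lambda>\<tau>. r' \<tau> (y i) * r \<tau> (y j))"
    "r t (y i) * r t (y j) - r 0 (y i) * r 0 (y j)
      = (\<integral>\<tau>. r' \<tau> (y i) * r \<tau> (y j) \<partial>lebesgue_on {0..t}) + (\<integral>\<tau>. r' \<tau> (y j) * r \<tau> (y i) \<partial>lebesgue_on {0..t})"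
    if t: "t \<in> {0..T}" and ij: "i < m" "j < m" for t i j
  proof -
    have sub: "integrable (lebesgue_on {0..t}) (\<lambda>\<tau>. r' \<tau> (y i))" if "i < m" for i
      using integrable_subinterval[OF int[OF y[OF that]]] t by auto
    have f: "r \<tau> (y i) = r 0 (y i) + (\<integral>\<sigma>. r' \<sigma> (y i) \<partial>lebesgue_on {0..\<tau>})" if "\<tau> \<in> {0..t}" "i < m" for \<tau> i
      using ftc[OF y[OF that(2)], of \<tau>] that t by auto
    have t0: "0 \<le> t" using t by simp
    note l = lebesgue_on_mult_indefinite_integrals[where F = "\<lambda>\<tau>. r \<tau> (y i)" and G = "\<lambda>\<tau>. r \<tau> (y j)",
        OF sub[OF ij(1)] sub[OF ij(2)] f[OF _ ij(1)] f[OF _ ij(2)] t0]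
    show "integrable (lebesgue_on {0..t}) (\<lambda>\<tau>. r' \<tau> (y i) * r \<tau> (y j))" using l(1) by simp
    show "r t (y i) * r t (y j) - r 0 (y i) * r 0 (y j)
      = (\<integral>\<tau>. r' \<tau> (y i) * r \<tau> (y j) \<partial>lebesgue_on {0..t}) + (\<integral>\<tau>. r' \<tau> (y j) * r \<tau> (y i) \<partial>lebesgue_on {0..t})"
      using l(3) by (simp add: mult.commute)
  qed
  have e: "pairing \<Omega> (\<lambda>x. \<phi> x * r' t x) (r t) = (\<Sum>i<m. \<Sum>j<m. M i j * (r' t (y i) * r t (y j)))"
    if "t \<in> {0..T}" for t by (rule samp[OF r'[OF that] r[OF that]])
  have int_e: "integrable (lebesgue_on {0..t}) (\<lambda>\<tau>. \<Sum>i<m. \<Sum>j<m. M i j * (r' \<tau> (y i) * r \<tau> (y j)))"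
    if "t \<in> {0..T}" for t by (rule integral_double_sum(1)[OF ibp(1)[OF that]])
  show I: ?int
    using int_e[of T] \<open>T > 0\<close> e by (subst Bochner_Integration.integrable_cong[OF refl]) auto
  show id: "?id t" if t: "t \<in> {0..T}" for t
  proof -
    have "(\<integral>\<tau>. pairing \<Omega> (\<lambda>x. \<phi> x * r' \<tau> x) (r \<tau>) \<partial>lebesgue_on {0..t})
      = (\<integral>\<tau>. (\<Sum>i<m. \<Sum>j<m. M i j * (r' \<tau> (y i) * r \<tau> (y j))) \<partial>lebesgue_on {0..t})"
      using e t by (intro Bochner_Integration.integral_cong) auto
    also have "\<dots> = (\<Sum>i<m. \<Sum>j<m. M i j * (\<integral>\<tau>. r' \<tau> (y i) * r \<tau> (y j) \<partial>lebesgue_on {0..t}))"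
      by (rule integral_double_sum(2)[OF ibp(1)[OF t]])
    finally have E: "(\<integral>\<tau>. pairing \<Omega> (\<lambda>x. \<phi> x * r' \<tau> x) (r \<tau>) \<partial>lebesgue_on {0..t})
      = (\<Sum>i<m. \<Sum>j<m. M i j * (\<integral>\<tau>. r' \<tau> (y i) * r \<tau> (y j) \<partial>lebesgue_on {0..t}))" (is "_ = ?E") .
    \<comment> \<open>The product rule yields two double sums; they agree after exchanging
      \<open>i\<close> and \<open>j\<close>.\<close>
    have E': "?E = (\<Sum>i<m. \<Sum>j<m. M i j * (\<integral>\<tau>. r' \<tau> (y j) * r \<tau> (y i) \<partial>lebesgue_on {0..t}))"
      by (subst sum.swap) (simp add: M)
    have "pairing \<Omega> (\<lambda>x. \<phi> x * r t x) (r t) - pairing \<Omega> (\<lambda>x. \<phi> x * r 0 x) (r 0)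
      = (\<Sum>i<m. \<Sum>j<m. M i j * (r t (y i) * r t (y j) - r 0 (y i) * r 0 (y j)))"
      using t \<open>T > 0\<close> by (simp add: samp r sum_subtractf right_diff_distrib)
    also have "\<dots> = (\<Sum>i<m. \<Sum>j<m. M i j * (\<integral>\<tau>. r' \<tau> (y i) * r \<tau> (y j) \<partial>lebesgue_on {0..t})
        + M i j * (\<integral>\<tau>. r' \<tau> (y j) * r \<tau> (y i) \<partial>lebesgue_on {0..t}))"
      using ibp(2)[OF t] by (intro sum.cong refl) (simp add: distrib_left)
    also have "\<dots> = ?E + ?E" by (simp add: sum.distrib flip: E')
    finally show ?thesis unfolding E by simp
  qed
  show ?cont
    by (subst continuous_on_cong[OF refl id], assumption)
      (intro continuous_intros indefinite_integral_continuous_real I)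
qed

text \<open>Testing with \<open>p\<close> itself gives
  \<open>(p, p) = (g, p) \<le> A / 2 + (p, p) / 2\<close>, a bound that is the same for every
  discrete space.\<close>

lemma L2_projection_bound:
  assumes p: "is_L2_projection \<Omega> Q g p" and pb: "ess_bounded (lebesgue_on \<Omega>) p"
    and fin: "finite_measure (lebesgue_on \<Omega>)"
    and g: "(\<integral>\<^sup>+x. ennreal ((g x)\<^sup>2) \<partial>lebesgue_on \<Omega>) \<le> ennreal A" "A \<ge> 0"
  shows "pairing \<Omega> p p \<le> A"
proof -
  have "integrable (lebesgue_on \<Omega>) (\<lambda>x. (p x)\<^sup>2)"
    unfolding power2_eq_square using fin pb by (intro ess_bounded_integrable ess_bounded_mult)
  moreover have "p \<in> borel_measurable (lebesgue_on \<Omega>)" using pb by (rule ess_bounded_measurable)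
  ultimately have "pairing \<Omega> g p \<le> A / 2 + 1 / 2 * pairing \<Omega> p p"
    using integral_mult_le_Young[OF g, of p 1] by (simp add: pairing_real power2_eq_square)
  moreover have "pairing \<Omega> p p = pairing \<Omega> g p" using p by (simp add: is_L2_projection_def)
  ultimately show ?thesis by simp
qed

text \<open>Testing with the difference of the two projections shows that its square integrates to
  \<open>0\<close>. This makes the energy of the difference of two solutions start at
  \<open>0\<close>.\<close>

lemma L2_projection_unique:
  fixes \<Omega> :: "(real^'d) set"
  assumes "is_L2_projection \<Omega> (Q_space \<Omega> k \<T>) g p" "is_L2_projection \<Omega> (Q_space \<Omega> k \<T>) g q"
    and \<Omega>: "bounded \<Omega>" "open \<Omega>"
  shows "AE x in lebesgue_on \<Omega>. p x - q x = 0"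
proof -
  let ?d = "\<lambda>x. p x - q x"
  have pq: "p \<in> Q_space \<Omega> k \<T>" "q \<in> Q_space \<Omega> k \<T>" using assms by (auto simp: is_L2_projection_def)
  then have d: "?d \<in> Q_space \<Omega> k \<T>" by (rule Q_space_diff)
  have fin: "finite_measure (lebesgue_on \<Omega>)" using \<Omega> by (intro finite_measure_lebesgue_on_bounded) auto
  have eb: "ess_bounded (lebesgue_on \<Omega>) u" if "u \<in> Q_space \<Omega> k \<T>" for u
    using that \<Omega> by (intro ess_bounded_continuous) (auto simp: Q_space_def)
  have int: "integrable (lebesgue_on \<Omega>) (\<lambda>x. u x * w x)" if "u \<in> Q_space \<Omega> k \<T>" "w \<in> Q_space \<Omega> k \<T>" for u w
    using fin that by (intro ess_bounded_integrable ess_bounded_mult eb)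
  have "pairing \<Omega> p ?d = pairing \<Omega> q ?d" using assms(1,2) d by (simp add: is_L2_projection_def)
  then have "(\<integral>x. ?d x * ?d x \<partial>lebesgue_on \<Omega>) = 0"
    using int[OF pq(1) d] int[OF pq(2) d] by (simp add: pairing_real left_diff_distrib)
  then have "AE x in lebesgue_on \<Omega>. ?d x * ?d x = 0"
    using integral_nonneg_eq_0_iff_AE[OF int[OF d d]] by auto
  then show ?thesis by (rule eventually_mono) simp
qed

lemma AE_lebesgue_on_subset:
  assumes "AE x in lebesgue_on S. P x" "R \<subseteq> S" "R \<in> sets lebesgue" "S \<in> sets lebesgue"
  shows "AE x in lebesgue_on R. P x"
  using assms by (auto simp: AE_restrict_space_iff elim!: eventually_mono)

lemma integral_lebesgue_on_const: "0 \<le> t \<Longrightarrow> (\<integral>x. c \<partial>lebesgue_on {0..t}) = t * (c::real)"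
  by (simp add: measure_restrict_space)

lemma pairing_diff_left:
  assumes "finite_measure (lebesgue_on \<Omega>)"
    and "ess_bounded (lebesgue_on \<Omega>) u" "ess_bounded (lebesgue_on \<Omega>) v" "ess_bounded (lebesgue_on \<Omega>) w"
  shows "pairing \<Omega> (\<lambda>x. u x - v x) w = pairing \<Omega> u w - pairing \<Omega> v w"
proof -
  have "integrable (lebesgue_on \<Omega>) (\<lambda>x. u x \<bullet> w x)" "integrable (lebesgue_on \<Omega>) (\<lambda>x. v x \<bullet> w x)"
    using assms by (auto intro: ess_bounded_integrable ess_bounded_inner)
  then show ?thesis by (simp add: pairing_def inner_diff_left)
qed

lemma pairing_cong_AE:
  assumes "AE x in lebesgue_on \<Omega>. u x = v x"
    and "ess_bounded (lebesgue_on \<Omega>) u" "ess_bounded (lebesgue_on \<Omega>) v" "ess_bounded (lebesgue_on \<Omega>) w"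
  shows "pairing \<Omega> u w = pairing \<Omega> v w"
  unfolding pairing_def
proof (rule integral_cong_AE)
  show "AE x in lebesgue_on \<Omega>. u x \<bullet> w x = v x \<bullet> w x" using assms(1) by (rule eventually_mono) simp
qed (use assms in \<open>auto intro!: ess_bounded_measurable ess_bounded_inner\<close>)

lemma ess_bounded_norm_powr:
  assumes w: "ess_bounded M w" and p: "p \<ge> 0"
  shows "ess_bounded M (\<lambda>x. norm (w x) powr p)"
proof -
  obtain B where B: "AE x in M. norm (w x) \<le> B" using w by (rule ess_boundedE)
  have "AE x in M. norm (norm (w x) powr p) \<le> B powr p"
    using B by (rule eventually_mono) (use p in \<open>auto intro: powr_mono2\<close>)
  moreover have "(\<lambda>x. norm (w x) powr p) \<in> borel_measurable M"
    using ess_bounded_measurable[OF w] by measurable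
  ultimately show ?thesis by (auto simp: ess_bounded_def)
qed

section \<open>Integrated coercivity and perturbation of the flux\<close>

context forchheimer
begin

lemma ess_bounded_flux:
  assumes a: "AE x in M. a x \<in> coeff_box N alo ahi"
    and am: "\<And>i. i \<in> {-1..int N} \<Longrightarrow> (\<lambda>x. a x i) \<in> borel_measurable M"
    and w: "ess_bounded M w"
  shows "ess_bounded M (\<lambda>x. Fpoly N \<alpha> (a x) (norm (w x)) *\<^sub>R w x)"
proof -
  obtain B where B: "AE x in M. norm (w x) \<le> B" using w by (rule ess_boundedE)
  have [measurable]: "w \<in> borel_measurable M" by (rule ess_bounded_measurable[OF w])
  have "(\<lambda>x. Fpoly N \<alpha> (a x) (norm (w x))) \<in> borel_measurable M"
    unfolding Fpoly_def using am by (intro borel_measurable_sum borel_measurable_times) auto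
  then have "(\<lambda>x. Fpoly N \<alpha> (a x) (norm (w x)) *\<^sub>R w x) \<in> borel_measurable M" by measurable
  moreover have "AE x in M. norm (Fpoly N \<alpha> (a x) (norm (w x)) *\<^sub>R w x) \<le> ahi * (N + 2) * (1 + B powr (s - 1))"
    using a B
  proof eventually_elim
    case (elim x)
    have "norm (Fpoly N \<alpha> (a x) (norm (w x)) *\<^sub>R w x) \<le> ahi * (N + 2) * (1 + norm (w x) powr (s - 1))"
      using Fpoly_growth[OF elim(1), of "norm (w x)"] by simp
    also have "\<dots> \<le> ahi * (N + 2) * (1 + B powr (s - 1))"
      using elim(2) alo alo_ahi s_gt_2 by (intro mult_left_mono add_left_mono powr_mono2) auto
    finally show ?case .
  qed
  ultimately show ?thesis by (auto simp: ess_bounded_def)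
qed

text \<open>Strong monotonicity against the vector \<open>0\<close>, where the flux
  vanishes.\<close>

lemma flux_coercive:
  fixes w :: "real^'d \<Rightarrow> real^'d"
  assumes fin: "finite_measure (lebesgue_on \<Omega>)"
    and a: "AE x in lebesgue_on \<Omega>. a x \<in> coeff_box N alo ahi"
    and am: "\<And>i. i \<in> {-1..int N} \<Longrightarrow> (\<lambda>x. a x i) \<in> borel_measurable (lebesgue_on \<Omega>)"
    and w: "ess_bounded (lebesgue_on \<Omega>) w"
  shows "mono_const * (\<integral>x. norm (w x) powr s \<partial>lebesgue_on \<Omega>)
    \<le> pairing \<Omega> (\<lambda>x. Fpoly N \<alpha> (a x) (norm (w x)) *\<^sub>R w x) w"
proof -
  have "(\<integral>x. mono_const * norm (w x) powr s \<partial>lebesgue_on \<Omega>)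
    \<le> (\<integral>x. (Fpoly N \<alpha> (a x) (norm (w x)) *\<^sub>R w x) \<bullet> w x \<partial>lebesgue_on \<Omega>)"
  proof (rule integral_mono_AE)
    show "integrable (lebesgue_on \<Omega>) (\<lambda>x. mono_const * norm (w x) powr s)"
      using fin w s_gt_2 by (intro ess_bounded_integrable ess_bounded_mult ess_bounded_const ess_bounded_norm_powr) auto
    show "integrable (lebesgue_on \<Omega>) (\<lambda>x. (Fpoly N \<alpha> (a x) (norm (w x)) *\<^sub>R w x) \<bullet> w x)"
      using fin a am w by (intro ess_bounded_integrable ess_bounded_inner ess_bounded_flux) auto
    show "AE x in lebesgue_on \<Omega>. mono_const * norm (w x) powr s \<le> (Fpoly N \<alpha> (a x) (norm (w x)) *\<^sub>R w x) \<bullet> w x"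
      using a
    proof (rule eventually_mono)
      fix x assume "a x \<in> coeff_box N alo ahi"
      from Fpoly_strongly_monotone[OF this, of "w x" 0]
      show "mono_const * norm (w x) powr s \<le> (Fpoly N \<alpha> (a x) (norm (w x)) *\<^sub>R w x) \<bullet> w x" by simp
    qed
  qed
  then show ?thesis by (simp add: pairing_def)
qed

lemma flux_difference:
  fixes w w' :: "real^'d \<Rightarrow> real^'d"
  assumes fin: "finite_measure (lebesgue_on \<Omega>)" and \<Omega>: "\<Omega> \<in> sets lebesgue"
    and a: "AE x in lebesgue_on \<Omega>. a x \<in> coeff_box N alo ahi" "AE x in lebesgue_on \<Omega>. a' x \<in> coeff_box N alo ahi"
    and am: "\<And>i. i \<in> {-1..int N} \<Longrightarrow> (\<lambda>x. a x i) \<in> borel_measurable (lebesgue_on \<Omega>)"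
      "\<And>i. i \<in> {-1..int N} \<Longrightarrow> (\<lambda>x. a' x i) \<in> borel_measurable (lebesgue_on \<Omega>)"
    and d: "AE x in lebesgue_on \<Omega>. \<forall>i\<in>{-1..int N}. \<bar>a x i - a' x i\<bar> \<le> \<Delta>"
    and w: "ess_bounded (lebesgue_on \<Omega>) w" "ess_bounded (lebesgue_on \<Omega>) w'"
  shows "mono_const / 2 * (\<integral>x. norm (w x - w' x) powr s \<partial>lebesgue_on \<Omega>)
    \<le> pairing \<Omega> (\<lambda>x. Fpoly N \<alpha> (a x) (norm (w x)) *\<^sub>R w x) (\<lambda>x. w x - w' x)
      - pairing \<Omega> (\<lambda>x. Fpoly N \<alpha> (a' x) (norm (w' x)) *\<^sub>R w' x) (\<lambda>x. w x - w' x)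
      + pert_const * \<Delta> powr (s / (s - 1)) * (measure lebesgue \<Omega> + (\<integral>x. norm (w' x) powr s \<partial>lebesgue_on \<Omega>))"
proof -
  let ?M = "lebesgue_on \<Omega>"
  let ?F = "\<lambda>x. Fpoly N \<alpha> (a x) (norm (w x)) *\<^sub>R w x" and ?F' = "\<lambda>x. Fpoly N \<alpha> (a' x) (norm (w' x)) *\<^sub>R w' x"
  let ?d = "\<lambda>x. w x - w' x" and ?c = "pert_const * \<Delta> powr (s / (s - 1))"
  have F: "ess_bounded ?M ?F" "ess_bounded ?M ?F'" "ess_bounded ?M ?d"
    using a am w by (auto intro: ess_bounded_flux ess_bounded_diff)
  have P: "ess_bounded ?M (\<lambda>x. norm (w' x) powr s)" "ess_bounded ?M (\<lambda>x. norm (?d x) powr s)"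
    using w F s_gt_2 by (auto intro!: ess_bounded_norm_powr)
  have i1: "integrable ?M (\<lambda>x. (?F x - ?F' x) \<bullet> ?d x)"
    by (intro ess_bounded_integrable[OF fin] ess_bounded_inner[OF ess_bounded_diff[OF F(1,2)] F(3)])
  have i2: "integrable ?M (\<lambda>x. 1 + norm (w' x) powr s)"
    using fin P by (intro ess_bounded_integrable ess_bounded_add ess_bounded_const)
  have "(\<integral>x. mono_const / 2 * norm (?d x) powr s \<partial>?M)
    \<le> (\<integral>x. (?F x - ?F' x) \<bullet> ?d x + ?c * (1 + norm (w' x) powr s) \<partial>?M)"
  proof (rule integral_mono_AE)
    show "integrable ?M (\<lambda>x. mono_const / 2 * norm (?d x) powr s)"
      using fin P by (intro ess_bounded_integrable ess_bounded_mult ess_bounded_const)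
    show "integrable ?M (\<lambda>x. (?F x - ?F' x) \<bullet> ?d x + ?c * (1 + norm (w' x) powr s))"
      using i1 i2 by auto
    show "AE x in ?M. mono_const / 2 * norm (?d x) powr s \<le> (?F x - ?F' x) \<bullet> ?d x + ?c * (1 + norm (w' x) powr s)"
      using a(1) d by eventually_elim (rule Fpoly_perturbed_monotone, auto)
  qed
  also have "\<dots> = (\<integral>x. (?F x - ?F' x) \<bullet> ?d x \<partial>?M) + ?c * (\<integral>x. 1 + norm (w' x) powr s \<partial>?M)"
    using i1 i2 by simp
  also have "(\<integral>x. (?F x - ?F' x) \<bullet> ?d x \<partial>?M) = pairing \<Omega> ?F ?d - pairing \<Omega> ?F' ?d"
    using pairing_diff_left[OF fin F] by (simp add: pairing_def)
  also have "(\<integral>x. 1 + norm (w' x) powr s \<partial>?M) = measure lebesgue \<Omega> + (\<integral>x. norm (w' x) powr s \<partial>?M)"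
    using ess_bounded_integrable[OF fin P(1)] ess_bounded_integrable[OF fin ess_bounded_const[of _ "1::real"]] \<Omega>
    by (simp add: measure_restrict_space)
  finally show ?thesis by simp
qed

end

lemma integral_lebesgue_on_initial_le:
  fixes e g :: "real \<Rightarrow> real"
  assumes "integrable (lebesgue_on {0..T}) e" "integrable (lebesgue_on {0..T}) g"
    and "AE t in lebesgue_on {0..T}. e t \<le> g t" and "t \<in> {0..T}"
  shows "(\<integral>\<tau>. e \<tau> \<partial>lebesgue_on {0..t}) \<le> (\<integral>\<tau>. g \<tau> \<partial>lebesgue_on {0..t})"
proof (rule integral_mono_AE)
  have sub: "{0..t} \<subseteq> {0..T}" using assms(4) by auto
  show "integrable (lebesgue_on {0..t}) e" "integrable (lebesgue_on {0..t}) g"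
    using integrable_subinterval[OF assms(1) sub] integrable_subinterval[OF assms(2) sub] by auto
  show "AE \<tau> in lebesgue_on {0..t}. e \<tau> \<le> g \<tau>"
    by (rule AE_lebesgue_on_subset[OF assms(3) sub]) auto
qed

text \<open>Only the data are fixed. Triangulations, coefficient functions and solutions stay
  outside, so a constant obtained here depends neither on the mesh nor on the distance of the
  coefficients.\<close>

locale forchheimer_problem = forchheimer N \<alpha> alo ahi s
  for N \<alpha> alo ahi s +
  fixes \<Omega> :: "(real^'d) set" and T \<phi>lo \<phi>hi b :: real and \<phi> \<rho>0 :: "real^'d \<Rightarrow> real"
    and f \<Psi> :: "real \<Rightarrow> real^'d \<Rightarrow> real" and D :: "(int \<Rightarrow> real) set" and k :: nat
  assumes \<Omega>: "bounded \<Omega>" "open \<Omega>" and T: "T > 0" and D: "D \<subseteq> coeff_box N alo ahi"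
    and \<phi>lo: "0 < \<phi>lo" and \<phi>_bounds: "\<And>x. x \<in> \<Omega> \<Longrightarrow> \<phi>lo \<le> \<phi> x \<and> \<phi> x \<le> \<phi>hi"
    and \<phi>_measurable: "\<phi> \<in> borel_measurable (lebesgue_on \<Omega>)"
    and f: "in_bochner \<infinity> T 2 \<Omega> f" and \<Psi>: "C12 T \<Omega> \<Psi>" and \<rho>0: "in_Lp 2 (lebesgue_on \<Omega>) \<rho>0"
begin

abbreviation "\<mu> \<equiv> lebesgue_on \<Omega>"
abbreviation "Q \<equiv> Q_space \<Omega> k"
abbreviation "V \<equiv> V_space \<Omega> k"

definition flux :: "(real^'d \<Rightarrow> int \<Rightarrow> real) \<Rightarrow> (real^'d \<Rightarrow> real^'d) \<Rightarrow> real^'d \<Rightarrow> real^'d" where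
  "flux a w x = Fpoly N \<alpha> (a x) (norm (w x)) *\<^sub>R w x"

definition weighted :: "(real^'d \<Rightarrow> real) \<Rightarrow> (real^'d \<Rightarrow> real) \<Rightarrow> real" where
  "weighted u w = pairing \<Omega> (\<lambda>x. \<phi> x * u x) w"

definition solves_at where
  "solves_at \<T> a m r r' t \<longleftrightarrow>
     (\<forall>v\<in>V \<T>. pairing \<Omega> (flux (a t) (m t)) v - pairing \<Omega> (r t) (divg v) = - pairing \<Omega> (grad (\<Psi> t)) v) \<and>
     (\<forall>q\<in>Q \<T>. weighted (r' t) q + pairing \<Omega> (divg (m t)) q
        = pairing \<Omega> (f t) q - weighted (time_deriv T \<Psi> t) q)"

text \<open>The time derivative \<open>r'\<close> is an argument, so that the equations at a given
  time and the energy identity speak of the same function.\<close>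

definition solves where
  "solves \<T> a m r r' \<longleftrightarrow>
     (\<forall>t\<in>{0..T}. m t \<in> V \<T> \<and> r t \<in> Q \<T>) \<and>
     is_L2_projection \<Omega> (Q \<T>) (\<lambda>x. \<rho>0 x - \<Psi> 0 x) (r 0) \<and>
     (\<forall>t\<in>{0..T}. r' t \<in> Q \<T>) \<and>
     (\<forall>x\<in>closure \<Omega>. integrable (lebesgue_on {0..T}) (\<lambda>t. r' t x) \<and>
        (\<forall>t\<in>{0..T}. r t x = r 0 x + (\<integral>\<tau>. r' \<tau> x \<partial>lebesgue_on {0..t}))) \<and>
     (AE t in lebesgue_on {0..T}. solves_at \<T> a m r r' t)"

lemma semidiscrete_solution_solves:
  assumes "semidiscrete_solution \<Omega> T \<phi> f \<Psi> \<rho>0 N \<alpha> (V \<T>) (Q \<T>) a m r"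
  obtains r' where "solves \<T> a m r r'"
proof -
  have "\<exists>r'. solves \<T> a m r r'"
    using assms unfolding semidiscrete_solution_def solves_def solves_at_def flux_def[abs_def] weighted_def
    by blast
  then show thesis using that by blast
qed

lemma fin: "finite_measure \<mu>"
  using \<Omega> by (intro finite_measure_lebesgue_on_bounded) auto

lemma \<Omega>_sets: "\<Omega> \<in> sets lebesgue"
  using \<Omega> by simp

lemma Q_ess_bounded: "u \<in> Q \<T> \<Longrightarrow> ess_bounded \<mu> u"
  using \<Omega> by (intro ess_bounded_continuous) (auto simp: Q_space_def)

lemma V_ess_bounded: "v \<in> V \<T> \<Longrightarrow> ess_bounded \<mu> v"
  using \<Omega> by (intro ess_bounded_continuous) (auto simp: V_space_def)

lemma \<phi>_ess_bounded: "ess_bounded \<mu> \<phi>"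
proof -
  have "AE x in \<mu>. norm (\<phi> x) \<le> \<phi>hi"
    using \<phi>_bounds \<phi>lo by (intro AE_I2) fastforce
  then show ?thesis using \<phi>_measurable by (auto simp: ess_bounded_def)
qed

lemma weighted_bounds:
  assumes "ess_bounded \<mu> u"
  shows "\<phi>lo * pairing \<Omega> u u \<le> weighted u u" "weighted u u \<le> \<phi>hi * pairing \<Omega> u u" "0 \<le> pairing \<Omega> u u"
proof -
  have i: "integrable \<mu> (\<lambda>x. u x * u x)" "integrable \<mu> (\<lambda>x. \<phi> x * u x * u x)"
    using fin assms \<phi>_ess_bounded by (auto intro!: ess_bounded_integrable ess_bounded_mult)
  have "(\<integral>x. \<phi>lo * (u x * u x) \<partial>\<mu>) \<le> (\<integral>x. \<phi> x * u x * u x \<partial>\<mu>)"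
    using i \<phi>_bounds by (intro integral_mono) (auto simp: mult.assoc mult_right_mono)
  then show "\<phi>lo * pairing \<Omega> u u \<le> weighted u u" by (simp add: weighted_def pairing_real)
  have "(\<integral>x. \<phi> x * u x * u x \<partial>\<mu>) \<le> (\<integral>x. \<phi>hi * (u x * u x) \<partial>\<mu>)"
    using i \<phi>_bounds by (intro integral_mono) (auto simp: mult.assoc mult_right_mono)
  then show "weighted u u \<le> \<phi>hi * pairing \<Omega> u u" by (simp add: weighted_def pairing_real)
  show "0 \<le> pairing \<Omega> u u" by (simp add: pairing_real)
qed

lemma weighted_diff_left:
  assumes "ess_bounded \<mu> u" "ess_bounded \<mu> v" "ess_bounded \<mu> w"
  shows "weighted (\<lambda>x. u x - v x) w = weighted u w - weighted v w"
  using pairing_diff_left[OF fin ess_bounded_mult[OF \<phi>_ess_bounded assms(1)] ess_bounded_mult[OF \<phi>_ess_bounded assms(2)] assms(3)]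
  by (simp add: weighted_def right_diff_distrib)

lemma solves_energy:
  assumes tri: "triangulation \<Omega> \<T>" and sol: "solves \<T> a m r r'"
  shows "integrable (lebesgue_on {0..T}) (\<lambda>t. weighted (r' t) (r t))"
    and "\<And>t. t \<in> {0..T} \<Longrightarrow>
      weighted (r t) (r t) = weighted (r 0) (r 0) + 2 * (\<integral>\<tau>. weighted (r' \<tau>) (r \<tau>) \<partial>lebesgue_on {0..t})"
    and "continuous_on {0..T} (\<lambda>t. weighted (r t) (r t))"
  using weighted_energy_identity[OF tri \<Omega> \<phi>_ess_bounded, of T r k r'] sol T
  unfolding solves_def weighted_def by blast+

lemma solves_at_energy:
  assumes at: "solves_at \<T> a m r r' t" and mem: "m t \<in> V \<T>" "r t \<in> Q \<T>"
  shows "weighted (r' t) (r t) + pairing \<Omega> (flux (a t) (m t)) (m t)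
    = pairing \<Omega> (f t) (r t) - weighted (time_deriv T \<Psi> t) (r t) - pairing \<Omega> (grad (\<Psi> t)) (m t)"
  using at mem unfolding solves_at_def
  by (smt (verit, best) pairing_commute)

text \<open>Meant for the gradient of the boundary data: with \<delta> a fraction of the coercivity
  constant, the first term is absorbed and the second contains only data.\<close>

lemma pairing_vector_Young:
  assumes g: "\<And>x. x \<in> \<Omega> \<Longrightarrow> norm (g x) \<le> K" "g \<in> borel_measurable \<mu>" and w: "ess_bounded \<mu> w" and "\<delta> > 0" "K \<ge> 0"
  shows "- pairing \<Omega> g w \<le> \<delta> * (\<integral>x. norm (w x) powr s \<partial>\<mu>)
    + \<delta> powr (- (1 / (s - 1))) * K powr (s / (s - 1)) * measure lebesgue \<Omega>"
proof -
  let ?C = "\<delta> powr (- (1 / (s - 1))) * K powr (s / (s - 1))"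
  have gb: "ess_bounded \<mu> g" using g by (auto simp: ess_bounded_def intro!: exI[of _ K] AE_I2)
  have P: "ess_bounded \<mu> (\<lambda>x. norm (w x) powr s)" using w s_gt_2 by (intro ess_bounded_norm_powr) auto
  have "(\<integral>x. - (g x \<bullet> w x) \<partial>\<mu>) \<le> (\<integral>x. \<delta> * norm (w x) powr s + ?C \<partial>\<mu>)"
  proof (rule integral_mono)
    show "integrable \<mu> (\<lambda>x. - (g x \<bullet> w x))"
      using ess_bounded_integrable[OF fin ess_bounded_inner[OF gb w]] by simp
    show "integrable \<mu> (\<lambda>x. \<delta> * norm (w x) powr s + ?C)"
      using fin P by (intro ess_bounded_integrable ess_bounded_add ess_bounded_mult ess_bounded_const)
    fix x assume "x \<in> space \<mu>"
    then have x: "x \<in> \<Omega>" by simp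
    have "- (g x \<bullet> w x) \<le> \<bar>g x \<bullet> w x\<bar>" by simp
    also have "\<dots> \<le> norm (g x) * norm (w x)" by (rule Cauchy_Schwarz_ineq2)
    also have "\<dots> \<le> norm (w x) * K" using g(1)[OF x] by (simp add: mult.commute mult_right_mono)
    also have "\<dots> \<le> \<delta> * norm (w x) powr s + ?C"
      using assms s_gt_2 by (intro powr_Young) auto
    finally show "- (g x \<bullet> w x) \<le> \<delta> * norm (w x) powr s + ?C" .
  qed
  also have "\<dots> = \<delta> * (\<integral>x. norm (w x) powr s \<partial>\<mu>) + ?C * measure lebesgue \<Omega>"
    using ess_bounded_integrable[OF fin P] ess_bounded_integrable[OF fin ess_bounded_const[of _ "?C"]] \<Omega>_sets
    by (simp add: measure_restrict_space)
  finally show ?thesis by (simp add: pairing_def)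
qed

text \<open>The projection does not increase the \<open>L^2\<close> norm, so one bound serves all
  triangulations. It is finite because \<open>\<rho>0\<close> is square integrable and
  \<open>\<Psi> 0\<close> is bounded on a set of finite measure.\<close>

lemma initial_bound:
  obtains A where "A \<ge> 0"
    "\<And>\<T> p. is_L2_projection \<Omega> (Q \<T>) (\<lambda>x. \<rho>0 x - \<Psi> 0 x) p \<Longrightarrow> weighted p p \<le> A"
proof -
  obtain K where K: "K \<ge> 0" "\<Psi> 0 \<in> borel_measurable \<mu>" "\<And>x. x \<in> \<Omega> \<Longrightarrow> \<bar>\<Psi> 0 x\<bar> \<le> K"
    by (rule C12_bounds[OF \<Psi> \<Omega> T]) (use T in auto)
  have [measurable]: "\<rho>0 \<in> borel_measurable \<mu>" using \<rho>0 by (simp add: in_Lp_def)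
  obtain B where B: "B \<ge> 0" "Lp_norm 2 \<mu> \<rho>0 \<le> ennreal B"
    using \<rho>0 unfolding in_Lp_def by (cases "Lp_norm 2 \<mu> \<rho>0") auto
  have "(\<integral>\<^sup>+x. ennreal ((\<rho>0 x - \<Psi> 0 x)\<^sup>2) \<partial>\<mu>) \<le> (\<integral>\<^sup>+x. 2 * ennreal ((norm (\<rho>0 x))\<^sup>2) + ennreal (2 * K\<^sup>2) \<partial>\<mu>)"
  proof (rule nn_integral_mono)
    fix x assume "x \<in> space \<mu>"
    then have "(\<Psi> 0 x)\<^sup>2 \<le> K\<^sup>2" using K(3)[of x] by (simp add: abs_le_square_iff[symmetric])
    moreover have "(\<rho>0 x - \<Psi> 0 x)\<^sup>2 \<le> 2 * (\<rho>0 x)\<^sup>2 + 2 * (\<Psi> 0 x)\<^sup>2"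
      using zero_le_power2[of "\<rho>0 x + \<Psi> 0 x"] by (simp add: power2_eq_square algebra_simps)
    ultimately have "ennreal ((\<rho>0 x - \<Psi> 0 x)\<^sup>2) \<le> ennreal (2 * (\<rho>0 x)\<^sup>2 + 2 * K\<^sup>2)" by (intro ennreal_leI) linarith
    also have "\<dots> = 2 * ennreal ((norm (\<rho>0 x))\<^sup>2) + ennreal (2 * K\<^sup>2)"
      by (simp add: ennreal_plus ennreal_mult)
    finally show "ennreal ((\<rho>0 x - \<Psi> 0 x)\<^sup>2) \<le> 2 * ennreal ((norm (\<rho>0 x))\<^sup>2) + ennreal (2 * K\<^sup>2)" .
  qed
  also have "\<dots> = 2 * (\<integral>\<^sup>+x. ennreal ((norm (\<rho>0 x))\<^sup>2) \<partial>\<mu>) + ennreal (2 * K\<^sup>2) * emeasure \<mu> (space \<mu>)"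
    by (simp add: nn_integral_add nn_integral_cmult)
  also have "\<dots> \<le> 2 * ennreal (B\<^sup>2) + ennreal (2 * K\<^sup>2) * emeasure \<mu> (space \<mu>)"
    using nn_integral_norm_sq_le[OF B(2,1)] by (intro add_mono mult_left_mono) auto
  also have "\<dots> < \<infinity>"
    using finite_measure.emeasure_finite[OF fin, of "space \<mu>"]
    by (auto simp: ennreal_mult_less_top less_top)
  finally obtain A where A: "A \<ge> 0" "(\<integral>\<^sup>+x. ennreal ((\<rho>0 x - \<Psi> 0 x)\<^sup>2) \<partial>\<mu>) = ennreal A"
    by (cases "\<integral>\<^sup>+x. ennreal ((\<rho>0 x - \<Psi> 0 x)\<^sup>2) \<partial>\<mu>") auto
  \<comment> \<open>The modulus appears because an empty \<Omega> leaves the sign of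
    \<open>\<phi>hi\<close> open.\<close>
  show thesis
  proof (rule that[of "\<bar>\<phi>hi\<bar> * A"])
    fix \<T> p assume p: "is_L2_projection \<Omega> (Q \<T>) (\<lambda>x. \<rho>0 x - \<Psi> 0 x) p"
    then have pb: "ess_bounded \<mu> p" by (intro Q_ess_bounded) (auto simp: is_L2_projection_def)
    have "pairing \<Omega> p p \<le> A" by (rule L2_projection_bound[OF p pb fin]) (use A in auto)
    have "weighted p p \<le> \<phi>hi * pairing \<Omega> p p" by (rule weighted_bounds(2)[OF pb])
    also have "\<dots> \<le> \<bar>\<phi>hi\<bar> * A" using weighted_bounds(3)[OF pb] \<open>pairing \<Omega> p p \<le> A\<close> by (intro mult_mono) auto
    finally show "weighted p p \<le> \<bar>\<phi>hi\<bar> * A" .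
  qed (use A in simp)
qed

end

section \<open>A priori bound and stability in the coefficients\<close>

context forchheimer_problem
begin

text \<open>The a priori bound is stated pointwise in time, with the dissipation controlled by the time
  derivative of the energy, so that it can be integrated without knowing that
  \<open>t \<mapsto> \<integral>\<bar>m t\<bar>\<^sup>s\<close> is measurable.\<close>

lemma a_priori_bound:
  obtains K1 K2 where "K1 \<ge> 0" "K2 \<ge> 0"
    "\<And>\<T> a m r r'. triangulation \<Omega> \<T> \<Longrightarrow> a \<in> coeff_functions T \<Omega> N D b \<Longrightarrow> solves \<T> a m r r' \<Longrightarrow>
      weighted (r 0) (r 0) \<le> K1 \<and>
      (AE t in lebesgue_on {0..T}. (\<integral>x. norm (m t x) powr s \<partial>\<mu>) \<le> K1 - K2 * weighted (r' t) (r t))"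
proof -
  obtain A where A: "A \<ge> 0"
    "\<And>\<T> p. is_L2_projection \<Omega> (Q \<T>) (\<lambda>x. \<rho>0 x - \<Psi> 0 x) p \<Longrightarrow> weighted p p \<le> A"
    by (rule initial_bound) blast
  obtain K where K: "K \<ge> 0"
    "\<And>t. t \<in> {0..T} \<Longrightarrow> grad (\<Psi> t) \<in> borel_measurable \<mu>"
    "\<And>t. t \<in> {0..T} \<Longrightarrow> time_deriv T \<Psi> t \<in> borel_measurable \<mu>"
    "\<And>t x. t \<in> {0..T} \<Longrightarrow> x \<in> \<Omega> \<Longrightarrow> norm (grad (\<Psi> t) x) \<le> K"
    "\<And>t x. t \<in> {0..T} \<Longrightarrow> x \<in> \<Omega> \<Longrightarrow> \<bar>time_deriv T \<Psi> t x\<bar> \<le> K"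
    by (rule C12_bounds[OF \<Psi> \<Omega> T]) blast
  have "esssup (lebesgue_on {0..T}) (\<lambda>t. Lp_norm 2 \<mu> (f t)) < \<infinity>"
    using f by (simp add: in_bochner_def bochner_norm_def Lnorm_def)
  then obtain B where B: "B \<ge> 0" "AE t in lebesgue_on {0..T}. Lp_norm 2 \<mu> (f t) \<le> ennreal B"
    by (rule esssup_finiteE)
  define vol where "vol = measure lebesgue \<Omega>"
  \<comment> \<open>The terms with \<open>f\<close> and with the time derivative of \<Psi> each cost
    \<open>\<epsilon> / 2\<close> times the squared norm of the density; together they cost at most
    the weighted energy divided by \<open>4 * T\<close>.\<close>
  define \<epsilon> where "\<epsilon> = \<phi>lo / (4 * T)"
  \<comment> \<open>The remainders in Young's inequality for \<open>f\<close>, for the time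
    derivative of \<Psi> and for its gradient, in this order.\<close>
  define K0 where "K0 = B\<^sup>2 / (2 * \<epsilon>) + (\<phi>hi * K)\<^sup>2 * vol / (2 * \<epsilon>)
    + (mono_const / 2) powr (- (1 / (s - 1))) * K powr (s / (s - 1)) * vol"
  \<comment> \<open>For the largest energy \<open>E\<close>, integration in time gives
    \<open>E \<le> A + 2 * (T * K0 + E / 4)\<close>, hence \<open>E \<le> S\<close>.\<close>
  define S where "S = 2 * A + 4 * T * K0"
  have \<epsilon>: "\<epsilon> > 0" using \<phi>lo T by (simp add: \<epsilon>_def)
  have vol: "vol \<ge> 0" by (simp add: vol_def)
  have K0: "K0 \<ge> 0" unfolding K0_def using vol \<epsilon> by simp
  have S: "S \<ge> 0" unfolding S_def using A K0 T by simp
  note c = mono_const_pos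
  have step: "weighted (r' t) (r t) + mono_const / 2 * (\<integral>x. norm (m t x) powr s \<partial>\<mu>)
      \<le> K0 + weighted (r t) (r t) / (4 * T)"
    if t: "t \<in> {0..T}" and at: "solves_at \<T> a m r r' t" and mem: "m t \<in> V \<T>" "r t \<in> Q \<T>"
      and ft: "Lp_norm 2 \<mu> (f t) \<le> ennreal B"
      and a: "AE x in \<mu>. a t x \<in> coeff_box N alo ahi" "\<forall>i\<in>{-1..int N}. (\<lambda>x. a t x i) \<in> borel_measurable \<mu>"
    for \<T> a m r r' t
  proof -
    have mb: "ess_bounded \<mu> (m t)" and rb: "ess_bounded \<mu> (r t)"
      using V_ess_bounded[OF mem(1)] Q_ess_bounded[OF mem(2)] .
    have rm: "r t \<in> borel_measurable \<mu>" by (rule ess_bounded_measurable[OF rb])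
    have ri: "integrable \<mu> (\<lambda>x. (r t x)\<^sup>2)"
      unfolding power2_eq_square using fin rb by (intro ess_bounded_integrable ess_bounded_mult)
    have n: "pairing \<Omega> (r t) (r t) = (\<integral>x. (r t x)\<^sup>2 \<partial>\<mu>)" by (simp add: pairing_real power2_eq_square)
    have 1: "mono_const * (\<integral>x. norm (m t x) powr s \<partial>\<mu>) \<le> pairing \<Omega> (flux (a t) (m t)) (m t)"
      unfolding flux_def[abs_def] by (rule flux_coercive[OF fin a(1) _ mb]) (use a(2) in auto)
    have 2: "pairing \<Omega> (f t) (r t) \<le> B\<^sup>2 / (2 * \<epsilon>) + \<epsilon> / 2 * pairing \<Omega> (r t) (r t)"
      unfolding n pairing_real[of _ "f t"]
      by (rule integral_mult_le_Young[OF _ _ rm ri \<epsilon>]) (use nn_integral_norm_sq_le[OF ft B(1)] in auto)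
    have 3: "- weighted (time_deriv T \<Psi> t) (r t) \<le> (\<phi>hi * K)\<^sup>2 * vol / (2 * \<epsilon>) + \<epsilon> / 2 * pairing \<Omega> (r t) (r t)"
    proof -
      have "(\<integral>x. (- (\<phi> x * time_deriv T \<Psi> t x)) * r t x \<partial>\<mu>)
          \<le> (\<phi>hi * K)\<^sup>2 * vol / (2 * \<epsilon>) + \<epsilon> / 2 * pairing \<Omega> (r t) (r t)"
        unfolding n
      proof (rule integral_mult_le_Young[OF _ _ rm ri \<epsilon>])
        have "(\<integral>\<^sup>+x. ennreal ((- (\<phi> x * time_deriv T \<Psi> t x))\<^sup>2) \<partial>\<mu>) \<le> (\<integral>\<^sup>+x. ennreal ((\<phi>hi * K)\<^sup>2) \<partial>\<mu>)"
        proof (intro nn_integral_mono ennreal_leI)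
          fix x assume "x \<in> space \<mu>"
          then have x: "x \<in> \<Omega>" by simp
          have "\<bar>\<phi> x * time_deriv T \<Psi> t x\<bar> \<le> \<phi>hi * K"
            unfolding abs_mult using \<phi>_bounds[OF x] \<phi>lo K(5)[OF t x] by (intro mult_mono) auto
          then show "(- (\<phi> x * time_deriv T \<Psi> t x))\<^sup>2 \<le> (\<phi>hi * K)\<^sup>2"
            using abs_le_square_iff by fastforce
        qed
        also have "\<dots> = ennreal ((\<phi>hi * K)\<^sup>2 * vol)"
          using finite_measure.emeasure_eq_measure[OF fin, of \<Omega>] \<Omega>_sets
          by (simp add: vol_def measure_restrict_space ennreal_mult)
        finally show "(\<integral>\<^sup>+x. ennreal ((- (\<phi> x * time_deriv T \<Psi> t x))\<^sup>2) \<partial>\<mu>) \<le> ennreal ((\<phi>hi * K)\<^sup>2 * vol)" .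
      qed (use vol in simp)
      then show ?thesis by (simp add: weighted_def pairing_real)
    qed
    have 4: "- pairing \<Omega> (grad (\<Psi> t)) (m t) \<le> mono_const / 2 * (\<integral>x. norm (m t x) powr s \<partial>\<mu>)
      + (mono_const / 2) powr (- (1 / (s - 1))) * K powr (s / (s - 1)) * vol"
      unfolding vol_def by (rule pairing_vector_Young[OF K(4)[OF t] K(2)[OF t] mb]) (use c K(1) in auto)
    have "pairing \<Omega> (r t) (r t) \<le> weighted (r t) (r t) / \<phi>lo"
      using weighted_bounds(1)[OF rb] \<phi>lo by (simp add: field_simps)
    then have "\<epsilon> * pairing \<Omega> (r t) (r t) \<le> \<epsilon> * (weighted (r t) (r t) / \<phi>lo)"
      using \<epsilon> by (intro mult_left_mono) auto
    also have "\<dots> = weighted (r t) (r t) / (4 * T)" using \<phi>lo T by (simp add: \<epsilon>_def)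
    finally show ?thesis
      using solves_at_energy[OF at mem] 1 2 3 4 unfolding K0_def by linarith
  qed
  \<comment> \<open>The maximum merges the bound for the initial energy and the one for the
    dissipation into a single constant \<open>K1\<close>; \<open>K2\<close> is
    \<open>2 / mono_const\<close>.\<close>
  have main: "weighted (r 0) (r 0) \<le> max A (2 / mono_const * (K0 + S / (4 * T))) \<and>
      (AE t in lebesgue_on {0..T}. (\<integral>x. norm (m t x) powr s \<partial>\<mu>)
        \<le> max A (2 / mono_const * (K0 + S / (4 * T))) - 2 / mono_const * weighted (r' t) (r t))"
    if tri: "triangulation \<Omega> \<T>" and a: "a \<in> coeff_functions T \<Omega> N D b" and sol: "solves \<T> a m r r'"
    for \<T> a m r r'
  proof -
    let ?E = "\<lambda>t. weighted (r t) (r t)" and ?e = "\<lambda>t. weighted (r' t) (r t)"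
    note en = solves_energy[OF tri sol]
    have mem: "m t \<in> V \<T>" "r t \<in> Q \<T>" if "t \<in> {0..T}" for t using sol that by (auto simp: solves_def)
    have E0: "?E 0 \<le> A" using sol by (intro A(2)) (auto simp: solves_def)
    have inI: "AE t in lebesgue_on {0..T}. t \<in> {0..T}" by (intro AE_I2) simp
    have "AE t in lebesgue_on {0..T}. solves_at \<T> a m r r' t" using sol by (simp add: solves_def)
    with B(2) coeff_functions_slices[OF a D alo \<Omega>(2)] inI
    have ae: "AE t in lebesgue_on {0..T}. ?e t + mono_const / 2 * (\<integral>x. norm (m t x) powr s \<partial>\<mu>) \<le> K0 + ?E t / (4 * T)"
      by eventually_elim (rule step, auto intro: mem)
    \<comment> \<open>This maximum replaces Gronwall's inequality: integrated up to
      \<open>t0\<close>, the energy on the right is bounded by the one on the left and carries a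
      small enough factor.\<close>
    obtain t0 where t0: "t0 \<in> {0..T}" "\<And>t. t \<in> {0..T} \<Longrightarrow> ?E t \<le> ?E t0"
      using continuous_attains_sup[OF compact_Icc _ en(3)] T by force
    have E0n: "0 \<le> ?E t0"
      using weighted_bounds(1,3)[OF Q_ess_bounded[OF mem(2)[OF t0(1)]]] \<phi>lo
      by (meson mult_nonneg_nonneg less_imp_le order_trans)
    have "(\<integral>\<tau>. ?e \<tau> \<partial>lebesgue_on {0..t0}) \<le> (\<integral>\<tau>. K0 + ?E t0 / (4 * T) \<partial>lebesgue_on {0..t0})"
    proof (rule integral_lebesgue_on_initial_le[OF en(1) _ _ t0(1)])
      show "AE t in lebesgue_on {0..T}. ?e t \<le> K0 + ?E t0 / (4 * T)"
        using ae inI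
      proof eventually_elim
        case (elim t)
        have "?E t / (4 * T) \<le> ?E t0 / (4 * T)" using t0(2)[OF elim(2)] T by (simp add: divide_right_mono)
        moreover have "0 \<le> mono_const / 2 * (\<integral>x. norm (m t x) powr s \<partial>\<mu>)"
          using c by (intro mult_nonneg_nonneg Bochner_Integration.integral_nonneg) auto
        ultimately show ?case using elim(1) by linarith
      qed
    qed simp
    also have "\<dots> = t0 * (K0 + ?E t0 / (4 * T))" using t0(1) by (intro integral_lebesgue_on_const) simp
    also have "\<dots> \<le> T * (K0 + ?E t0 / (4 * T))"
      using t0(1) K0 E0n T by (intro mult_right_mono) auto
    also have "\<dots> = T * K0 + ?E t0 / 4" using T by (simp add: distrib_left)
    finally have "?E t0 \<le> S" using en(2)[OF t0(1)] E0 unfolding S_def by linarith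
    then have ES: "?E t \<le> S" if "t \<in> {0..T}" for t using t0(2)[OF that] by linarith
    have "AE t in lebesgue_on {0..T}. (\<integral>x. norm (m t x) powr s \<partial>\<mu>)
        \<le> max A (2 / mono_const * (K0 + S / (4 * T))) - 2 / mono_const * ?e t"
      using ae inI
    proof eventually_elim
      case (elim t)
      have "?E t / (4 * T) \<le> S / (4 * T)" using ES[OF elim(2)] T by (simp add: divide_right_mono)
      then have "mono_const / 2 * (\<integral>x. norm (m t x) powr s \<partial>\<mu>) \<le> K0 + S / (4 * T) - ?e t"
        using elim(1) by linarith
      then have "2 / mono_const * (mono_const / 2 * (\<integral>x. norm (m t x) powr s \<partial>\<mu>))
          \<le> 2 / mono_const * (K0 + S / (4 * T) - ?e t)"
        using c by (intro mult_left_mono) auto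
      then show ?case using c by (simp add: right_diff_distrib)
    qed
    with E0 show ?thesis by auto
  qed
  show thesis
    by (rule that[OF _ _ main]) (use A c in auto)
qed

text \<open>One differential inequality yields both norms: without the flux term it bounds the
  density at every time, and integrated up to \<open>T\<close> it bounds the flux. The a priori
  bound for the second solution enters through \<open>?R\<close>, an integrable function whose
  integral reduces to energies at the endpoints.\<close>

lemma stability:
  obtains C where "C > 0"
    "\<And>\<T> a1 a2 m1 m2 r1 r2 r1' r2'. triangulation \<Omega> \<T> \<Longrightarrow>
      a1 \<in> coeff_functions T \<Omega> N D b \<Longrightarrow> a2 \<in> coeff_functions T \<Omega> N D b \<Longrightarrow>
      solves \<T> a1 m1 r1 r1' \<Longrightarrow> solves \<T> a2 m2 r2 r2' \<Longrightarrow>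
      (bochner_norm \<infinity> T 2 \<Omega> (\<lambda>t x. r1 t x - r2 t x))\<^sup>2
        + ennreal_powr (bochner_norm (ennreal s) T (ennreal s) \<Omega> (\<lambda>t x. m1 t x - m2 t x)) s
      \<le> ennreal C * ennreal_powr (coeff_dist T \<Omega> N a1 a2) (s / (s - 1))"
proof -
  obtain K1 K2 where K: "K1 \<ge> 0" "K2 \<ge> 0"
    and ap: "\<And>\<T> a m r r'. triangulation \<Omega> \<T> \<Longrightarrow> a \<in> coeff_functions T \<Omega> N D b \<Longrightarrow> solves \<T> a m r r' \<Longrightarrow>
      weighted (r 0) (r 0) \<le> K1 \<and>
      (AE t in lebesgue_on {0..T}. (\<integral>x. norm (m t x) powr s \<partial>\<mu>) \<le> K1 - K2 * weighted (r' t) (r t))"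
    by (rule a_priori_bound) blast
  define vol where "vol = measure lebesgue \<Omega>"
  \<comment> \<open>Times \<open>\<delta>\<close>, this bounds the integral of \<open>?R\<close>: by
    the energy identity, minus the integral of \<open>?e2\<close> is half the loss of energy of the
    second solution, hence at most \<open>K1 / 2\<close>.\<close>
  define C0 where "C0 = pert_const * ((vol + K1) * T + K2 * K1 / 2)"
  \<comment> \<open>The first summand is for the density, the second for the flux; the
    \<open>1\<close> makes \<open>C\<close> positive even if \<open>C0\<close> is
    \<open>0\<close>.\<close>
  define C where "C = 2 * C0 / \<phi>lo + 2 / mono_const * C0 + 1"
  have vol: "vol \<ge> 0" by (simp add: vol_def)
  note c = mono_const_pos
  have C0: "C0 \<ge> 0" unfolding C0_def using vol K T pert_const_pos by simp
  have C: "C > 0" unfolding C_def using C0 c \<phi>lo by (simp add: add_nonneg_pos)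
  have "(bochner_norm \<infinity> T 2 \<Omega> (\<lambda>t x. r1 t x - r2 t x))\<^sup>2
        + ennreal_powr (bochner_norm (ennreal s) T (ennreal s) \<Omega> (\<lambda>t x. m1 t x - m2 t x)) s
      \<le> ennreal C * ennreal_powr (coeff_dist T \<Omega> N a1 a2) (s / (s - 1))"
    if tri: "triangulation \<Omega> \<T>" and a1: "a1 \<in> coeff_functions T \<Omega> N D b" and a2: "a2 \<in> coeff_functions T \<Omega> N D b"
      and sol1: "solves \<T> a1 m1 r1 r1'" and sol2: "solves \<T> a2 m2 r2 r2'"
    for \<T> a1 a2 m1 m2 r1 r2 r1' r2'
  proof (cases "coeff_dist T \<Omega> N a1 a2 < \<infinity>")
    \<comment> \<open>At infinite distance the right-hand side is \<infinity>, because
      \<open>C\<close> is positive.\<close>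
    case False
    then show ?thesis using C by (simp add: ennreal_powr_def less_top ennreal_mult_top)
  next
    case True
    then obtain \<Delta> where \<Delta>: "\<Delta> \<ge> 0" "coeff_dist T \<Omega> N a1 a2 = ennreal \<Delta>"
      and d: "AE t in lebesgue_on {0..T}. AE x in \<mu>. \<forall>i\<in>{-1..int N}. \<bar>a1 t x i - a2 t x i\<bar> \<le> \<Delta>"
      by (rule coeff_dist_finiteE)
    define \<delta> where "\<delta> = \<Delta> powr (s / (s - 1))"
    have \<delta>: "\<delta> \<ge> 0" by (simp add: \<delta>_def)
    define r where "r t x = r1 t x - r2 t x" for t x
    define r' where "r' t x = r1' t x - r2' t x" for t x
    define m where "m t x = m1 t x - m2 t x" for t x
    define X where "X t = (\<integral>x. norm (m t x) powr s \<partial>\<mu>)" for t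
    let ?E = "\<lambda>t. weighted (r t) (r t)" and ?e = "\<lambda>t. weighted (r' t) (r t)"
    let ?e2 = "\<lambda>t. weighted (r2' t) (r2 t)"
    let ?R = "\<lambda>t. pert_const * \<delta> * (vol + K1 - K2 * ?e2 t)"
    have mem: "m1 t \<in> V \<T>" "m2 t \<in> V \<T>" "r1 t \<in> Q \<T>" "r2 t \<in> Q \<T>" "r1' t \<in> Q \<T>" "r2' t \<in> Q \<T>"
      if "t \<in> {0..T}" for t using sol1 sol2 that by (auto simp: solves_def)
    have memd: "m t \<in> V \<T>" "r t \<in> Q \<T>" "r' t \<in> Q \<T>" if "t \<in> {0..T}" for t
      unfolding m_def r_def r'_def using mem[OF that] by (auto intro: V_space_diff Q_space_diff)
    have int': "integrable (lebesgue_on {0..T}) (\<lambda>t. r1' t x)" "integrable (lebesgue_on {0..T}) (\<lambda>t. r2' t x)"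
      if "x \<in> closure \<Omega>" for x using sol1 sol2 that by (auto simp: solves_def)
    have int: "integrable (lebesgue_on {0..T}) (\<lambda>t. r' t x)" if "x \<in> closure \<Omega>" for x
      unfolding r'_def using int'[OF that] by simp
    have ftc: "r t x = r 0 x + (\<integral>\<tau>. r' \<tau> x \<partial>lebesgue_on {0..t})" if x: "x \<in> closure \<Omega>" and t: "t \<in> {0..T}" for x t
    proof -
      have "integrable (lebesgue_on {0..t}) (\<lambda>t. r1' t x)" "integrable (lebesgue_on {0..t}) (\<lambda>t. r2' t x)"
        using integrable_subinterval[OF int'(1)[OF x]] integrable_subinterval[OF int'(2)[OF x]] t by auto
      moreover have "r1 t x = r1 0 x + (\<integral>\<tau>. r1' \<tau> x \<partial>lebesgue_on {0..t})"
        "r2 t x = r2 0 x + (\<integral>\<tau>. r2' \<tau> x \<partial>lebesgue_on {0..t})"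
        using sol1 sol2 x t unfolding solves_def by blast+
      ultimately show ?thesis by (simp add: r_def r'_def)
    qed
    have en: "integrable (lebesgue_on {0..T}) ?e"
      "\<And>t. t \<in> {0..T} \<Longrightarrow> ?E t = ?E 0 + 2 * (\<integral>\<tau>. ?e \<tau> \<partial>lebesgue_on {0..t})"
      using weighted_energy_identity(1,2)[OF tri \<Omega> \<phi>_ess_bounded, of T r k r'] memd(2,3) int ftc T
      unfolding weighted_def by blast+
    \<comment> \<open>The energy identity with weight \<open>1\<close> makes the norm of
      \<open>r t\<close> continuous in time and so measurable; otherwise \<open>esssup\<close> would
      have the default value \<infinity>.\<close>
    have cont: "continuous_on {0..T} (\<lambda>t. pairing \<Omega> (\<lambda>x. 1 * r t x) (r t))"
      using weighted_energy_identity(3)[OF tri \<Omega> ess_bounded_const[of _ "1::real"], of T r k r'] memd(2,3) int ftc T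
      by blast
    note en2 = solves_energy[OF tri sol2]
    have E_nonneg: "0 \<le> weighted u u" if "u \<in> Q \<T>" for u
      using weighted_bounds(1,3)[OF Q_ess_bounded[OF that]] \<phi>lo
      by (meson mult_nonneg_nonneg less_imp_le order_trans)
    have E0: "?E 0 = 0"
    proof -
      have "AE x in \<mu>. r 0 x = 0"
        unfolding r_def by (rule L2_projection_unique[OF _ _ \<Omega>]) (use sol1 sol2 in \<open>auto simp: solves_def\<close>)
      then have "AE x in \<mu>. (\<phi> x * r 0 x) \<bullet> r 0 x = 0" by (rule eventually_mono) simp
      then show ?thesis unfolding weighted_def pairing_def by (rule integral_eq_zero_AE)
    qed
    have X0: "0 \<le> X t" for t unfolding X_def by (rule Bochner_Integration.integral_nonneg) simp
    have inI: "AE t in lebesgue_on {0..T}. t \<in> {0..T}" by (intro AE_I2) simp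
    have "AE t in lebesgue_on {0..T}. solves_at \<T> a1 m1 r1 r1' t" "AE t in lebesgue_on {0..T}. solves_at \<T> a2 m2 r2 r2' t"
      using sol1 sol2 by (auto simp: solves_def)
    with d coeff_functions_slices[OF a1 D alo \<Omega>(2)] coeff_functions_slices[OF a2 D alo \<Omega>(2)]
      conjunct2[OF ap[OF tri a2 sol2]] inI
    have ae: "AE t in lebesgue_on {0..T}. ?e t + mono_const / 2 * X t \<le> ?R t"
    proof eventually_elim
      case (elim t)
      note t = elim(5) and at1 = elim(6) and at2 = elim(7)
      note vb = mem(1,2)[OF t, THEN V_ess_bounded] and qb = mem(3-6)[OF t, THEN Q_ess_bounded]
      note mb = V_ess_bounded[OF memd(1)[OF t]] and rb = Q_ess_bounded[OF memd(2)[OF t]]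
      note db = V_space_ess_bounded_divg[OF tri \<Omega>(2)]
      have mm: "m t = (\<lambda>x. m1 t x - m2 t x)" and rr: "r t = (\<lambda>x. r1 t x - r2 t x)" and rr': "r' t = (\<lambda>x. r1' t x - r2' t x)"
        by (auto simp: m_def r_def r'_def)
      have "pairing \<Omega> (flux (a1 t) (m1 t)) (m t) - pairing \<Omega> (r1 t) (divg (m t))
          = pairing \<Omega> (flux (a2 t) (m2 t)) (m t) - pairing \<Omega> (r2 t) (divg (m t))"
        using at1 at2 memd(1)[OF t] by (simp add: solves_at_def)
      moreover have "pairing \<Omega> (r t) (divg (m t)) = pairing \<Omega> (r1 t) (divg (m t)) - pairing \<Omega> (r2 t) (divg (m t))"
        unfolding rr by (rule pairing_diff_left[OF fin qb(1,2) db[OF memd(1)[OF t]]])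
      moreover have "weighted (r1' t) (r t) + pairing \<Omega> (divg (m1 t)) (r t) = weighted (r2' t) (r t) + pairing \<Omega> (divg (m2 t)) (r t)"
        using at1 at2 memd(2)[OF t] by (simp add: solves_at_def)
      moreover have "?e t = weighted (r1' t) (r t) - weighted (r2' t) (r t)"
        unfolding rr' by (rule weighted_diff_left[OF qb(3,4) rb])
      \<comment> \<open>The equations contain the divergences of \<open>m1 t\<close> and
        \<open>m2 t\<close> separately; the difference of these is that of \<open>m t\<close> off
        the boundaries of elements.\<close>
      moreover have "pairing \<Omega> (divg (m t)) (r t) = pairing \<Omega> (\<lambda>x. divg (m1 t) x - divg (m2 t) x) (r t)"
        unfolding mm
        by (rule pairing_cong_AE[OF V_space_divg_diff[OF tri \<Omega>(2) mem(1,2)[OF t]]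
              db[OF memd(1)[OF t, unfolded mm]] ess_bounded_diff[OF db[OF mem(1)[OF t]] db[OF mem(2)[OF t]]] rb])
      moreover have "\<dots> = pairing \<Omega> (divg (m1 t)) (r t) - pairing \<Omega> (divg (m2 t)) (r t)"
        by (rule pairing_diff_left[OF fin db[OF mem(1)[OF t]] db[OF mem(2)[OF t]] rb])
      moreover have "pairing \<Omega> (divg (m t)) (r t) = pairing \<Omega> (r t) (divg (m t))" by (rule pairing_commute)
      ultimately have "?e t + (pairing \<Omega> (flux (a1 t) (m1 t)) (m t) - pairing \<Omega> (flux (a2 t) (m2 t)) (m t)) = 0"
        by linarith
      moreover have "mono_const / 2 * X t \<le> pairing \<Omega> (flux (a1 t) (m1 t)) (m t) - pairing \<Omega> (flux (a2 t) (m2 t)) (m t)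
          + pert_const * \<delta> * (vol + (\<integral>x. norm (m2 t x) powr s \<partial>\<mu>))"
        unfolding X_def \<delta>_def vol_def flux_def[abs_def] mm
        by (rule flux_difference[OF fin \<Omega>_sets _ _ _ _ elim(1) vb]) (use elim(2,3) in auto)
      moreover have "pert_const * \<delta> * (vol + (\<integral>x. norm (m2 t x) powr s \<partial>\<mu>)) \<le> ?R t"
        using elim(4) pert_const_pos \<delta> by (intro mult_left_mono) auto
      ultimately show ?case by linarith
    qed
    have Ri: "integrable (lebesgue_on {0..T}) ?R" using en2(1) by simp
    have R: "(\<integral>\<tau>. ?R \<tau> \<partial>lebesgue_on {0..t}) \<le> C0 * \<delta>" if t: "t \<in> {0..T}" for t
    proof -
      have i: "integrable (lebesgue_on {0..t}) ?e2" using integrable_subinterval[OF en2(1)] t by auto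
      then have "(\<integral>\<tau>. ?R \<tau> \<partial>lebesgue_on {0..t})
          = pert_const * \<delta> * (t * (vol + K1) - K2 * (\<integral>\<tau>. ?e2 \<tau> \<partial>lebesgue_on {0..t}))"
        using t integral_lebesgue_on_const[of t "vol + K1"] by simp
      also have "\<dots> \<le> pert_const * \<delta> * ((vol + K1) * T + K2 * K1 / 2)"
      proof (intro mult_left_mono)
        have "- (\<integral>\<tau>. ?e2 \<tau> \<partial>lebesgue_on {0..t}) \<le> K1 / 2"
          using en2(2)[OF t] E_nonneg[OF mem(4)[OF t]] conjunct1[OF ap[OF tri a2 sol2]] by linarith
        then have "K2 * - (\<integral>\<tau>. ?e2 \<tau> \<partial>lebesgue_on {0..t}) \<le> K2 * (K1 / 2)" using K(2) by (rule mult_left_mono)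
        moreover have "t * (vol + K1) \<le> T * (vol + K1)" using t vol K(1) by (intro mult_right_mono) auto
        ultimately show "t * (vol + K1) - K2 * (\<integral>\<tau>. ?e2 \<tau> \<partial>lebesgue_on {0..t}) \<le> (vol + K1) * T + K2 * K1 / 2"
          by (simp add: mult.commute)
      qed (use pert_const_pos \<delta> in simp)
      also have "\<dots> = C0 * \<delta>" by (simp add: C0_def)
      finally show ?thesis .
    qed
    have rbound: "pairing \<Omega> (r t) (r t) \<le> 2 * C0 / \<phi>lo * \<delta>" if t: "t \<in> {0..T}" for t
    proof -
      have "(\<integral>\<tau>. ?e \<tau> \<partial>lebesgue_on {0..t}) \<le> (\<integral>\<tau>. ?R \<tau> \<partial>lebesgue_on {0..t})"
      proof (rule integral_lebesgue_on_initial_le[OF en(1) Ri _ t])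
        show "AE t in lebesgue_on {0..T}. ?e t \<le> ?R t"
          using ae
        proof (rule eventually_mono)
          fix t assume "?e t + mono_const / 2 * X t \<le> ?R t"
          moreover have "0 \<le> mono_const / 2 * X t" using c X0 by simp
          ultimately show "?e t \<le> ?R t" by linarith
        qed
      qed
      then have "?E t \<le> 2 * C0 * \<delta>" using en(2)[OF t] E0 R[OF t] by linarith
      then have "\<phi>lo * pairing \<Omega> (r t) (r t) \<le> 2 * C0 * \<delta>"
        using weighted_bounds(1)[OF Q_ess_bounded[OF memd(2)[OF t]]] by linarith
      then show ?thesis using \<phi>lo by (simp add: field_simps)
    qed
    have Lp: "Lp_norm 2 \<mu> (r t) = ennreal (sqrt (pairing \<Omega> (r t) (r t)))" if t: "t \<in> {0..T}" for t
    proof -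
      have "integrable \<mu> (\<lambda>x. (norm (r t x))\<^sup>2)"
        using ess_bounded_integrable[OF fin ess_bounded_mult[OF Q_ess_bounded Q_ess_bounded], OF memd(2)[OF t] memd(2)[OF t]]
        by (simp add: power2_eq_square)
      from Lp_norm_2_eq[OF this] show ?thesis by (simp add: pairing_real power2_eq_square)
    qed
    have "bochner_norm \<infinity> T 2 \<Omega> r \<le> ennreal (sqrt (2 * C0 / \<phi>lo * \<delta>))"
      unfolding bochner_norm_def Lnorm_def if_P[OF refl]
    proof (rule esssup_I)
      have "(\<lambda>t. pairing \<Omega> (r t) (r t)) \<in> borel_measurable (lebesgue_on {0..T})"
        by (rule continuous_imp_measurable_on_sets_lebesgue) (use cont in auto)
      then have "(\<lambda>t. ennreal (sqrt (pairing \<Omega> (r t) (r t)))) \<in> borel_measurable (lebesgue_on {0..T})"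
        by measurable
      then show "(\<lambda>t. Lp_norm 2 \<mu> (r t)) \<in> borel_measurable (lebesgue_on {0..T})"
        by (subst measurable_cong[OF Lp]) auto
      show "AE t in lebesgue_on {0..T}. Lp_norm 2 \<mu> (r t) \<le> ennreal (sqrt (2 * C0 / \<phi>lo * \<delta>))"
        using inI
      proof (rule eventually_mono)
        fix t assume t: "t \<in> {0..T}"
        show "Lp_norm 2 \<mu> (r t) \<le> ennreal (sqrt (2 * C0 / \<phi>lo * \<delta>))"
          unfolding Lp[OF t] by (intro ennreal_leI real_sqrt_le_mono rbound t)
      qed
    qed
    then have "(bochner_norm \<infinity> T 2 \<Omega> r)\<^sup>2 \<le> (ennreal (sqrt (2 * C0 / \<phi>lo * \<delta>)))\<^sup>2"
      by (intro power_mono) auto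
    also have "\<dots> = ennreal (2 * C0 / \<phi>lo * \<delta>)"
      using C0 \<phi>lo \<delta> by (simp add: ennreal_power)
    finally have 1: "(bochner_norm \<infinity> T 2 \<Omega> r)\<^sup>2 \<le> ennreal (2 * C0 / \<phi>lo * \<delta>)" .
    have "ennreal_powr (bochner_norm (ennreal s) T (ennreal s) \<Omega> m) s
      = (\<integral>\<^sup>+t. \<integral>\<^sup>+x. ennreal (norm (m t x) powr s) \<partial>\<mu> \<partial>lebesgue_on {0..T})"
      using s_gt_2 by (intro bochner_norm_powr) simp
    \<comment> \<open>Nonnegative integrals are monotone without measurability of the smaller
      integrand, so the integrable majorant takes the place of the dissipation.\<close>
    also have "\<dots> \<le> (\<integral>\<^sup>+t. ennreal (2 / mono_const * (?R t - ?e t)) \<partial>lebesgue_on {0..T})"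
    proof (rule nn_integral_mono_AE)
      show "AE t in lebesgue_on {0..T}. (\<integral>\<^sup>+x. ennreal (norm (m t x) powr s) \<partial>\<mu>) \<le> ennreal (2 / mono_const * (?R t - ?e t))"
        using ae inI
      proof eventually_elim
        case (elim t)
        have "integrable \<mu> (\<lambda>x. norm (m t x) powr s)"
          using s_gt_2 by (intro ess_bounded_integrable[OF fin] ess_bounded_norm_powr V_ess_bounded[OF memd(1)[OF elim(2)]]) auto
        then have "(\<integral>\<^sup>+x. ennreal (norm (m t x) powr s) \<partial>\<mu>) = ennreal (X t)"
          unfolding X_def by (rule nn_integral_eq_integral) simp
        moreover have "X t \<le> 2 / mono_const * (?R t - ?e t)"
          using elim(1) c by (simp add: field_simps)
        ultimately show ?case by (simp add: ennreal_leI)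
      qed
    qed
    also have "\<dots> = ennreal (\<integral>t. 2 / mono_const * (?R t - ?e t) \<partial>lebesgue_on {0..T})"
    proof (rule nn_integral_eq_integral)
      show "integrable (lebesgue_on {0..T}) (\<lambda>t. 2 / mono_const * (?R t - ?e t))"
        by (intro integrable_mult_right Bochner_Integration.integrable_diff[OF Ri en(1)])
      show "AE t in lebesgue_on {0..T}. 0 \<le> 2 / mono_const * (?R t - ?e t)"
        using ae
      proof (rule eventually_mono)
        fix t assume "?e t + mono_const / 2 * X t \<le> ?R t"
        moreover have "0 \<le> mono_const / 2 * X t" using c X0 by simp
        ultimately show "0 \<le> 2 / mono_const * (?R t - ?e t)" using c by (intro mult_nonneg_nonneg) auto
      qed
    qed
    also have "(\<integral>t. 2 / mono_const * (?R t - ?e t) \<partial>lebesgue_on {0..T})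
      = 2 / mono_const * ((\<integral>t. ?R t \<partial>lebesgue_on {0..T}) - (\<integral>t. ?e t \<partial>lebesgue_on {0..T}))"
      by (subst integral_mult_right_zero, subst Bochner_Integration.integral_diff[OF Ri en(1)]) (rule refl)
    also have "ennreal \<dots> \<le> ennreal (2 / mono_const * (C0 * \<delta>))"
    proof (intro ennreal_leI mult_left_mono)
      have TT: "T \<in> {0..T}" using T by simp
      show "(\<integral>t. ?R t \<partial>lebesgue_on {0..T}) - (\<integral>t. ?e t \<partial>lebesgue_on {0..T}) \<le> C0 * \<delta>"
        using R[OF TT] en(2)[OF TT] E0 E_nonneg[OF memd(2)[OF TT]] by linarith
    qed (use c in simp)
    finally have 2: "ennreal_powr (bochner_norm (ennreal s) T (ennreal s) \<Omega> m) s \<le> ennreal (2 / mono_const * (C0 * \<delta>))" .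
    have "(bochner_norm \<infinity> T 2 \<Omega> r)\<^sup>2 + ennreal_powr (bochner_norm (ennreal s) T (ennreal s) \<Omega> m) s
      \<le> ennreal (2 * C0 / \<phi>lo * \<delta>) + ennreal (2 / mono_const * (C0 * \<delta>))"
      by (rule add_mono[OF 1 2])
    also have "\<dots> = ennreal (2 * C0 / \<phi>lo * \<delta> + 2 / mono_const * (C0 * \<delta>))"
      using C0 \<phi>lo \<delta> c by (intro ennreal_plus[symmetric]) auto
    also have "\<dots> \<le> ennreal (C * \<delta>)"
      using \<delta> by (intro ennreal_leI) (simp add: C_def algebra_simps)
    also have "\<dots> = ennreal C * ennreal_powr (coeff_dist T \<Omega> N a1 a2) (s / (s - 1))"
      using C \<Delta> by (simp add: \<delta>_def ennreal_powr_ennreal ennreal_mult)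
    finally show ?thesis by (simp add: r_def[abs_def] m_def[abs_def])
  qed
  with C show thesis by (rule that)
qed

end

theorem theorem5p1:
  fixes \<Omega> :: "(real^'d) set"
    and T alo ahi b \<phi>lo \<phi>hi s s' \<alpha>m :: real
    and N k :: nat
    and \<alpha> :: "int \<Rightarrow> real"
    and D :: "(int \<Rightarrow> real) set"
    and \<phi> \<rho>0 :: "real^'d \<Rightarrow> real"
    and f \<psi> \<Psi> :: "real \<Rightarrow> real^'d \<Rightarrow> real"
    and H :: "real set"
    and \<T> :: "real \<Rightarrow> (real^'d) set set"
  assumes "CARD('d) \<ge> 2"
    and "open \<Omega>" and "bounded \<Omega>" and "C1_boundary \<Omega>"
    and "T > 0"
    and "N \<ge> 1"
    and "0 < \<alpha>m" and "\<alpha>m < 1" and "\<alpha> (-1) = - \<alpha>m" and "\<alpha> 0 = 0"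
    and "strict_mono_on {-1..int N} \<alpha>"
    and "s = \<alpha> (int N) + 2" and "s' = s / (s - 1)"
    and "0 < alo" and "alo \<le> ahi"
    and "compact D" and "D \<subseteq> coeff_box N alo ahi"
    and "0 < \<phi>lo" and "\<forall>x\<in>\<Omega>. \<phi>lo \<le> \<phi> x \<and> \<phi> x \<le> \<phi>hi"
    and "\<phi> \<in> borel_measurable (lebesgue_on \<Omega>)"
    and "in_bochner \<infinity> T 2 \<Omega> f"
    and "C12 T \<Omega> \<psi>"
    and "C12 T \<Omega> \<Psi>" and "\<forall>t\<in>{0..T}. \<forall>x\<in>frontier \<Omega>. \<Psi> t x = \<psi> t x"
    and "in_Lp 2 (lebesgue_on \<Omega>) \<rho>0"
    and "quasi_uniform_triangulations \<Omega> H \<T>"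
  shows "\<exists>C>0. \<forall>h\<in>H.
    \<forall>a1\<in>coeff_functions T \<Omega> N D b. \<forall>a2\<in>coeff_functions T \<Omega> N D b. \<forall>m1 m2 \<rho>1 \<rho>2.
      semidiscrete_solution \<Omega> T \<phi> f \<Psi> \<rho>0 N \<alpha> (V_space \<Omega> k (\<T> h)) (Q_space \<Omega> k (\<T> h)) a1 m1 \<rho>1 \<longrightarrow>
      semidiscrete_solution \<Omega> T \<phi> f \<Psi> \<rho>0 N \<alpha> (V_space \<Omega> k (\<T> h)) (Q_space \<Omega> k (\<T> h)) a2 m2 \<rho>2 \<longrightarrow>
      (bochner_norm \<infinity> T 2 \<Omega> (\<lambda>t x. \<rho>1 t x - \<rho>2 t x))\<^sup>2
        + ennreal_powr (bochner_norm (ennreal s) T (ennreal s) \<Omega> (\<lambda>t x. m1 t x - m2 t x)) s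
      \<le> ennreal C * ennreal_powr (coeff_dist T \<Omega> N a1 a2) s'"
proof -
  interpret forchheimer_problem N \<alpha> alo ahi s \<Omega> T \<phi>lo \<phi>hi b \<phi> \<rho>0 f \<Psi> D k
    by unfold_locales (use assms in auto)
  obtain C where C: "C > 0"
    and st: "\<And>\<T> a1 a2 m1 m2 r1 r2 r1' r2'. triangulation \<Omega> \<T> \<Longrightarrow>
      a1 \<in> coeff_functions T \<Omega> N D b \<Longrightarrow> a2 \<in> coeff_functions T \<Omega> N D b \<Longrightarrow>
      solves \<T> a1 m1 r1 r1' \<Longrightarrow> solves \<T> a2 m2 r2 r2' \<Longrightarrow>
      (bochner_norm \<infinity> T 2 \<Omega> (\<lambda>t x. r1 t x - r2 t x))\<^sup>2
        + ennreal_powr (bochner_norm (ennreal s) T (ennreal s) \<Omega> (\<lambda>t x. m1 t x - m2 t x)) s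
      \<le> ennreal C * ennreal_powr (coeff_dist T \<Omega> N a1 a2) (s / (s - 1))"
    by (rule stability) blast
  show ?thesis
  proof (intro exI[of _ C] conjI C ballI allI impI)
    fix h a1 a2 m1 m2 \<rho>1 \<rho>2
    assume h: "h \<in> H"
      and a: "a1 \<in> coeff_functions T \<Omega> N D b" "a2 \<in> coeff_functions T \<Omega> N D b"
      and sol: "semidiscrete_solution \<Omega> T \<phi> f \<Psi> \<rho>0 N \<alpha> (V (\<T> h)) (Q (\<T> h)) a1 m1 \<rho>1"
        "semidiscrete_solution \<Omega> T \<phi> f \<Psi> \<rho>0 N \<alpha> (V (\<T> h)) (Q (\<T> h)) a2 m2 \<rho>2"
    have tri: "triangulation \<Omega> (\<T> h)"
      using h \<open>quasi_uniform_triangulations \<Omega> H \<T>\<close> by (simp add: quasi_uniform_triangulations_def)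
    obtain r1' r2' where "solves (\<T> h) a1 m1 \<rho>1 r1'" "solves (\<T> h) a2 m2 \<rho>2 r2'"
      using semidiscrete_solution_solves[OF sol(1)] semidiscrete_solution_solves[OF sol(2)] by metis
    from st[OF tri a this]
    show "(bochner_norm \<infinity> T 2 \<Omega> (\<lambda>t x. \<rho>1 t x - \<rho>2 t x))\<^sup>2
        + ennreal_powr (bochner_norm (ennreal s) T (ennreal s) \<Omega> (\<lambda>t x. m1 t x - m2 t x)) s
      \<le> ennreal C * ennreal_powr (coeff_dist T \<Omega> N a1 a2) s'"
      by (simp only: \<open>s' = s / (s - 1)\<close>)
  qed
qed

end
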